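(* Let $W\in\{0,1,2,\dots\}$. (i) Let $P$ be an odd prime and $m$ a positive integer with either ($P\ge5$ and $m\ge 2$) or ($P\ge 3$ and $m\ge 3$); let $q=P^m$. Then there exist at least two $(q+W-6)$-dimensional orbifold lens spaces with groups of order $P^m$ which are isospectral but not isometric. (ii) Let $P_1\ne P_2$ be odd primes with $q=P_1P_2\ge 33$. Then there exist at least two $(q+W-6)$-dimensional orbifold lens spaces with groups of order $P_1P_2$ which are isospectral but not isometric. (iii) Let $q=2^m$ with $m\ge 6$. Then there exist at least two $(q+W-5)$-dimensional orbifold lens spaces with groups of order $2^m$ which are isospectral but not isometric. (iv) Let $q=2P$ with $P\ge 7$ an odd prime. Then there exist at least two $(q+W-5)$-dimensional orbifold lens spaces with groups of order $2P$ which are isospectral but not isometric.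
   Context: Let $R(\theta)=\begin{pmatrix}\cos 2\pi\theta & \sin 2\pi\theta\\ -\sin 2\pi\theta & \cos 2\pi\theta\end{pmatrix}$. For integers $q\ge 2$, $n\ge1$, $W\ge 0$ and integers $p_1,\dots,p_n$ with $\gcd(p_1,\dots,p_n,q)=1$, let $g=\mathrm{diag}(R(p_1/q),\dots,R(p_n/q),I_W)\in O(2n+W)$ ($I_W$ the $W\times W$ identity) and $G=\langle g\rangle$, cyclic of order $q$ (the group of the lens space). The orbifold lens space $L^{(W)}(q:p_1,\dots,p_n)=S^{2n+W-1}/G$, where $S^{2n+W-1}$ is the round unit sphere, is a $(2n+W-1)$-dimensional Riemannian orbifold with the induced metric; the $p_i$ need not be coprime to $q$, so $G$ may have fixed points. Its spectrum is the spectrum (with multiplicities) of the Laplacian acting on $G$-invariant smooth functions on the sphere; isospectral means equal spectra. In this theorem "orbifold lens space" means a space $L^{(W)}(q:p_1,\dots,p_n)$ of this form. *)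

theory Defs
  imports "HOL-Analysis.Analysis"
begin

text \<open>Points of R^N are represented as functions nat => real whose coordinates
  with index >= N vanish.  An orbifold lens space L^(W)(q : p_1,...,p_n) is
  represented by the triple (q, [p_1,...,p_n], W).\<close>

type_synonym pt = "nat \<Rightarrow> real"
type_synonym lens = "nat \<times> int list \<times> nat"

definition valid_lens :: "lens \<Rightarrow> bool" where
  "valid_lens L = (case L of (q, ps, W) \<Rightarrow>
      q \<ge> 2 \<and> ps \<noteq> [] \<and>
      (\<forall>d::int. d dvd int q \<and> (\<forall>p\<in>set ps. d dvd p) \<longrightarrow> d dvd 1))"

definition lens_N :: "lens \<Rightarrow> nat" where
  "lens_N L = (case L of (q, ps, W) \<Rightarrow> 2 * length ps + W)"

definition lens_dim :: "lens \<Rightarrow> nat" where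
  "lens_dim L = lens_N L - 1"

definition lens_order :: "lens \<Rightarrow> nat" where
  "lens_order L = fst L"

definition sphere_pts :: "nat \<Rightarrow> pt set" where
  "sphere_pts N = {x. (\<forall>i\<ge>N. x i = 0) \<and> (\<Sum>i<N. (x i)^2) = 1}"

text \<open>Action of g^k, where g = diag(R(p_1/q),...,R(p_n/q),I_W) and
  R(t) = [[cos 2 pi t, sin 2 pi t], [- sin 2 pi t, cos 2 pi t]].\<close>
definition lens_act :: "lens \<Rightarrow> int \<Rightarrow> pt \<Rightarrow> pt" where
  "lens_act L k x = (case L of (q, ps, W) \<Rightarrow>
     (\<lambda>j. if j < 2 * length ps then
            (let th = 2 * pi * real_of_int (k * ps ! (j div 2)) / real q in
             if even j then cos th * x j + sin th * x (Suc j)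
             else - sin th * x (j - 1) + cos th * x j)
          else x j))"

definition lens_invariant :: "lens \<Rightarrow> (pt \<Rightarrow> real) \<Rightarrow> bool" where
  "lens_invariant L f =
     (\<forall>x\<in>sphere_pts (lens_N L). \<forall>k<lens_order L. f (lens_act L (int k) x) = f x)"

fun pds :: "nat list \<Rightarrow> (pt \<Rightarrow> real) \<Rightarrow> pt \<Rightarrow> real" where
  "pds [] F = F"
| "pds (i # is) F = (\<lambda>x. deriv (\<lambda>t. pds is F (x(i := x i + t))) 0)"

definition punctured :: "nat \<Rightarrow> pt set" where
  "punctured N = {x. (\<forall>i\<ge>N. x i = 0) \<and> x \<noteq> (\<lambda>_. 0)}"

definition smooth_punct :: "nat \<Rightarrow> (pt \<Rightarrow> real) \<Rightarrow> bool" where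
  "smooth_punct N F =
     (\<forall>is. set is \<subseteq> {..<N} \<longrightarrow>
        continuous_on (punctured N) (pds is F) \<and>
        (\<forall>i<N. \<forall>x\<in>punctured N. (\<lambda>t. pds is F (x(i := x i + t))) differentiable (at 0)))"

definition ext0 :: "nat \<Rightarrow> (pt \<Rightarrow> real) \<Rightarrow> pt \<Rightarrow> real" where
  "ext0 N f = (\<lambda>y. f (\<lambda>i. y i / sqrt (\<Sum>j<N. (y j)^2)))"

text \<open>Laplace-Beltrami operator of the round sphere S^(N-1): the Euclidean
  Laplacian of the 0-homogeneous extension, restricted to the sphere.\<close>
definition sph_laplacian :: "nat \<Rightarrow> (pt \<Rightarrow> real) \<Rightarrow> pt \<Rightarrow> real" where
  "sph_laplacian N f x = (\<Sum>i<N. pds [i, i] (ext0 N f) x)"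

definition lens_eigenfun :: "lens \<Rightarrow> real \<Rightarrow> (pt \<Rightarrow> real) \<Rightarrow> bool" where
  "lens_eigenfun L lam f =
     (smooth_punct (lens_N L) (ext0 (lens_N L) f) \<and> lens_invariant L f \<and>
      (\<forall>x\<in>sphere_pts (lens_N L). sph_laplacian (lens_N L) f x = - lam * f x))"

definition eig_mult :: "lens \<Rightarrow> real \<Rightarrow> nat \<Rightarrow> bool" where
  "eig_mult L lam d =
     (\<exists>fs. length fs = d \<and> (\<forall>f\<in>set fs. lens_eigenfun L lam f) \<and>
        (\<forall>c::nat \<Rightarrow> real. (\<forall>x\<in>sphere_pts (lens_N L). (\<Sum>j<d. c j * (fs ! j) x) = 0)
              \<longrightarrow> (\<forall>j<d. c j = 0)) \<and>
        (\<forall>f. lens_eigenfun L lam f \<longrightarrow>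
              (\<exists>c::nat \<Rightarrow> real. \<forall>x\<in>sphere_pts (lens_N L). f x = (\<Sum>j<d. c j * (fs ! j) x))))"

definition isospectral :: "lens \<Rightarrow> lens \<Rightarrow> bool" where
  "isospectral L1 L2 = (\<forall>lam d. eig_mult L1 lam d \<longleftrightarrow> eig_mult L2 lam d)"

definition sph_dist :: "nat \<Rightarrow> pt \<Rightarrow> pt \<Rightarrow> real" where
  "sph_dist N x y = arccos (\<Sum>i<N. x i * y i)"

definition orbit_dist :: "lens \<Rightarrow> pt \<Rightarrow> pt \<Rightarrow> real" where
  "orbit_dist L x y =
     Min ((\<lambda>k. sph_dist (lens_N L) x (lens_act L (int k) y)) ` {..<lens_order L})"

text \<open>Isometry of the orbit spaces (as metric spaces), expressed on representatives.\<close>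
definition lens_isometric :: "lens \<Rightarrow> lens \<Rightarrow> bool" where
  "lens_isometric L1 L2 =
     (\<exists>\<Phi>. (\<forall>x\<in>sphere_pts (lens_N L1). \<Phi> x \<in> sphere_pts (lens_N L2)) \<and>
          (\<forall>x\<in>sphere_pts (lens_N L1). \<forall>y\<in>sphere_pts (lens_N L1).
              orbit_dist L2 (\<Phi> x) (\<Phi> y) = orbit_dist L1 x y) \<and>
          (\<forall>z\<in>sphere_pts (lens_N L2). \<exists>x\<in>sphere_pts (lens_N L1).
              orbit_dist L2 (\<Phi> x) z = 0))"

definition isospec_noniso_pair :: "nat \<Rightarrow> nat \<Rightarrow> bool" where
  "isospec_noniso_pair q d =
     (\<exists>L1 L2. valid_lens L1 \<and> valid_lens L2 \<and>
        lens_order L1 = q \<and> lens_order L2 = q \<and>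
        lens_dim L1 = d \<and> lens_dim L2 = d \<and>
        isospectral L1 L2 \<and> \<not> lens_isometric L1 L2)"

end

theory Submission
  imports Defs "HOL-Library.Function_Algebras"
begin

text \<open>
  The rotation numbers of both lens spaces are \<open>1, \<dots>, q div 2\<close> with two numbers deleted:
  1 and a for the first space, 1 and b for the second.

  Isospectrality. A smooth eigenfunction on the sphere is the restriction of a harmonic
  polynomial, because the spherical Laplacian is self-adjoint and polynomials are dense. Hence the
  multiplicities are dimensions of spaces of invariant harmonic polynomials, and by Molien's formula
  the generating function of the invariants of degree k is the average over j of \<open>1 / D(j)\<close>, where
  \<open>D(j)\<close> is the reversed characteristic polynomial of the j-th power of the generator. Deleting a plane
  multiplies the summand by \<open>1 - 2 z cos (2 \<pi> j p / q) + z\<^sup>2\<close>. The product of two such factors is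
  linear in the cosines of \<open>j\<close>, \<open>j a\<close>, \<open>j (1 + a)\<close> and \<open>j (1 - a)\<close> (times \<open>2 \<pi> / q\<close>), and since the
  full product over \<open>1, \<dots>, q div 2\<close> is unchanged when j is multiplied by a unit modulo q, the sum
  over j depends on each of these multipliers only up to units.

  Non-isometry. An isometry of the quotients lifts near a point with trivial stabilizer to a linear
  isometry of the sphere. Comparing nearest points of orbits shows that this linear map conjugates a
  generator into the other group. The rotation numbers are therefore related by a multiplier c modulo q
  and sign, so c also maps the deleted pair \<open>{1, b}\<close> to \<open>{1, a}\<close>, which forces \<open>a = b\<close> or
  \<open>a b = \<plusminus>1\<close> modulo q.
\<close>

section \<open>Derivatives in coordinate directions\<close>

text \<open>No surface measure enters: \<open>ip\<close> integrates 0-homogeneous extensions over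
  the shell \<open>1 < nsq N x < 2\<close> with a radial cutoff, so that Fubini and the fundamental
  theorem on coordinate lines yield Green's identity.

  In the non-isometry the obstacle is that the given map only matches orbits. It need not be
  continuous, and its corrected version is linear only near one point u. Points far away are reached
  through nearest points: if \<open>g k0\<close> displaces u least, then
  \<open>m = u + g k0 u\<close> and \<open>g (- k0) m\<close> are equally near to u, and arbitrarily
  small moves of u select either one. Both are carried into one orbit of the other group, which
  relates the linear map to \<open>g (- k0)\<close>. The group element found this way depends on the
  point; infinitely many points of a polynomial curve make it constant.

  The choice of a and b comes from the four multipliers: up to units modulo q, a must agree with b,
  and the pair 1 + a, 1 - a with the pair 1 + b, 1 - b. Since \<open>q div 2 - 2\<close> planes
  remain, the dimension is q + W - 6 for odd q and q + W - 5 for even q.\<close>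

definition vecs :: "nat \<Rightarrow> pt set" where
  "vecs N = {x. \<forall>i\<ge>N. x i = 0}"

definition nsq :: "nat \<Rightarrow> pt \<Rightarrow> real" where
  "nsq N x = (\<Sum>i<N. (x i)\<^sup>2)"

text \<open>The function of t is the one to which \<open>pds\<close> applies \<open>deriv\<close>,
  so chains of \<open>has_pd\<close> compute iterated \<open>pds\<close>.\<close>

definition has_pd :: "nat \<Rightarrow> nat \<Rightarrow> (pt \<Rightarrow> real) \<Rightarrow> (pt \<Rightarrow> real) \<Rightarrow> bool" where
  "has_pd N i F F' \<longleftrightarrow>
    (\<forall>x\<in>punctured N. ((\<lambda>t. F (x(i := x i + t))) has_real_derivative F' x) (at 0))"

lemma sphere_pts_iff: "x \<in> sphere_pts N \<longleftrightarrow> x \<in> vecs N \<and> nsq N x = 1"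
  by (auto simp: sphere_pts_def vecs_def nsq_def)

lemma nsq_nonneg: "nsq N x \<ge> 0"
  by (auto simp: nsq_def intro: sum_nonneg)

lemma nsq_eq_0_iff: "x \<in> vecs N \<Longrightarrow> nsq N x = 0 \<longleftrightarrow> x = (\<lambda>_. 0)"
proof -
  assume x: "x \<in> vecs N"
  have "nsq N x = 0 \<longleftrightarrow> (\<forall>i<N. x i = 0)"
    by (auto simp: nsq_def sum_nonneg_eq_0_iff)
  also have "\<dots> \<longleftrightarrow> x = (\<lambda>_. 0)"
    using x by (auto simp: vecs_def fun_eq_iff) (metis linorder_not_less)
  finally show ?thesis .
qed

lemma nsq_pos: "x \<in> punctured N \<Longrightarrow> nsq N x > 0"
  using nsq_eq_0_iff[of x N] nsq_nonneg[of N x]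
  by (auto simp: punctured_def vecs_def less_le)

lemma punctured_iff: "x \<in> punctured N \<longleftrightarrow> x \<in> vecs N \<and> nsq N x > 0"
  using nsq_pos by (auto simp: punctured_def vecs_def nsq_def)

lemma sphere_pts_punctured: "sphere_pts N \<subseteq> punctured N"
  by (auto simp: sphere_pts_iff punctured_iff)

lemma nsq_scale: "nsq N (\<lambda>i. c * x i) = c\<^sup>2 * nsq N x"
  by (simp add: nsq_def power_mult_distrib sum_distrib_left)

lemma nsq_upd:
  assumes "i < N"
  shows "nsq N (x(i := x i + t)) = nsq N x + 2 * t * x i + t\<^sup>2"
proof -
  have "nsq N (x(i := x i + t)) = (x i + t)\<^sup>2 + (\<Sum>j\<in>{..<N}-{i}. (x j)\<^sup>2)"
    using assms by (simp add: nsq_def sum.remove[of _ i])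
  moreover have "nsq N x = (x i)\<^sup>2 + (\<Sum>j\<in>{..<N}-{i}. (x j)\<^sup>2)"
    using assms by (simp add: nsq_def sum.remove[of _ i])
  ultimately show ?thesis by (simp add: power2_eq_square algebra_simps)
qed

lemma vecs_upd: "x \<in> vecs N \<Longrightarrow> i < N \<Longrightarrow> x(i := s) \<in> vecs N"
  by (auto simp: vecs_def)

lemma punctured_scale: "x \<in> punctured N \<Longrightarrow> c \<noteq> 0 \<Longrightarrow> (\<lambda>i. c * x i) \<in> punctured N"
  by (auto simp: punctured_iff vecs_def nsq_scale)

definition proj :: "nat \<Rightarrow> pt \<Rightarrow> pt" where
  "proj N y = (\<lambda>i. y i / sqrt (nsq N y))"

lemma ext0_proj: "ext0 N f y = f (proj N y)"
  by (simp add: ext0_def proj_def nsq_def)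

lemma proj_sphere: "y \<in> punctured N \<Longrightarrow> proj N y \<in> sphere_pts N"
proof -
  assume y: "y \<in> punctured N"
  have "proj N y = (\<lambda>i. (1 / sqrt (nsq N y)) * y i)" by (simp add: proj_def)
  then have "nsq N (proj N y) = (1 / sqrt (nsq N y))\<^sup>2 * nsq N y"
    by (simp only: nsq_scale)
  also have "\<dots> = 1" using nsq_pos[OF y] by (simp add: power_divide)
  finally show ?thesis using y by (auto simp: sphere_pts_iff proj_def punctured_iff vecs_def)
qed

lemma proj_id: "x \<in> sphere_pts N \<Longrightarrow> proj N x = x"
  by (simp add: proj_def sphere_pts_iff)

lemma ext0_id: "x \<in> sphere_pts N \<Longrightarrow> ext0 N f x = f x"
  by (simp add: ext0_proj proj_id)

lemma proj_scale: "c > 0 \<Longrightarrow> proj N (\<lambda>i. c * x i) = proj N x"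
  by (auto simp: proj_def nsq_scale real_sqrt_mult)

lemma continuous_on_coord:
  "continuous_on S (\<lambda>x::nat \<Rightarrow> real. x i)"
  by (rule continuous_on_subset[OF continuous_on_product_coordinates]) simp

lemma continuous_on_nsq [continuous_intros]: "continuous_on S (nsq N)"
  unfolding nsq_def by (intro continuous_on_sum continuous_on_power continuous_on_coord)

lemma continuous_on_upd [continuous_intros]:
  fixes x :: pt
  shows "continuous_on S f \<Longrightarrow> continuous_on S (\<lambda>t. x(i := f t))"
proof (rule continuous_on_coordinatewise_then_product)
  fix j assume "continuous_on S f"
  then show "continuous_on S (\<lambda>t. (x(i := f t)) j)"
    by (cases "j = i") auto
qed

lemma continuous_on_proj: "continuous_on (punctured N) (proj N)"
  unfolding proj_def
  by (rule continuous_on_coordinatewise_then_product)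
     (use nsq_pos in \<open>auto intro!: continuous_intros continuous_on_coord simp: less_imp_neq[THEN not_sym]\<close>)

lemma eventually_punctured_upd:
  assumes "x \<in> punctured N" "i < N"
  shows "eventually (\<lambda>t. x(i := x i + t) \<in> punctured N) (nhds 0)"
proof -
  have "((\<lambda>t. nsq N x + 2 * t * x i + t\<^sup>2) \<longlongrightarrow> nsq N x + 2 * 0 * x i + 0\<^sup>2) (nhds 0)"
    by (intro tendsto_intros filterlim_ident)
  then have "eventually (\<lambda>t. 0 < nsq N x + 2 * t * x i + t\<^sup>2) (nhds 0)"
    using nsq_pos[OF assms(1)] by (intro order_tendstoD) auto
  then show ?thesis
    by eventually_elim (use assms in \<open>auto simp: punctured_iff nsq_upd vecs_upd\<close>)
qed

lemma has_pd_deriv: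
  assumes "has_pd N i F F'" "x \<in> punctured N"
  shows "deriv (\<lambda>t. F (x(i := x i + t))) 0 = F' x"
  using assms by (auto simp: has_pd_def intro!: DERIV_imp_deriv)

lemma has_pd_cong:
  assumes "has_pd N i F F'" "i < N"
    and "\<And>x. x \<in> punctured N \<Longrightarrow> F x = G x" "\<And>x. x \<in> punctured N \<Longrightarrow> F' x = G' x"
  shows "has_pd N i G G'"
  unfolding has_pd_def
proof
  fix x assume x: "x \<in> punctured N"
  have "eventually (\<lambda>t. F (x(i := x i + t)) = G (x(i := x i + t))) (nhds 0)"
    using eventually_punctured_upd[OF x assms(2)] by eventually_elim (use assms in auto)
  then show "((\<lambda>t. G (x(i := x i + t))) has_real_derivative G' x) (at 0)"
    using assms(1) assms(4)[OF x] x DERIV_cong_ev[OF refl _ refl]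
    by (metis has_pd_def)
qed

text \<open>A formula for \<open>pds is H\<close> is usually known on the punctured space only.
  Coordinate lines stay there for small t, so it can still be differentiated.\<close>

lemma pds_step:
  assumes "has_pd N i F F'" "i < N" "\<And>x. x \<in> punctured N \<Longrightarrow> pds is H x = F x"
    and "x \<in> punctured N"
  shows "pds (i # is) H x = F' x"
    "((\<lambda>t. pds is H (x(i := x i + t))) has_real_derivative F' x) (at 0)"
proof -
  have "has_pd N i (pds is H) F'"
    by (rule has_pd_cong[OF assms(1,2)]) (use assms(3) in auto)
  from has_pd_deriv[OF this assms(4)] this
  show "pds (i # is) H x = F' x"
    "((\<lambda>t. pds is H (x(i := x i + t))) has_real_derivative F' x) (at 0)"
    using assms(4) by (auto simp: has_pd_def)
qed

lemma has_pd_add: "has_pd N i F F' \<Longrightarrow> has_pd N i G G' \<Longrightarrow> has_pd N i (\<lambda>x. F x + G x) (\<lambda>x. F' x + G' x)"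
  by (auto simp: has_pd_def intro!: derivative_intros)

lemma has_pd_mult: "has_pd N i F F' \<Longrightarrow> has_pd N i G G' \<Longrightarrow>
   has_pd N i (\<lambda>x. F x * G x) (\<lambda>x. F' x * G x + F x * G' x)"
  by (auto simp: has_pd_def intro!: derivative_eq_intros)

lemma has_pd_const: "has_pd N i (\<lambda>x. c) (\<lambda>x. 0)"
  by (auto simp: has_pd_def)

lemma has_pd_coord: "has_pd N i (\<lambda>x. x j) (\<lambda>x. if j = i then 1 else 0)"
  by (auto simp: has_pd_def intro!: derivative_eq_intros)

lemma has_pd_nsq: "i < N \<Longrightarrow> has_pd N i (nsq N) (\<lambda>x. 2 * x i)"
  by (auto simp: has_pd_def nsq_upd intro!: derivative_eq_intros)

lemma has_pd_chain:
  assumes "has_pd N i F F'" "\<And>x. x \<in> punctured N \<Longrightarrow> (h has_real_derivative h' (F x)) (at (F x))"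
  shows "has_pd N i (\<lambda>x. h (F x)) (\<lambda>x. h' (F x) * F' x)"
  unfolding has_pd_def
proof
  fix x assume x: "x \<in> punctured N"
  show "((\<lambda>t. h (F (x(i := x i + t)))) has_real_derivative h' (F x) * F' x) (at 0)"
    using DERIV_chain2[of h "h' (F x)" "\<lambda>t. F (x(i := x i + t))" 0 "F' x"] assms x
    by (auto simp: has_pd_def)
qed

text \<open>Powers of this function make polynomials homogeneous of degree 0.\<close>
definition inv_norm :: "nat \<Rightarrow> pt \<Rightarrow> real" where
  "inv_norm N x = 1 / sqrt (nsq N x)"

lemma has_pd_inv_norm: "i < N \<Longrightarrow> has_pd N i (inv_norm N) (\<lambda>x. - x i * inv_norm N x ^ 3)"
proof -
  assume i: "i < N"
  have "((\<lambda>u. 1 / sqrt u) has_real_derivative - (1 / 2) * (1 / sqrt u) ^ 3) (at u)" if "u > 0" for u :: real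
    using that by (auto intro!: derivative_eq_intros simp: field_simps power3_eq_cube)
  then have "has_pd N i (\<lambda>x. 1 / sqrt (nsq N x)) (\<lambda>x. - (1/2) * (1 / sqrt (nsq N x)) ^ 3 * (2 * x i))"
    by (intro has_pd_chain[OF has_pd_nsq[OF i]]) (use nsq_pos in auto)
  then show ?thesis
    by (rule has_pd_cong) (use i in \<open>auto simp: inv_norm_def\<close>)
qed

text \<open>An algebra of functions closed under every coordinate derivative:
  \<open>inv_norm\<close> differentiates into \<open>- x i * inv_norm N x ^ 3\<close>. Smoothness of
  all orders follows at once, and the 0-homogeneous extension of a homogeneous polynomial agrees
  with a member.\<close>

inductive_set nice :: "nat \<Rightarrow> (pt \<Rightarrow> real) set" for N where
  const: "(\<lambda>x. c) \<in> nice N"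
| coord: "i < N \<Longrightarrow> (\<lambda>x. x i) \<in> nice N"
| inv_norm: "inv_norm N \<in> nice N"
| add: "F \<in> nice N \<Longrightarrow> G \<in> nice N \<Longrightarrow> (\<lambda>x. F x + G x) \<in> nice N"
| mult: "F \<in> nice N \<Longrightarrow> G \<in> nice N \<Longrightarrow> (\<lambda>x. F x * G x) \<in> nice N"

lemma nice_power: "F \<in> nice N \<Longrightarrow> (\<lambda>x. F x ^ k) \<in> nice N"
  by (induction k) (auto intro: nice.intros)

lemma nice_cont: "F \<in> nice N \<Longrightarrow> continuous_on (punctured N) F"
proof (induction rule: nice.induct)
  case inv_norm
  show ?case unfolding inv_norm_def
    by (intro continuous_intros) (use nsq_pos in \<open>auto simp: less_imp_neq[THEN not_sym]\<close>)
qed (auto intro!: continuous_intros continuous_on_coord)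

lemma nice_pd: "F \<in> nice N \<Longrightarrow> i < N \<Longrightarrow> \<exists>F'\<in>nice N. has_pd N i F F'"
proof (induction rule: nice.induct)
  case (const c)
  then show ?case using has_pd_const nice.const by blast
next
  case (coord j)
  show ?case
    by (rule bexI[of _ "\<lambda>x. if j = i then 1 else 0"]) (use has_pd_coord[of N i j] in \<open>auto intro: nice.const\<close>)
next
  case inv_norm
  have "(\<lambda>x. - x i * inv_norm N x ^ 3) = (\<lambda>x. (\<lambda>_. -1) x * (x i * inv_norm N x ^ 3))" by simp
  also have "\<dots> \<in> nice N" by (intro nice.mult nice.const nice_power nice.inv_norm nice.coord inv_norm)
  finally show ?case using has_pd_inv_norm[OF inv_norm] by blast
next
  case (add F G)
  obtain F' where F: "F' \<in> nice N" "has_pd N i F F'" using add.IH(1)[OF add.prems] by blast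
  obtain G' where G: "G' \<in> nice N" "has_pd N i G G'" using add.IH(2)[OF add.prems] by blast
  show ?case
    by (rule bexI[of _ "\<lambda>x. F' x + G' x"]) (intro has_pd_add nice.add F G)+
next
  case (mult F G)
  obtain F' where F: "F' \<in> nice N" "has_pd N i F F'" using mult.IH(1)[OF mult.prems] by blast
  obtain G' where G: "G' \<in> nice N" "has_pd N i G G'" using mult.IH(2)[OF mult.prems] by blast
  show ?case
    by (rule bexI[of _ "\<lambda>x. F' x * G x + F x * G' x"])
      (intro has_pd_mult nice.add nice.mult F G mult.hyps)+
qed

lemma nice_smooth:
  assumes "F \<in> nice N"
  shows "smooth_punct N F"
proof -
  have *: "\<exists>K\<in>nice N. \<forall>x\<in>punctured N. pds is F x = K x" if "set is \<subseteq> {..<N}" for "is"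
    using that
  proof (induction "is")
    case Nil
    then show ?case using assms by auto
  next
    case (Cons i "is")
    then obtain K where K: "K \<in> nice N" "\<And>x. x \<in> punctured N \<Longrightarrow> pds is F x = K x" by auto
    obtain K' where "K' \<in> nice N" "has_pd N i K K'" using nice_pd[OF K(1), of i] Cons.prems by auto
    then show ?case using pds_step(1)[of N i K K' "is" F] Cons.prems K by (intro bexI[of _ K']) auto
  qed
  show ?thesis unfolding smooth_punct_def
  proof (intro allI impI conjI ballI)
    fix "is" :: "nat list" assume "set is \<subseteq> {..<N}"
    then obtain K where K: "K \<in> nice N" "\<And>x. x \<in> punctured N \<Longrightarrow> pds is F x = K x" using * by blast
    show "continuous_on (punctured N) (pds is F)"
      by (rule continuous_on_eq[OF nice_cont[OF K(1)]]) (simp add: K(2))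
    fix i x assume i: "i < N" and x: "x \<in> punctured N"
    obtain K' where "K' \<in> nice N" "has_pd N i K K'" using nice_pd[OF K(1) i] by auto
    then show "(\<lambda>t. pds is F (x(i := x i + t))) differentiable (at 0)"
      using pds_step(2)[of N i K K' "is" F x] i x K(2) by (auto simp: real_differentiable_def)
  qed
qed

lemma smooth_punct_has_pd:
  assumes "smooth_punct N F" "set is \<subseteq> {..<N}" "i < N"
  shows "has_pd N i (pds is F) (pds (i # is) F)"
  using assms by (auto simp: has_pd_def smooth_punct_def DERIV_deriv_iff_real_differentiable)

lemma pds_cong:
  assumes "\<And>x. x \<in> punctured N \<Longrightarrow> F x = G x" "set is \<subseteq> {..<N}" "x \<in> punctured N"
  shows "pds is F x = pds is G x"
  using assms(2,3)
proof (induction "is" arbitrary: x)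
  case Nil
  then show ?case using assms(1) by simp
next
  case (Cons i "is")
  have "eventually (\<lambda>t. pds is F (x(i := x i + t)) = pds is G (x(i := x i + t))) (nhds 0)"
    using eventually_punctured_upd[of x N i] Cons.prems
    by (auto elim!: eventually_mono intro!: Cons.IH)
  then show ?case by (simp add: deriv_cong_ev)
qed

lemma smooth_punct_cong:
  assumes "\<And>x. x \<in> punctured N \<Longrightarrow> F x = G x" "smooth_punct N F"
  shows "smooth_punct N G"
  unfolding smooth_punct_def
proof (intro allI impI conjI ballI)
  fix "is" :: "nat list" assume S: "set is \<subseteq> {..<N}"
  have eq: "pds is F x = pds is G x" if "x \<in> punctured N" for x
    by (rule pds_cong) (use assms S that in auto)
  show "continuous_on (punctured N) (pds is G)"
    by (rule continuous_on_eq[of _ "pds is F"]) (use assms(2) S eq in \<open>auto simp: smooth_punct_def\<close>)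
  fix i x assume i: "i < N" and x: "x \<in> punctured N"
  have "has_pd N i (pds is G) (pds (i # is) F)"
    by (rule has_pd_cong[OF smooth_punct_has_pd[OF assms(2) S i] i]) (use eq in auto)
  then show "(\<lambda>t. pds is G (x(i := x i + t))) differentiable (at 0)"
    using x by (auto simp: has_pd_def real_differentiable_def)
qed

section \<open>Integration and self-adjointness of the spherical Laplacian\<close>

text \<open>Only derivatives along coordinate lines are at hand, not a total derivative. The radial
  step from x to its multiple by 1 + t is therefore split into N coordinate steps, each treated by
  the mean value theorem; continuity of the partial derivatives gives the limit.\<close>

lemma euler_homogeneous:
  assumes pd: "\<And>i. i < N \<Longrightarrow> has_pd N i F (F' i)"
    and cont: "\<And>i. i < N \<Longrightarrow> continuous_on (punctured N) (F' i)"
    and hom: "\<And>c x. c > 0 \<Longrightarrow> x \<in> punctured N \<Longrightarrow> F (\<lambda>i. c * x i) = F x"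
    and x: "x \<in> punctured N"
  shows "(\<Sum>i<N. x i * F' i x) = 0"
proof -
  \<comment> \<open>\<open>z n t\<close> is the point reached after the first n coordinate
    steps.\<close>
  define z where "z n t = (\<lambda>i. if i < n then (1 + t) * x i else x i)" for n :: nat and t :: real
  have pos: "(\<lambda>i. c i * x i) \<in> punctured N" if "\<And>i. c i > 0" for c :: "nat \<Rightarrow> real"
    using x that by (auto simp: punctured_def fun_eq_iff) (metis less_irrefl)
  have lim: "((\<lambda>t. (F (z n t) - F x) / t) \<longlongrightarrow> (\<Sum>i<n. x i * F' i x)) (at_right 0)" if "n \<le> N" for n
    using that
  proof (induction n)
    case 0
    have "z 0 t = x" for t by (simp add: z_def)
    then show ?case by simp
  next
    case (Suc n)
    define y where "y t s = (z n t)(n := (1 + s) * x n)" for t s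
    have yp: "y t s \<in> punctured N" if "t > 0" "s \<ge> 0" for t s
    proof -
      have "y t s = (\<lambda>i. (if i = n then 1 + s else if i < n then 1 + t else 1) * x i)"
        by (auto simp: y_def z_def)
      then show ?thesis using that by (auto intro!: pos)
    qed
    have der: "((\<lambda>s. F (y t s)) has_real_derivative x n * F' n (y t s)) (at s)" if "t > 0" "s \<ge> 0" for t s
    proof -
      have "((\<lambda>r. F ((y t s)(n := y t s n + r))) has_real_derivative F' n (y t s)) (at 0)"
        using pd[of n] Suc.prems yp[OF that] by (auto simp: has_pd_def)
      then have "((\<lambda>r. F ((y t s)(n := y t s n + r))) has_real_derivative F' n (y t s)) (at ((s - s) * x n))"
        by simp
      moreover have "((\<lambda>s'. (s' - s) * x n) has_real_derivative x n) (at s)"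
        by (auto intro!: derivative_eq_intros)
      ultimately have "((\<lambda>s'. F ((y t s)(n := y t s n + (s' - s) * x n))) has_real_derivative
          F' n (y t s) * x n) (at s)"
        by (rule DERIV_chain2[where g="\<lambda>s'. (s' - s) * x n"])
      moreover have "(y t s)(n := y t s n + (s' - s) * x n) = y t s'" for s'
        by (auto simp: y_def algebra_simps)
      ultimately show ?thesis by (simp add: mult.commute)
    qed
    have "\<exists>s. 0 < s \<and> s < t \<and> F (z (Suc n) t) - F (z n t) = t * (x n * F' n (y t s))" if t: "t > 0" for t
    proof -
      have "\<exists>s. 0 < s \<and> s < t \<and> F (y t t) - F (y t 0) = (t - 0) * (x n * F' n (y t s))"
        using t by (intro MVT2) (auto intro!: der)
      moreover have "y t t = z (Suc n) t" "y t 0 = z n t"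
        by (auto simp: y_def z_def fun_eq_iff less_Suc_eq)
      ultimately show ?thesis by simp
    qed
    then obtain s where s: "\<And>t. t > 0 \<Longrightarrow> 0 < s t \<and> s t < t \<and>
         F (z (Suc n) t) - F (z n t) = t * (x n * F' n (y t (s t)))" by metis
    have s0: "(s \<longlongrightarrow> 0) (at_right 0)"
    proof (rule tendsto_sandwich[of "\<lambda>_. 0" _ _ "\<lambda>t. t"])
      show "eventually (\<lambda>t. 0 \<le> s t) (at_right 0)" "eventually (\<lambda>t. s t \<le> t) (at_right 0)"
        using s by (auto simp: eventually_at_filter intro!: always_eventually less_imp_le)
    qed (auto intro: tendsto_ident_at)
    have contY: "continuous_on UNIV (\<lambda>(t, s). y t s)"
    proof (rule continuous_on_coordinatewise_then_product)
      fix i show "continuous_on UNIV (\<lambda>p. (case p of (t, s) \<Rightarrow> y t s) i)"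
        unfolding y_def z_def case_prod_unfold
        by (cases "i = n"; cases "i < n") (auto intro!: continuous_intros)
    qed
    have "((\<lambda>t. y t (s t)) \<longlongrightarrow> y 0 0) (at_right 0)"
      using continuous_on_tendsto_compose[OF contY tendsto_Pair[OF tendsto_ident_at s0]]
      by (auto simp: case_prod_unfold)
    moreover have y00: "y 0 0 = x" by (auto simp: y_def z_def)
    ultimately have "((\<lambda>t. F' n (y t (s t))) \<longlongrightarrow> F' n x) (at_right 0)"
      using Suc.prems x s yp
      by (intro continuous_on_tendsto_compose[OF cont])
        (auto simp: eventually_at_filter intro!: always_eventually less_imp_le)
    then have "((\<lambda>t. (F (z n t) - F x) / t + x n * F' n (y t (s t))) \<longlongrightarrow>
        (\<Sum>i<n. x i * F' i x) + x n * F' n x) (at_right 0)"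
      using Suc.IH Suc.prems by (intro tendsto_intros) auto
    then show ?case
    proof -
      assume L: "((\<lambda>t. (F (z n t) - F x) / t + x n * F' n (y t (s t))) \<longlongrightarrow>
        (\<Sum>i<n. x i * F' i x) + x n * F' n x) (at_right 0)"
      have "(F (z n t) - F x) / t + x n * F' n (y t (s t)) = (F (z (Suc n) t) - F x) / t" if "t > 0" for t
      proof -
        have "F (z (Suc n) t) = F (z n t) + t * (x n * F' n (y t (s t)))" using s[OF that] by linarith
        then have "(F (z (Suc n) t) - F x) / t = ((F (z n t) - F x) + t * (x n * F' n (y t (s t)))) / t" by simp
        also have "\<dots> = (F (z n t) - F x) / t + x n * F' n (y t (s t))"
          using that by (simp only: add_divide_distrib) simp
        finally show ?thesis by simp
      qed
      then have "\<forall>\<^sub>F t in at_right 0. (F (z n t) - F x) / t + x n * F' n (y t (s t)) = (F (z (Suc n) t) - F x) / t"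
        by (auto simp: eventually_at_filter)
      from Lim_transform_eventually[OF L this] show ?thesis by simp
    qed
  qed
  \<comment> \<open>All N steps together are a dilation, under which F does not change.\<close>
  have "z N t = (\<lambda>i. (1 + t) * x i)" for t
    using x by (auto simp: z_def punctured_def fun_eq_iff)
  then have "\<forall>\<^sub>F t in at_right 0. (F (z N t) - F x) / t = 0"
    using hom[OF _ x] by (auto simp: eventually_at_filter)
  then have "((\<lambda>t. (F (z N t) - F x) / t) \<longlongrightarrow> 0) (at_right 0)"
    by (rule tendsto_eventually)
  from tendsto_unique[OF _ lim[OF order_refl] this] show ?thesis by simp
qed

section \<open>Lebesgue integration of compactly supported continuous functions\<close>

definition trunc :: "nat \<Rightarrow> pt \<Rightarrow> pt" where
  "trunc N x = (\<lambda>i. if i < N then x i else 0)"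

definition leb :: "nat \<Rightarrow> pt measure" where
  "leb N = Pi\<^sub>M {..<N} (\<lambda>_. lborel)"

text \<open>Continuous on \<open>R^N\<close>, supported in the ball of radius \<open>sqrt 2\<close>.\<close>
definition csupp :: "nat \<Rightarrow> (pt \<Rightarrow> real) \<Rightarrow> bool" where
  "csupp N H \<longleftrightarrow> continuous_on (vecs N) H \<and> (\<forall>x\<in>vecs N. nsq N x > 2 \<longrightarrow> H x = 0)"

text \<open>Points of \<open>leb N\<close> are \<open>undefined\<close> from N on, while the points
  of the theorem vanish there; \<open>trunc\<close> mediates between the two conventions.\<close>

definition vint :: "nat \<Rightarrow> (pt \<Rightarrow> real) \<Rightarrow> real" where
  "vint N H = (\<integral>x. H (trunc N x) \<partial>leb N)"

interpretation lborel_product: product_sigma_finite "\<lambda>_::nat. lborel :: real measure"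
  by (rule product_sigma_finite.intro) (rule lborel.sigma_finite_measure_axioms)

lemma trunc_vecs: "trunc N x \<in> vecs N"
  by (auto simp: trunc_def vecs_def)

lemma trunc_id: "x \<in> vecs N \<Longrightarrow> trunc N x = x"
  by (auto simp: trunc_def vecs_def)

lemma trunc_upd: "i < N \<Longrightarrow> trunc N (x(i := y)) = (trunc N x)(i := y)"
  by (auto simp: trunc_def)

lemma continuous_trunc: "continuous_on S (trunc N)"
  unfolding trunc_def
proof (rule continuous_on_coordinatewise_then_product)
  fix i show "continuous_on S (\<lambda>x. if i < N then x i else 0)"
    by (cases "i < N") (auto intro: continuous_on_coord)
qed

lemma measurable_trunc: "trunc N \<in> borel_measurable (leb N)"
proof (rule measurable_coordinatewise_then_product)
  fix i
  show "(\<lambda>x. trunc N x i) \<in> borel_measurable (leb N)"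
    by (cases "i < N") (auto simp: trunc_def leb_def)
qed

lemma measurable_comp_trunc:
  assumes "continuous_on (vecs N) H"
  shows "(\<lambda>x. H (trunc N x)) \<in> borel_measurable (leb N)"
proof -
  have "continuous_on UNIV (\<lambda>x. H (trunc N x))"
    by (rule continuous_on_compose2[OF assms continuous_trunc]) (auto simp: trunc_vecs)
  then have "(\<lambda>x. H (trunc N x)) \<in> borel_measurable borel"
    by (rule borel_measurable_continuous_onI)
  from measurable_compose[OF measurable_trunc this, of N]
  show ?thesis by (simp add: trunc_id trunc_vecs)
qed

lemma compact_box: "compact {x \<in> vecs N. \<forall>i<N. \<bar>x i\<bar> \<le> R}"
proof -
  have "compactin (product_topology (\<lambda>_. euclidean) UNIV)
     (Pi\<^sub>E (UNIV::nat set) (\<lambda>i. if i < N then {-R..R} else {0::real}))"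
    by (subst compactin_PiE) auto
  moreover have "Pi\<^sub>E (UNIV::nat set) (\<lambda>i. if i < N then {-R..R} else {0::real}) =
      {x \<in> vecs N. \<forall>i<N. \<bar>x i\<bar> \<le> R}"
  proof (intro set_eqI)
    fix x :: pt
    have "x i \<in> (if i < N then {-R..R} else {0}) \<longleftrightarrow> (N \<le> i \<longrightarrow> x i = 0) \<and> (i < N \<longrightarrow> \<bar>x i\<bar> \<le> R)" for i
      by (auto simp: abs_le_iff)
    then show "x \<in> Pi\<^sub>E UNIV (\<lambda>i. if i < N then {-R..R} else {0}) \<longleftrightarrow> x \<in> {x \<in> vecs N. \<forall>i<N. \<bar>x i\<bar> \<le> R}"
      unfolding PiE_iff vecs_def by auto
  qed
  ultimately show ?thesis by (simp add: euclidean_product_topology)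
qed

lemma abs_le_of_nsq_le: "nsq N x \<le> R\<^sup>2 \<Longrightarrow> R \<ge> 0 \<Longrightarrow> i < N \<Longrightarrow> \<bar>x i\<bar> \<le> R"
proof -
  assume "nsq N x \<le> R\<^sup>2" "R \<ge> 0" "i < N"
  have "(x i)\<^sup>2 \<le> nsq N x"
    unfolding nsq_def by (rule member_le_sum) (use \<open>i < N\<close> in auto)
  then have "\<bar>x i\<bar>\<^sup>2 \<le> R\<^sup>2" using \<open>nsq N x \<le> R\<^sup>2\<close> by simp
  then show ?thesis using \<open>R \<ge> 0\<close> by (rule power2_le_imp_le)
qed

lemma csupp_bounded:
  assumes "csupp N H"
  obtains B where "\<And>x. x \<in> vecs N \<Longrightarrow> \<bar>H x\<bar> \<le> B"
    and "\<And>x. x \<in> vecs N \<Longrightarrow> (\<exists>i<N. \<bar>x i\<bar> > 2) \<Longrightarrow> H x = 0"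
proof -
  let ?C = "{x \<in> vecs N. \<forall>i<N. \<bar>x i\<bar> \<le> 2}"
  have "compact (H ` ?C)"
    using assms by (intro compact_continuous_image compact_box)
      (auto simp: csupp_def intro: continuous_on_subset)
  then obtain B where B: "\<And>x. x \<in> ?C \<Longrightarrow> \<bar>H x\<bar> \<le> B"
    using compact_imp_bounded[of "H ` ?C"] by (auto simp: bounded_iff)
  have z: "H x = 0" if "x \<in> vecs N" "\<exists>i<N. \<bar>x i\<bar> > 2" for x
  proof -
    have "\<not> nsq N x \<le> 2\<^sup>2" using that abs_le_of_nsq_le[of N x 2] by force
    then show ?thesis using assms that by (auto simp: csupp_def)
  qed
  have "\<bar>H x\<bar> \<le> max B 0" if "x \<in> vecs N" for x
    using B[of x] z[of x] that by (cases "\<forall>i<N. \<bar>x i\<bar> \<le> 2") (auto simp: not_le intro: le_max_iff_disj[THEN iffD2])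
  with z that show ?thesis by blast
qed

lemma integrable_csupp:
  assumes "csupp N H"
  shows "integrable (leb N) (\<lambda>x. H (trunc N x))"
proof -
  obtain B where B: "\<And>x. x \<in> vecs N \<Longrightarrow> \<bar>H x\<bar> \<le> B"
      "\<And>x. x \<in> vecs N \<Longrightarrow> (\<exists>i<N. \<bar>x i\<bar> > 2) \<Longrightarrow> H x = 0"
    using csupp_bounded[OF assms] by metis
  let ?A = "Pi\<^sub>E {..<N} (\<lambda>_. {-2..2::real})"
  have "integrable (leb N) (\<lambda>x. indicator ?A x *\<^sub>R H (trunc N x))"
  proof (rule integrableI_bounded_set_indicator)
    show "?A \<in> sets (leb N)" unfolding leb_def by (rule sets_PiM_I_finite) auto
    show "(\<lambda>x. H (trunc N x)) \<in> borel_measurable (leb N)"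
      using assms measurable_comp_trunc by (auto simp: csupp_def)
    have "emeasure (leb N) ?A = (\<Prod>i<N. emeasure lborel {-2..2::real})"
      unfolding leb_def by (rule lborel_product.emeasure_PiM) auto
    then show "emeasure (leb N) ?A < \<infinity>"
      by (simp add: ennreal_power[symmetric] less_top[symmetric] power_eq_top_ennreal)
    show "AE x in leb N. x \<in> ?A \<longrightarrow> norm (H (trunc N x)) \<le> B"
      using B trunc_vecs by auto
  qed
  also have "?this \<longleftrightarrow> ?thesis"
  proof (rule Bochner_Integration.integrable_cong[OF refl])
    fix x assume x: "x \<in> space (leb N)"
    show "indicator ?A x *\<^sub>R H (trunc N x) = H (trunc N x)"
    proof (cases "x \<in> ?A")
      case False
      then obtain i where "i < N" "\<not> (-2 \<le> x i \<and> x i \<le> 2)"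
        using x by (auto simp: leb_def space_PiM PiE_iff)
      then have "\<exists>i<N. \<bar>trunc N x i\<bar> > 2"
        by (intro exI[of _ i]) (auto simp: trunc_def)
      then show ?thesis using B(2) trunc_vecs by auto
    qed auto
  qed
  finally show ?thesis .
qed

text \<open>By Fubini the i-th coordinate is integrated first. On every coordinate line the integral
  is a difference of two values of H, taken at -3 and 3 and hence outside the support.\<close>

lemma vint_partial_eq_0:
  assumes "csupp N H" "csupp N H'" and i: "i < N"
    and der: "\<And>x. x \<in> vecs N \<Longrightarrow> ((\<lambda>t. H (x(i := x i + t))) has_real_derivative H' x) (at 0)"
  shows "vint N H' = 0"
proof -
  have ins: "{..<N} = insert i ({..<N} - {i})" using i by auto
  have z: "(\<integral>y. H' ((trunc N x)(i := y)) \<partial>lborel) = 0" for x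
  proof -
    let ?h = "\<lambda>y. H ((trunc N x)(i := y))" and ?h' = "\<lambda>y. H' ((trunc N x)(i := y))"
    have v: "(trunc N x)(i := y) \<in> vecs N" for y by (intro vecs_upd trunc_vecs i)
    have d: "(?h has_real_derivative ?h' y) (at y)" for y
    proof -
      have "((\<lambda>t. H ((trunc N x)(i := y + t))) has_real_derivative ?h' y) (at 0)"
        using der[OF v[of y]] by simp
      then show ?thesis
        using DERIV_shift[of ?h "?h' y" 0 y] by (simp add: add.commute)
    qed
    have c: "isCont ?h' y" for y
    proof -
      have "continuous_on UNIV ?h'"
      proof (rule continuous_on_compose2[of "vecs N" H'])
        show "continuous_on (vecs N) H'" using assms(2) by (simp add: csupp_def)
        show "continuous_on UNIV (\<lambda>y. (trunc N x)(i := y))" by (rule continuous_on_upd[OF continuous_on_id])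
        show "(\<lambda>y. (trunc N x)(i := y)) ` UNIV \<subseteq> vecs N" using v by blast
      qed
      then show ?thesis by (simp add: continuous_on_eq_continuous_at)
    qed
    obtain B where B: "\<And>x. x \<in> vecs N \<Longrightarrow> (\<exists>i<N. \<bar>x i\<bar> > 2) \<Longrightarrow> H x = 0"
      using csupp_bounded[OF assms(1)] by metis
    obtain B' where B': "\<And>x. x \<in> vecs N \<Longrightarrow> (\<exists>i<N. \<bar>x i\<bar> > 2) \<Longrightarrow> H' x = 0"
      using csupp_bounded[OF assms(2)] by metis
    have out: "?h' y = 0" "?h y = 0" if "\<bar>y\<bar> > 2" for y
    proof -
      have "\<exists>ia<N. \<bar>((trunc N x)(i := y)) ia\<bar> > 2" using that i by (intro exI[of _ i]) auto
      then show "?h' y = 0" "?h y = 0" by (rule B'[OF v], rule B[OF v])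
    qed
    have "(\<integral>y. ?h' y \<partial>lborel) = (\<integral>y. ?h' y * indicator {-3..3} y \<partial>lborel)"
    proof (rule Bochner_Integration.integral_cong[OF refl])
      fix y show "?h' y = ?h' y * indicator {-3..3} y"
        by (cases "\<bar>y\<bar> > 2") (simp_all add: out(1) indicator_def abs_le_iff not_less)
    qed
    also have "\<dots> = ?h 3 - ?h (-3)"
      by (rule integral_FTC_Icc_real[of "-3" 3 ?h ?h']) (simp, rule d, rule c)
    also have "\<dots> = 0" using out(2)[of 3] out(2)[of "-3"] by simp
    finally show ?thesis .
  qed
  have "vint N H' = (\<integral>x. (\<integral>y. H' (trunc N (x(i := y))) \<partial>lborel) \<partial>Pi\<^sub>M ({..<N} - {i}) (\<lambda>_. lborel))"
    unfolding vint_def leb_def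
    using lborel_product.product_integral_insert[of "{..<N} - {i}" i "\<lambda>x. H' (trunc N x)", folded ins]
      integrable_csupp[OF assms(2)] by (simp add: leb_def)
  also have "\<dots> = 0" using i z by (simp add: trunc_upd)
  finally show ?thesis .
qed

text \<open>If H were positive at x, it would be positive on a product of open sets. Each factor
  contains an interval, so the product has positive measure, whereas a non-negative function with
  integral 0 vanishes almost everywhere.\<close>

lemma vint_eq_0_imp:
  assumes "csupp N H" "\<And>x. x \<in> vecs N \<Longrightarrow> H x \<ge> 0" "vint N H = 0" "x \<in> vecs N"
  shows "H x = 0"
proof (rule ccontr)
  assume "H x \<noteq> 0"
  then have "H x > 0" using assms by (simp add: less_le)
  have "continuous_on UNIV (\<lambda>x. H (trunc N x))"
    by (rule continuous_on_compose2[OF _ continuous_trunc]) (use assms(1) in \<open>auto simp: trunc_vecs csupp_def\<close>)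
  then have "open ((\<lambda>x. H (trunc N x)) -` {0<..} \<inter> UNIV)"
    by (intro continuous_on_open_vimage[THEN iffD1, rule_format]) auto
  then have o: "open {x. H (trunc N x) > 0}" by (simp add: vimage_def)
  have "x \<in> {x. H (trunc N x) > 0}" using \<open>H x > 0\<close> assms(4) by (simp add: trunc_id)
  with product_topology_open_contains_basis[of "\<lambda>_. euclidean" UNIV "{x. H (trunc N x) > 0}" x] o
  obtain X where X: "x \<in> Pi\<^sub>E UNIV X" "\<And>i. open (X i)" "Pi\<^sub>E UNIV X \<subseteq> {x. H (trunc N x) > 0}"
    by (auto simp: euclidean_product_topology open_openin[symmetric])
  have nonneg: "AE x in leb N. 0 \<le> H (trunc N x)" using assms(2) trunc_vecs by auto
  have "AE x in leb N. H (trunc N x) = 0"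
    using integral_nonneg_eq_0_iff_AE[OF integrable_csupp[OF assms(1)] nonneg] assms(3)
    by (simp add: vint_def)
  then obtain Z where Z: "{y \<in> space (leb N). H (trunc N y) \<noteq> 0} \<subseteq> Z" "Z \<in> null_sets (leb N)"
    by (rule AE_E) (auto intro: null_setsI)
  have "Pi\<^sub>E {..<N} X \<subseteq> Z"
  proof
    fix y assume y: "y \<in> Pi\<^sub>E {..<N} X"
    \<comment> \<open>Beyond N the coordinates of x are borrowed, because the basic open set of the
      product topology restricts all coordinates.\<close>
    define y' where "y' i = (if i < N then y i else x i)" for i
    have "y' \<in> Pi\<^sub>E UNIV X" using y X(1) by (auto simp: y'_def PiE_iff)
    then have "H (trunc N y') > 0" using X(3) by auto
    moreover have "trunc N y' = trunc N y" by (auto simp: trunc_def y'_def)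
    ultimately show "y \<in> Z" using y Z(1) by (auto simp: leb_def space_PiM PiE_iff subset_iff)
  qed
  then have "emeasure (leb N) (Pi\<^sub>E {..<N} X) = 0"
    using Z(2) emeasure_mono[of "Pi\<^sub>E {..<N} X" Z "leb N"] by (auto simp: null_sets_def)
  moreover have "emeasure (leb N) (Pi\<^sub>E {..<N} X) = (\<Prod>i<N. emeasure lborel (X i))"
    unfolding leb_def by (rule lborel_product.emeasure_PiM) (use X(2) in auto)
  ultimately have "(\<Prod>i<N. emeasure lborel (X i)) = 0" by simp
  moreover have "(\<Prod>i<n. f i) > 0" if "\<And>i. f i > 0" for n and f :: "nat \<Rightarrow> ennreal"
    by (induction n) (auto simp: ennreal_zero_less_mult_iff that)
  ultimately have "\<exists>i. \<not> emeasure lborel (X i) > 0" by (metis less_irrefl)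
  then obtain i where i: "emeasure lborel (X i) = 0" by (auto simp: not_less)
  obtain e where e: "e > 0" "ball (x i) e \<subseteq> X i"
    using X(1) X(2)[of i] unfolding open_contains_ball PiE_iff by blast
  have "emeasure lborel {x i - e<..<x i + e} \<le> emeasure lborel (X i)"
    using e X(2)[of i] by (intro emeasure_mono) (auto simp: ball_def dist_real_def subset_iff abs_less_iff)
  then show False using i e by (simp add: ennreal_eq_0_iff)
qed

text \<open>A cutoff in the variable \<open>nsq N x\<close>, supported between 1 and 2 and so away
  from the origin, where extensions from the sphere are singular. Squaring the positive part makes
  it continuously differentiable, which suffices for one integration by parts.\<close>

definition phi :: "real \<Rightarrow> real" where
  "phi u = (max 0 ((u - 1) * (2 - u)))\<^sup>2"

definition phi' :: "real \<Rightarrow> real" where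
  "phi' u = 2 * max 0 ((u - 1) * (2 - u)) * (3 - 2 * u)"

lemma phi_deriv: "(phi has_real_derivative phi' u) (at u)"
proof -
  let ?g = "\<lambda>v::real. (v - 1) * (2 - v)"
  have sq: "((\<lambda>w::real. (max 0 w)\<^sup>2) has_real_derivative 2 * max 0 w) (at w)" for w
  proof -
    consider "w < 0" | "w = 0" | "w > 0" by linarith
    then show ?thesis
    proof cases
      case 1
      have ev: "eventually (\<lambda>v. (max 0 v)\<^sup>2 = (0::real)) (nhds w)"
        using eventually_nhds_in_open[of "{..<0}" w] 1 by (auto elim!: eventually_mono)
      show ?thesis using 1 DERIV_cong_ev[OF refl ev refl] by simp
    next
      case 3
      have ev: "eventually (\<lambda>v. (max 0 v)\<^sup>2 = v\<^sup>2) (nhds w)"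
        using eventually_nhds_in_open[of "{0<..}" w] 3 by (auto elim!: eventually_mono)
      have "((\<lambda>v. v\<^sup>2) has_real_derivative 2 * w) (at w)" by (auto intro!: derivative_eq_intros)
      then show ?thesis using 3 DERIV_cong_ev[OF refl ev refl] by simp
    next
      case 2
      have "((\<lambda>h::real. ((max 0 (0 + h))\<^sup>2 - (max 0 0)\<^sup>2) / h) \<longlongrightarrow> 0) (at 0)"
      proof (rule Lim_null_comparison)
        show "eventually (\<lambda>h::real. norm (((max 0 (0 + h))\<^sup>2 - (max 0 0)\<^sup>2) / h) \<le> \<bar>h\<bar>) (at 0)"
          by (rule always_eventually) (auto simp: max_def power2_eq_square abs_mult)
        show "((\<lambda>h::real. \<bar>h\<bar>) \<longlongrightarrow> 0) (at 0)"
          using tendsto_rabs[OF tendsto_ident_at[of "0::real" UNIV]] by simp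
      qed
      then show ?thesis using 2 by (simp add: DERIV_def)
    qed
  qed
  have g: "(?g has_real_derivative (3 - 2 * u)) (at u)"
    by (auto intro!: derivative_eq_intros)
  from DERIV_chain2[OF sq[of "?g u"] g] show ?thesis by (simp add: phi_def[abs_def] phi'_def)
qed

lemma phi_out: "u \<le> 1 \<or> u \<ge> 2 \<Longrightarrow> phi u = 0" "u \<le> 1 \<or> u \<ge> 2 \<Longrightarrow> phi' u = 0"
proof -
  assume "u \<le> 1 \<or> u \<ge> 2"
  then have "(u - 1) * (2 - u) \<le> 0" by (auto simp: mult_le_0_iff)
  then show "phi u = 0" "phi' u = 0" by (auto simp: phi_def phi'_def)
qed

lemma phi_nonneg: "phi u \<ge> 0"
  by (simp add: phi_def)

lemma phi_pos: "1 < u \<Longrightarrow> u < 2 \<Longrightarrow> phi u > 0"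
  by (simp add: phi_def max_def)

lemma continuous_phi: "continuous_on S phi" "continuous_on S phi'"
  unfolding phi_def[abs_def] phi'_def[abs_def] by (auto intro!: continuous_intros)

text \<open>This is \<open>phi u / u\<close>: as \<open>phi\<close> vanishes up to 1, dividing by
  \<open>max u 1\<close> gives the same value and makes continuity immediate.\<close>

definition psi :: "real \<Rightarrow> real" where
  "psi u = phi u / max u 1"

lemma psi_eq: "phi u / u = psi u"
  using phi_out(1)[of u] by (cases "u \<le> 1") (auto simp: psi_def)

lemma continuous_psi: "continuous_on S psi"
  unfolding psi_def[abs_def] by (auto intro!: continuous_intros continuous_phi)

lemma psi_out: "u \<le> 1 \<or> u \<ge> 2 \<Longrightarrow> psi u = 0"
  by (simp add: psi_def phi_out)

lemma psi_nonneg: "psi u \<ge> 0"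
  by (simp add: psi_def phi_nonneg)

lemma psi_pos: "1 < u \<Longrightarrow> u < 2 \<Longrightarrow> psi u > 0"
  by (simp add: psi_def phi_pos)

section \<open>Radial cutoffs and Green's identity\<close>

lemma closed_vecs: "closed (vecs N)"
proof -
  have "vecs N = (\<Inter>i\<in>{N..}. {x. x i = 0})" by (auto simp: vecs_def)
  moreover have "closed {x::pt. x i = 0}" for i
    by (intro closed_Collect_eq continuous_on_coord continuous_on_const)
  ultimately show ?thesis by auto
qed

text \<open>K is continuous only off the origin. Two closed sets cover the space: where
  \<open>nsq\<close> is at least 1/2 both factors are continuous, and where it is at most 1 the
  product is 0.\<close>

lemma csupp_radial:
  assumes "continuous_on (punctured N) K" "continuous_on UNIV p"
    and "\<And>u. u \<le> 1 \<or> u \<ge> 2 \<Longrightarrow> p u = 0"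
  shows "csupp N (\<lambda>x. K x * p (nsq N x))"
proof -
  let ?A = "vecs N \<inter> {x. 1 / 2 \<le> nsq N x}" and ?B = "vecs N \<inter> {x. nsq N x \<le> 1}"
  have AB: "vecs N = ?A \<union> ?B" by auto
  have "continuous_on (?A \<union> ?B) (\<lambda>x. K x * p (nsq N x))"
  proof (rule continuous_on_closed_Un)
    show "closed ?A" "closed ?B"
      by (intro closed_Int closed_vecs closed_Collect_le continuous_on_const continuous_on_nsq)+
    have "?A \<subseteq> punctured N" by (auto simp: punctured_iff)
    then show "continuous_on ?A (\<lambda>x. K x * p (nsq N x))"
      by (intro continuous_on_mult continuous_on_subset[OF assms(1)]
          continuous_on_compose2[OF assms(2)] continuous_on_nsq) auto
    have "continuous_on ?B (\<lambda>x. 0::real)" by (rule continuous_on_const)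
    then show "continuous_on ?B (\<lambda>x. K x * p (nsq N x))"
      by (rule continuous_on_eq) (simp add: assms(3))
  qed
  then show ?thesis using AB assms(3) by (simp add: csupp_def)
qed

lemma csupp_add: "csupp N H \<Longrightarrow> csupp N K \<Longrightarrow> csupp N (\<lambda>x. H x + K x)"
  by (simp add: csupp_def continuous_on_add)

lemma csupp_cmult: "csupp N H \<Longrightarrow> csupp N (\<lambda>x. c * H x)"
  by (simp add: csupp_def continuous_on_mult)

lemma vint_cong: "(\<And>x. x \<in> vecs N \<Longrightarrow> H x = K x) \<Longrightarrow> vint N H = vint N K"
  by (simp add: vint_def trunc_vecs)

lemma vint_add: "csupp N H \<Longrightarrow> csupp N K \<Longrightarrow> vint N (\<lambda>x. H x + K x) = vint N H + vint N K"
  unfolding vint_def by (rule Bochner_Integration.integral_add[OF integrable_csupp integrable_csupp])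

lemma vint_cmult: "vint N (\<lambda>x. c * H x) = c * vint N H"
  unfolding vint_def by (rule integral_mult_right_zero)

lemma vint_sum: "(\<And>a. a \<in> A \<Longrightarrow> csupp N (H a)) \<Longrightarrow> vint N (\<lambda>x. \<Sum>a\<in>A. H a x) = (\<Sum>a\<in>A. vint N (H a))"
  unfolding vint_def by (rule Bochner_Integration.integral_sum) (simp add: integrable_csupp)

text \<open>Green's identity; the boundary term vanishes because the cutoff is radial while
  the gradient of a homogeneous function of degree 0 is tangential.\<close>
lemma green:
  assumes F1: "\<And>i. i < N \<Longrightarrow> has_pd N i (F1 i) (F2 i)"
    and cF: "\<And>i. i < N \<Longrightarrow> continuous_on (punctured N) (F1 i)" "\<And>i. i < N \<Longrightarrow> continuous_on (punctured N) (F2 i)"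
    and G: "\<And>i. i < N \<Longrightarrow> has_pd N i G (G1 i)"
    and cG: "continuous_on (punctured N) G" "\<And>i. i < N \<Longrightarrow> continuous_on (punctured N) (G1 i)"
    and tang: "\<And>x. x \<in> punctured N \<Longrightarrow> (\<Sum>i<N. x i * F1 i x) = 0"
  shows "vint N (\<lambda>x. ((\<Sum>i<N. F2 i x) * G x) * phi (nsq N x)) =
     - vint N (\<lambda>x. (\<Sum>i<N. F1 i x * G1 i x) * phi (nsq N x))"
proof -
  let ?A = "\<lambda>i x. (F2 i x * G x + F1 i x * G1 i x) * phi (nsq N x)"
  let ?B = "\<lambda>i x. (F1 i x * G x * (2 * x i)) * phi' (nsq N x)"
  have cA: "csupp N (?A i)" if "i < N" for i
    using that by (intro csupp_radial continuous_phi phi_out continuous_intros cF cG)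
  have cB: "csupp N (?B i)" if "i < N" for i
    using that by (intro csupp_radial continuous_phi phi_out continuous_on_mult continuous_on_coord continuous_on_const cF cG)
  have int0: "vint N (\<lambda>x. ?A i x + ?B i x) = 0" if i: "i < N" for i
  proof (rule vint_partial_eq_0[of N "\<lambda>x. (F1 i x * G x) * phi (nsq N x)" _ i])
    show "csupp N (\<lambda>x. (F1 i x * G x) * phi (nsq N x))"
      using i by (intro csupp_radial continuous_phi phi_out continuous_on_mult cF cG)
    show "csupp N (\<lambda>x. ?A i x + ?B i x)" using cA cB i by (intro csupp_add)
    fix x assume x: "x \<in> vecs N"
    show "((\<lambda>t. F1 i (x(i := x i + t)) * G (x(i := x i + t)) * phi (nsq N (x(i := x i + t))))
       has_real_derivative ?A i x + ?B i x) (at 0)"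
    proof (cases "x \<in> punctured N")
      case True
      have p: "has_pd N i (\<lambda>x. phi (nsq N x)) (\<lambda>x. phi' (nsq N x) * (2 * x i))"
        by (rule has_pd_chain[OF has_pd_nsq[OF i] phi_deriv])
      have "has_pd N i (\<lambda>x. F1 i x * G x * phi (nsq N x))
         (\<lambda>x. (F2 i x * G x + F1 i x * G1 i x) * phi (nsq N x) + F1 i x * G x * (phi' (nsq N x) * (2 * x i)))"
        by (intro has_pd_mult F1 G i p)
      then show ?thesis using True by (auto simp: has_pd_def algebra_simps)
    next
      case False
      then have n0: "nsq N x = 0" using x nsq_nonneg[of N x] by (auto simp: punctured_iff)
      then have "x i = 0" using x nsq_eq_0_iff[of x N] by simp
      then have n: "nsq N (x(i := x i + t)) = t\<^sup>2" for t
        using nsq_upd[OF i, of x t] n0 by (simp only: \<open>x i = 0\<close> mult_zero_right add_0_left)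
      have "eventually (\<lambda>t::real. t \<in> {-1<..<1}) (nhds 0)" by (rule eventually_nhds_in_open) auto
      then have ev: "eventually (\<lambda>t. F1 i (x(i := x i + t)) * G (x(i := x i + t)) * phi (nsq N (x(i := x i + t))) = 0) (nhds 0)"
        by eventually_elim (auto simp: n phi_out abs_square_le_1[THEN iffD2] abs_le_iff)
      have AB0: "?A i x + ?B i x = 0" using n0 phi_out[of 0] by simp
      show ?thesis unfolding AB0
        by (rule DERIV_cong_ev[OF refl ev refl, THEN iffD2]) (rule DERIV_const)
    qed
  qed fact
  have "0 = (\<Sum>i<N. vint N (\<lambda>x. ?A i x + ?B i x))" using int0 by simp
  also have "\<dots> = (\<Sum>i<N. vint N (?A i)) + (\<Sum>i<N. vint N (?B i))"
    using cA cB by (simp add: vint_add sum.distrib)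
  also have "(\<Sum>i<N. vint N (?B i)) = vint N (\<lambda>x. \<Sum>i<N. ?B i x)"
    using cB by (intro vint_sum[symmetric]) auto
  also have "\<dots> = vint N (\<lambda>x. 0)"
  proof (rule vint_cong)
    fix x assume x: "x \<in> vecs N"
    \<comment> \<open>The terms in which the cutoff is differentiated add up to a multiple of the
      radial component of F1, which is 0.\<close>
    have "(\<Sum>i<N. ?B i x) = 2 * G x * phi' (nsq N x) * (\<Sum>i<N. x i * F1 i x)"
      by (simp add: sum_distrib_left algebra_simps)
    also have "\<dots> = 0"
    proof (cases "x \<in> punctured N")
      case False
      then have "nsq N x = 0" using x nsq_nonneg[of N x] by (auto simp: punctured_iff)
      then show ?thesis using phi_out[of 0] by simp
    qed (simp add: tang)
    finally show "(\<Sum>i<N. ?B i x) = 0" .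
  qed
  also have "\<dots> = 0" by (simp add: vint_def)
  also have "(\<Sum>i<N. vint N (?A i)) = vint N (\<lambda>x. \<Sum>i<N. ?A i x)"
    using cA by (intro vint_sum[symmetric]) auto
  also have "\<dots> = vint N (\<lambda>x. ((\<Sum>i<N. F2 i x) * G x) * phi (nsq N x) + (\<Sum>i<N. F1 i x * G1 i x) * phi (nsq N x))"
    by (rule vint_cong) (simp only: sum_distrib_right sum.distrib distrib_right)
  also have "\<dots> = vint N (\<lambda>x. ((\<Sum>i<N. F2 i x) * G x) * phi (nsq N x)) + vint N (\<lambda>x. (\<Sum>i<N. F1 i x * G1 i x) * phi (nsq N x))"
    by (intro vint_add csupp_radial continuous_phi phi_out continuous_on_mult continuous_on_sum cF cG) auto
  finally show ?thesis by simp
qed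

section \<open>The inner product on the sphere and self-adjointness\<close>

lemma has_pd_scale:
  assumes "has_pd N i F F'" "i < N" "c > 0" "\<And>x. x \<in> punctured N \<Longrightarrow> F (\<lambda>j. c * x j) = k * F x"
    and x: "x \<in> punctured N"
  shows "F' (\<lambda>j. c * x j) = k / c * F' x"
proof -
  have ev0: "eventually (\<lambda>t. x(i := x i + t) \<in> punctured N) (nhds (0 / c))"
    using eventually_punctured_upd[OF x assms(2)] by simp
  have "filterlim (\<lambda>t. t / c) (nhds (0 / c)) (nhds 0)"
    using \<open>c > 0\<close> by (intro tendsto_intros filterlim_ident) auto
  from eventually_compose_filterlim[OF ev0 this]
  have "eventually (\<lambda>t. x(i := x i + t / c) \<in> punctured N) (nhds 0)" .
  then have ev: "eventually (\<lambda>t. F ((\<lambda>j. c * x j)(i := c * x i + t)) = k * F (x(i := x i + t / c))) (nhds 0)"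
  proof eventually_elim
    case (elim t)
    have "(\<lambda>j. c * x j)(i := c * x i + t) = (\<lambda>j. c * (x(i := x i + t / c)) j)"
      using \<open>c > 0\<close> by (auto simp: algebra_simps)
    then show ?case using assms(4)[OF elim] by simp
  qed
  have "((\<lambda>t. F (x(i := x i + t))) has_real_derivative F' x) (at (0 / c))"
    using assms(1) x by (simp add: has_pd_def)
  moreover have "((\<lambda>t. t / c) has_real_derivative 1 / c) (at 0)"
    by (rule DERIV_cdivide[OF DERIV_ident])
  ultimately have "((\<lambda>t. F (x(i := x i + t / c))) has_real_derivative F' x * (1 / c)) (at 0)"
    by (rule DERIV_chain2)
  from DERIV_cmult[OF this, of k]
  have "((\<lambda>t. F ((\<lambda>j. c * x j)(i := c * x i + t))) has_real_derivative k / c * F' x) (at 0)"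
    using DERIV_cong_ev[OF refl ev refl] by (simp add: field_simps)
  moreover have "((\<lambda>t. F ((\<lambda>j. c * x j)(i := c * x i + t))) has_real_derivative F' (\<lambda>j. c * x j)) (at 0)"
    using bspec[OF assms(1)[unfolded has_pd_def] punctured_scale[OF x, of c]] \<open>c > 0\<close> by blast
  ultimately show ?thesis by (rule DERIV_unique[symmetric])
qed

text \<open>In polar coordinates this is the L2 product over the sphere times a positive constant
  depending only on N.\<close>

definition ip :: "nat \<Rightarrow> (pt \<Rightarrow> real) \<Rightarrow> (pt \<Rightarrow> real) \<Rightarrow> real" where
  "ip N f g = vint N (\<lambda>x. (ext0 N f x * ext0 N g x) * psi (nsq N x))"

lemma smooth_punct_cont: "smooth_punct N F \<Longrightarrow> set is \<subseteq> {..<N} \<Longrightarrow> continuous_on (punctured N) (pds is F)"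
  by (simp add: smooth_punct_def)

lemma ext0_scale: "c > 0 \<Longrightarrow> ext0 N f (\<lambda>i. c * x i) = ext0 N f x"
  by (simp add: ext0_proj proj_scale)

lemma smooth_pd1:
  assumes "smooth_punct N F" "i < N"
  shows "has_pd N i F (pds [i] F)" "has_pd N i (pds [i] F) (pds [i, i] F)"
    "continuous_on (punctured N) F" "continuous_on (punctured N) (pds [i] F)"
    "continuous_on (punctured N) (pds [i, i] F)"
  using smooth_punct_has_pd[OF assms(1), of "[]" i] smooth_punct_has_pd[OF assms(1), of "[i]" i]
    smooth_punct_cont[OF assms(1), of "[]"] smooth_punct_cont[OF assms(1), of "[i]"]
    smooth_punct_cont[OF assms(1), of "[i, i]"] assms(2)
  by (simp_all del: pds.simps add: pds.simps(1))

lemma laplacian_ext0: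
  assumes sm: "smooth_punct N (ext0 N f)" and x: "x \<in> punctured N"
  shows "(\<Sum>i<N. pds [i, i] (ext0 N f) x) = ext0 N (sph_laplacian N f) x / nsq N x"
proof -
  let ?F = "ext0 N f"
  define c where "c = sqrt (nsq N x)"
  have c: "c > 0" using nsq_pos[OF x] by (simp add: c_def)
  define y where "y = proj N x"
  have y: "y \<in> punctured N"
    using proj_sphere[OF x] sphere_pts_punctured by (auto simp: y_def)
  have xy: "x = (\<lambda>i. c * y i)" using c by (auto simp: y_def proj_def c_def)
  \<comment> \<open>\<open>has_pd_scale\<close> takes the factor belonging to the single dilation c
    rather than a degree: it is 1 for the extension itself and 1 / c for its first
    derivatives.\<close>
  have s1: "pds [i] ?F (\<lambda>j. c * z j) = 1 / c * pds [i] ?F z" if "i < N" "z \<in> punctured N" for i z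
    by (rule has_pd_scale[OF smooth_pd1(1)[OF sm that(1)] that(1) c _ that(2)])
      (simp add: ext0_scale c)
  have s2: "pds [i, i] ?F x = (1 / c) / c * pds [i, i] ?F y" if "i < N" for i
    unfolding xy by (rule has_pd_scale[OF smooth_pd1(2)[OF sm that(1)] that(1) c _ y])
      (rule s1[OF that])
  have "(\<Sum>i<N. pds [i, i] ?F x) = (1 / c) / c * (\<Sum>i<N. pds [i, i] ?F y)"
    unfolding sum_distrib_left by (rule sum.cong[OF refl]) (rule s2, simp)
  also have "(\<Sum>i<N. pds [i, i] ?F y) = ext0 N (sph_laplacian N f) x"
    by (simp add: sph_laplacian_def ext0_proj y_def)
  also have "(1 / c) / c * ext0 N (sph_laplacian N f) x = ext0 N (sph_laplacian N f) x / nsq N x"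
    using nsq_pos[OF x] by (simp add: c_def)
  finally show ?thesis .
qed

text \<open>Second derivatives of the extension have degree -2, so its Laplacian carries a factor
  \<open>1 / nsq N x\<close>, which turns the \<open>phi\<close> of \<open>green\<close> into the
  \<open>psi\<close> of \<open>ip\<close>. The right-hand side is symmetric in f and g; this is
  where self-adjointness comes from.\<close>

lemma ip_laplacian:
  assumes sm: "smooth_punct N (ext0 N f)" "smooth_punct N (ext0 N g)"
  shows "ip N (sph_laplacian N f) g =
    - vint N (\<lambda>x. (\<Sum>i<N. pds [i] (ext0 N f) x * pds [i] (ext0 N g) x) * phi (nsq N x))"
proof -
  let ?F = "ext0 N f" and ?G = "ext0 N g"
  have "(\<Sum>i<N. x i * pds [i] ?F x) = 0" if "x \<in> punctured N" for x
    by (rule euler_homogeneous[of N ?F, OF smooth_pd1(1)[OF sm(1)] smooth_pd1(4)[OF sm(1)] ext0_scale that])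
  then have green: "vint N (\<lambda>x. ((\<Sum>i<N. pds [i, i] ?F x) * ?G x) * phi (nsq N x)) =
     - vint N (\<lambda>x. (\<Sum>i<N. pds [i] ?F x * pds [i] ?G x) * phi (nsq N x))"
    by (intro green[OF smooth_pd1(2)[OF sm(1)] smooth_pd1(4)[OF sm(1)] smooth_pd1(5)[OF sm(1)]
        smooth_pd1(1)[OF sm(2)] smooth_punct_cont[OF sm(2), of "[]", unfolded pds.simps(1)]
        smooth_pd1(4)[OF sm(2)]]) simp_all
  have lap: "vint N (\<lambda>x. ((\<Sum>i<N. pds [i, i] ?F x) * ?G x) * phi (nsq N x)) =
      ip N (sph_laplacian N f) g"
    unfolding ip_def
  proof (rule vint_cong)
    fix x assume x: "x \<in> vecs N"
    show "((\<Sum>i<N. pds [i, i] ?F x) * ?G x) * phi (nsq N x) =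
        (ext0 N (sph_laplacian N f) x * ?G x) * psi (nsq N x)"
    proof (cases "x \<in> punctured N")
      case True
      show ?thesis unfolding laplacian_ext0[OF sm(1) True] psi_eq[symmetric]
        by (simp only: times_divide_eq_left times_divide_eq_right)
    next
      case False
      then have "nsq N x = 0" using x nsq_nonneg[of N x] by (auto simp: punctured_iff)
      then show ?thesis using phi_out(1)[of 0] psi_out[of 0] by simp
    qed
  qed
  show ?thesis using green unfolding lap .
qed

lemma ip_commute: "ip N f g = ip N g f"
  by (simp add: ip_def mult.commute)

lemma laplacian_selfadjoint:
  assumes "smooth_punct N (ext0 N f)" "smooth_punct N (ext0 N g)"
  shows "ip N (sph_laplacian N f) g = ip N f (sph_laplacian N g)"
  using ip_laplacian[OF assms] ip_laplacian[OF assms(2,1)] ip_commute[of N f]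
  by (simp add: mult.commute del: pds.simps)

lemma ext0_cong:
  "(\<And>x. x \<in> sphere_pts N \<Longrightarrow> f x = g x) \<Longrightarrow> x \<in> punctured N \<Longrightarrow> ext0 N f x = ext0 N g x"
  by (simp add: ext0_proj proj_sphere)

lemma continuous_ext0:
  "continuous_on (sphere_pts N) f \<Longrightarrow> continuous_on (punctured N) (ext0 N f)"
  unfolding ext0_proj[abs_def]
  by (rule continuous_on_compose2[OF _ continuous_on_proj]) (auto simp: proj_sphere)

lemma smooth_continuous_sphere:
  assumes "smooth_punct N (ext0 N f)"
  shows "continuous_on (sphere_pts N) f"
proof (rule continuous_on_eq)
  show "continuous_on (sphere_pts N) (ext0 N f)"
    using smooth_punct_cont[OF assms, of "[]"] by (intro continuous_on_subset[OF _ sphere_pts_punctured]) simp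
qed (simp add: ext0_id)

lemma ip_cong:
  assumes "\<And>x. x \<in> sphere_pts N \<Longrightarrow> f x = f' x" "\<And>x. x \<in> sphere_pts N \<Longrightarrow> g x = g' x"
  shows "ip N f g = ip N f' g'"
  unfolding ip_def
proof (rule vint_cong)
  fix x assume x: "x \<in> vecs N"
  show "ext0 N f x * ext0 N g x * psi (nsq N x) = ext0 N f' x * ext0 N g' x * psi (nsq N x)"
  proof (cases "x \<in> punctured N")
    case True
    then show ?thesis using ext0_cong[of N f f'] ext0_cong[of N g g'] assms by simp
  next
    case False
    then have "nsq N x = 0" using x nsq_nonneg[of N x] by (auto simp: punctured_iff)
    then show ?thesis using psi_out[of 0] by simp
  qed
qed

lemma csupp_ip:
  assumes "continuous_on (sphere_pts N) f" "continuous_on (sphere_pts N) g"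
  shows "csupp N (\<lambda>x. (ext0 N f x * ext0 N g x) * psi (nsq N x))"
  by (intro csupp_radial continuous_psi psi_out continuous_on_mult continuous_ext0 assms)

lemma ip_add:
  assumes "continuous_on (sphere_pts N) f" "continuous_on (sphere_pts N) g" "continuous_on (sphere_pts N) h"
  shows "ip N (\<lambda>x. f x + g x) h = ip N f h + ip N g h"
proof -
  have "ip N f h + ip N g h = vint N (\<lambda>x. (ext0 N f x * ext0 N h x) * psi (nsq N x) +
      (ext0 N g x * ext0 N h x) * psi (nsq N x))"
    unfolding ip_def using assms by (intro vint_add[symmetric] csupp_ip)
  also have "\<dots> = ip N (\<lambda>x. f x + g x) h"
    unfolding ip_def by (rule vint_cong) (simp add: ext0_proj algebra_simps)
  finally show ?thesis by simp
qed

lemma ip_cmult: "ip N (\<lambda>x. c * f x) h = c * ip N f h"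
proof -
  have "c * ip N f h = vint N (\<lambda>x. c * ((ext0 N f x * ext0 N h x) * psi (nsq N x)))"
    unfolding ip_def by (rule vint_cmult[symmetric])
  also have "\<dots> = ip N (\<lambda>x. c * f x) h"
    unfolding ip_def by (rule vint_cong) (simp add: ext0_proj algebra_simps)
  finally show ?thesis by simp
qed

lemma ip_eq_0_imp:
  assumes "continuous_on (sphere_pts N) f" "ip N f f = 0" "x \<in> sphere_pts N"
  shows "f x = 0"
proof -
  \<comment> \<open>The factor puts y in the interior of the shell, where \<open>psi\<close> is
    positive.\<close>
  define y where "y = (\<lambda>i. sqrt (3/2) * x i)"
  have n: "nsq N y = 3 / 2" using assms(3) by (simp add: y_def nsq_scale sphere_pts_iff)
  have y: "y \<in> vecs N" using assms(3) by (auto simp: y_def sphere_pts_iff vecs_def)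
  have "ext0 N f y * ext0 N f y * psi (nsq N y) = 0"
    by (rule vint_eq_0_imp[OF csupp_ip[OF assms(1,1)] _ _ y])
      (use assms(2) psi_nonneg in \<open>auto simp: ip_def\<close>)
  then have "ext0 N f y = 0" using psi_pos[of "3/2"] n by simp
  moreover have "ext0 N f y = f x"
    unfolding y_def by (subst ext0_scale) (auto simp: ext0_id assms(3))
  ultimately show ?thesis by simp
qed

lemma vint_mono:
  assumes "csupp N H" "csupp N K" "\<And>x. x \<in> vecs N \<Longrightarrow> H x \<le> K x"
  shows "vint N H \<le> vint N K"
  unfolding vint_def by (rule integral_mono[OF integrable_csupp integrable_csupp])
    (use assms trunc_vecs in auto)

text \<open>Meant for g the error of a uniform polynomial approximation to f.\<close>

lemma ip_sup_bound:
  assumes f: "continuous_on (sphere_pts N) f" and g: "continuous_on (sphere_pts N) g"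
    and "\<And>x. x \<in> sphere_pts N \<Longrightarrow> \<bar>g x\<bar> \<le> e"
  shows "ip N f g \<le> e * ip N (\<lambda>x. \<bar>f x\<bar>) (\<lambda>x. 1)"
proof -
  have "ip N f g \<le> vint N (\<lambda>x. e * ((ext0 N (\<lambda>x. \<bar>f x\<bar>) x * ext0 N (\<lambda>x. 1) x) * psi (nsq N x)))"
    unfolding ip_def
  proof (rule vint_mono)
    show "csupp N (\<lambda>x. ext0 N f x * ext0 N g x * psi (nsq N x))" using f g by (rule csupp_ip)
    show "csupp N (\<lambda>x. e * (ext0 N (\<lambda>x. \<bar>f x\<bar>) x * ext0 N (\<lambda>x. 1) x * psi (nsq N x)))"
      using f by (intro csupp_cmult csupp_ip continuous_on_rabs continuous_on_const)
    fix x assume x: "x \<in> vecs N"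
    show "ext0 N f x * ext0 N g x * psi (nsq N x) \<le>
        e * (ext0 N (\<lambda>x. \<bar>f x\<bar>) x * ext0 N (\<lambda>x. 1) x * psi (nsq N x))"
    proof (cases "x \<in> punctured N")
      case True
      have "f (proj N x) * g (proj N x) \<le> \<bar>f (proj N x)\<bar> * \<bar>g (proj N x)\<bar>"
        by (metis abs_ge_self abs_mult)
      also have "\<dots> \<le> \<bar>f (proj N x)\<bar> * e"
        using assms(3)[OF proj_sphere[OF True]] by (rule mult_left_mono) simp
      finally have "f (proj N x) * g (proj N x) * psi (nsq N x) \<le> \<bar>f (proj N x)\<bar> * e * psi (nsq N x)"
        by (rule mult_right_mono) (rule psi_nonneg)
      then show ?thesis by (simp add: ext0_proj algebra_simps)
    next
      case False
      then have "nsq N x = 0" using x nsq_nonneg[of N x] by (auto simp: punctured_iff)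
      then show ?thesis using psi_out[of 0] by simp
    qed
  qed
  also have "\<dots> = e * ip N (\<lambda>x. \<bar>f x\<bar>) (\<lambda>x. 1)"
    unfolding ip_def by (rule vint_cmult)
  finally show ?thesis .
qed

lemma compact_sphere: "compact (sphere_pts N)"
proof -
  have "sphere_pts N = {x \<in> vecs N. \<forall>i<N. \<bar>x i\<bar> \<le> 1} \<inter> {x. nsq N x = 1}"
  proof (intro set_eqI)
    fix x :: pt
    have "\<bar>x i\<bar> \<le> 1" if "nsq N x = 1" "i < N" for i
      using abs_le_of_nsq_le[of N x 1 i] that by simp
    then show "x \<in> sphere_pts N \<longleftrightarrow> x \<in> {x \<in> vecs N. \<forall>i<N. \<bar>x i\<bar> \<le> 1} \<inter> {x. nsq N x = 1}"
      unfolding sphere_pts_iff by blast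
  qed
  moreover have "closed {x. nsq N x = 1}"
    by (intro closed_Collect_eq continuous_on_nsq continuous_on_const)
  ultimately show ?thesis by (simp only: compact_Int_closed[OF compact_box])
qed

section \<open>Homogeneous polynomials in diagonalizing coordinates\<close>

text \<open>\<open>zeta n (par n l)\<close> is the complex conjugate of \<open>zeta n l\<close>;
  beyond the n planes the coordinates are real and \<open>par\<close> fixes the index.\<close>

definition par :: "nat \<Rightarrow> nat \<Rightarrow> nat" where
  "par n l = (if l < 2 * n then if even l then l + 1 else l - 1 else l)"

definition kA :: "nat \<Rightarrow> nat \<Rightarrow> complex" where
  "kA n l = (if l < 2 * n \<and> odd l then - \<i> else 1)"

definition kB :: "nat \<Rightarrow> nat \<Rightarrow> complex" where
  "kB n l = (if l < 2 * n then if even l then \<i> else 1 else 0)"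

text \<open>The coordinates diagonalizing the rotations: \<open>x (2 j) \<plusminus> i x (2 j + 1)\<close> on the
  first n coordinate planes, and the remaining real coordinates.\<close>
definition zeta :: "nat \<Rightarrow> nat \<Rightarrow> pt \<Rightarrow> complex" where
  "zeta n l x = kA n l * of_real (x l) + kB n l * of_real (x (par n l))"

text \<open>The i-th partial derivative of \<open>zeta n l\<close>, which is a constant.\<close>

definition kap :: "nat \<Rightarrow> nat \<Rightarrow> nat \<Rightarrow> complex" where
  "kap n l i = (if i = l then kA n l else 0) + (if i = par n l then kB n l else 0)"

definition mon :: "nat \<Rightarrow> nat \<Rightarrow> (nat \<Rightarrow> nat) \<Rightarrow> pt \<Rightarrow> complex" where
  "mon n N a x = (\<Prod>l<N. zeta n l x ^ a l)"

definition down :: "(nat \<Rightarrow> nat) \<Rightarrow> nat \<Rightarrow> (nat \<Rightarrow> nat)" where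
  "down a l = a(l := a l - 1)"

definition Idx :: "nat \<Rightarrow> nat \<Rightarrow> (nat \<Rightarrow> nat) set" where
  "Idx N k = {a. (\<forall>i\<ge>N. a i = 0) \<and> (\<Sum>i<N. a i) = k}"

text \<open>A real-linear functional: \<open>cas z\<close> and \<open>cas (cnj z)\<close> together determine z.\<close>
definition cas :: "complex \<Rightarrow> real" where
  "cas z = Re z + Im z"

definition ee :: "nat \<Rightarrow> nat \<Rightarrow> (nat \<Rightarrow> nat) \<Rightarrow> pt \<Rightarrow> real" where
  "ee n N a x = cas (mon n N a x)"

text \<open>The bilinear, not Hermitian, product of the gradients of two coordinates
  (\<open>kap_kap\<close>). It pairs a coordinate with its conjugate: in a plane the Laplacian is 4
  times the mixed derivative in z and its conjugate, and each of the two orders counts 2.\<close>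

definition Kr :: "nat \<Rightarrow> nat \<Rightarrow> nat \<Rightarrow> real" where
  "Kr n l m = (if l < 2 * n then if m = par n l then 2 else 0 else if m = l then 1 else 0)"

lemma cas_sum: "cas (\<Sum>a\<in>A. f a) = (\<Sum>a\<in>A. cas (f a))"
  by (simp add: cas_def sum.distrib)

lemma cas_scale: "cas (of_real c * z) = c * cas z"
  by (simp add: cas_def algebra_simps)

lemma bounded_linear_cas: "bounded_linear cas"
  unfolding cas_def[abs_def] by (intro bounded_linear_add bounded_linear_Re bounded_linear_Im)

lemma finite_Idx: "finite (Idx N k)"
proof (rule finite_subset)
  show "Idx N k \<subseteq> {a. \<forall>i. (i \<in> {..<N} \<longrightarrow> a i \<in> {..k}) \<and> (i \<notin> {..<N} \<longrightarrow> a i = 0)}"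
  proof
    fix a assume a: "a \<in> Idx N k"
    have "a i \<le> (\<Sum>i<N. a i)" if "i < N" for i by (rule member_le_sum) (use that in auto)
    then show "a \<in> {a. \<forall>i. (i \<in> {..<N} \<longrightarrow> a i \<in> {..k}) \<and> (i \<notin> {..<N} \<longrightarrow> a i = 0)}"
      using a by (auto simp: Idx_def)
  qed
  show "finite {a::nat \<Rightarrow> nat. \<forall>i. (i \<in> {..<N} \<longrightarrow> a i \<in> {..k}) \<and> (i \<notin> {..<N} \<longrightarrow> a i = 0)}"
    by (rule finite_set_of_finite_funs) auto
qed

lemma sum_fun_upd:
  fixes a :: "nat \<Rightarrow> nat"
  assumes "l < N"
  shows "(\<Sum>i<N. (a(l := v)) i) + a l = (\<Sum>i<N. a i) + v"
proof -
  have "(\<Sum>i<N. (a(l := v)) i) = v + (\<Sum>i\<in>{..<N}-{l}. a i)"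
    using assms by (simp add: sum.remove[of _ l])
  moreover have "(\<Sum>i<N. a i) = a l + (\<Sum>i\<in>{..<N}-{l}. a i)"
    using assms by (simp add: sum.remove[of _ l])
  ultimately show ?thesis by simp
qed

lemma down_Idx:
  assumes "a \<in> Idx N (Suc k)" "l < N" "a l \<noteq> 0"
  shows "down a l \<in> Idx N k"
  using assms sum_fun_upd[OF assms(2), of a "a l - 1"]
  by (auto simp: Idx_def down_def)

lemma par_par: "par n (par n l) = l"
proof -
  have "l - Suc 0 < 2 * n" if "l < 2 * n" "odd l" using that by auto
  moreover have "Suc l < 2 * n" if "l < 2 * n" "even l" using that by (metis Suc_lessI dvd_triv_left even_Suc)
  moreover have "Suc (l - Suc 0) = l" "even (l - Suc 0)" if "odd l" using that by (auto elim: oddE)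
  ultimately show ?thesis by (auto simp: par_def)
qed

lemma par_lt: "2 * n \<le> N \<Longrightarrow> l < N \<Longrightarrow> par n l < N"
proof -
  assume "2 * n \<le> N" "l < N"
  moreover have "Suc l < 2 * n" if "l < 2 * n" "even l" using that by (metis Suc_lessI dvd_triv_left even_Suc)
  ultimately show ?thesis by (auto simp: par_def less_imp_diff_less)
qed

lemma par_lt2: "par n l < 2 * n \<longleftrightarrow> l < 2 * n"
  using par_lt[of n "2 * n" l] by (auto simp: par_def)

lemma par_eq_iff: "par n l = m \<longleftrightarrow> l = par n m"
  using par_par by metis

lemma par_neq: "l < 2 * n \<Longrightarrow> par n l \<noteq> l"
  by (auto simp: par_def elim: oddE)

lemma even_par: "l < 2 * n \<Longrightarrow> even (par n l) \<longleftrightarrow> odd l"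
  by (auto simp: par_def)

lemma zeta_kap: "2 * n \<le> N \<Longrightarrow> l < N \<Longrightarrow> zeta n l x = (\<Sum>i<N. of_real (x i) * kap n l i)"
proof -
  assume "2 * n \<le> N" "l < N"
  moreover have "par n l < N" using calculation by (rule par_lt)
  moreover have "(\<Sum>i<N. of_real (x i) * kap n l i) = (\<Sum>i<N. (if i = l then of_real (x i) * kA n l else 0))
     + (\<Sum>i<N. (if i = par n l then of_real (x i) * kB n l else 0))"
    unfolding sum.distrib[symmetric] by (rule sum.cong) (auto simp: kap_def algebra_simps)
  ultimately show ?thesis by (simp add: zeta_def)
qed

lemma zeta_upd: "zeta n l (x(i := x i + t)) = zeta n l x + of_real t * kap n l i"
  by (auto simp: zeta_def kap_def algebra_simps)

lemma kap_kap:
  assumes "2 * n \<le> N" "l < N"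
  shows "(\<Sum>i<N. kap n l i * kap n m i) = of_real (Kr n l m)"
proof -
  have "(\<Sum>i<N. kap n l i * kap n m i) = (\<Sum>i<N. (if i = l then kA n l * kap n m i else 0))
     + (\<Sum>i<N. (if i = par n l then kB n l * kap n m i else 0))"
    unfolding sum.distrib[symmetric] by (rule sum.cong) (auto simp: kap_def[of n l] algebra_simps)
  also have "\<dots> = kA n l * kap n m l + kB n l * kap n m (par n l)"
    using assms par_lt[OF assms] by simp
  also have "\<dots> = of_real (Kr n l m)"
  proof (cases "l < 2 * n")
    case True
    consider "m = l" | "m = par n l" "m \<noteq> l" | "m \<noteq> l" "m \<noteq> par n l" by blast
    then show ?thesis
    proof cases
      case 1
      then show ?thesis using True par_neq[OF True]
        by (cases "even l") (auto simp: kap_def kA_def kB_def Kr_def)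
    next
      case 2
      then show ?thesis using True par_neq[OF True] par_lt2[of n l] even_par[OF True]
        by (cases "even l") (auto simp: kap_def kA_def kB_def Kr_def par_par)
    next
      case 3
      then have "l \<noteq> par n m" "par n l \<noteq> par n m" using par_par by metis+
      with 3 show ?thesis using True by (auto simp: kap_def Kr_def)
    qed
  next
    case False
    moreover have "l \<noteq> par n m \<or> m = l" using False by (metis par_def par_par)
    ultimately show ?thesis
      by (auto simp: kap_def kA_def kB_def Kr_def par_def)
  qed
  finally show ?thesis .
qed

lemma mon_split: "l < N \<Longrightarrow> mon n N a x = zeta n l x ^ a l * (\<Prod>m\<in>{..<N}-{l}. zeta n m x ^ a m)"
  by (simp add: mon_def prod.remove[of _ l])

lemma mon_down:
  "l < N \<Longrightarrow> mon n N (down a l) x = zeta n l x ^ (a l - 1) * (\<Prod>m\<in>{..<N}-{l}. zeta n m x ^ a m)"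
  by (simp add: mon_split down_def)

definition dmon :: "nat \<Rightarrow> nat \<Rightarrow> nat \<Rightarrow> (nat \<Rightarrow> nat) \<Rightarrow> pt \<Rightarrow> complex" where
  "dmon n N i a x = (\<Sum>l<N. kap n l i * of_nat (a l) * mon n N (down a l) x)"

lemma mon_has_derivative:
  "((\<lambda>t. mon n N a (x(i := x i + t))) has_vector_derivative dmon n N i a x) (at 0)"
proof -
  have "((\<lambda>\<tau>. \<Prod>l<N. (zeta n l x + \<tau> * kap n l i) ^ a l) has_field_derivative
     (\<Sum>l<N. (of_nat (a l) * zeta n l x ^ (a l - 1) * kap n l i) *
        (\<Prod>m\<in>{..<N}-{l}. (zeta n m x + 0 * kap n m i) ^ a m))) (at 0)"
  proof (rule has_field_derivative_prod)
    fix l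
    show "((\<lambda>\<tau>. (zeta n l x + \<tau> * kap n l i) ^ a l) has_field_derivative
        of_nat (a l) * zeta n l x ^ (a l - 1) * kap n l i) (at 0)"
      by (auto intro!: derivative_eq_intros)
  qed
  also have "(\<Sum>l<N. (of_nat (a l) * zeta n l x ^ (a l - 1) * kap n l i) *
        (\<Prod>m\<in>{..<N}-{l}. (zeta n m x + 0 * kap n m i) ^ a m)) = dmon n N i a x"
    unfolding dmon_def by (rule sum.cong) (auto simp: mon_down algebra_simps)
  finally have "((\<lambda>\<tau>. \<Prod>l<N. (zeta n l x + \<tau> * kap n l i) ^ a l) has_field_derivative
      dmon n N i a x) (at (of_real 0))" by simp
  from has_vector_derivative_real_field[OF this]
  show ?thesis by (simp add: mon_def zeta_upd)
qed

lemma cas_has_pd: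
  assumes "\<And>x. ((\<lambda>t. f (x(i := x i + t))) has_vector_derivative f' x) (at 0)"
  shows "has_pd N i (\<lambda>x. cas (f x)) (\<lambda>x. cas (f' x))"
  unfolding has_pd_def
  using bounded_linear.has_vector_derivative[OF bounded_linear_cas assms]
  by (simp add: has_real_derivative_iff_has_vector_derivative)

lemma ee_pd1: "has_pd N i (ee n N a) (\<lambda>x. cas (dmon n N i a x))"
  unfolding ee_def[abs_def] by (rule cas_has_pd) (rule mon_has_derivative)

lemma dmon_has_derivative:
  "((\<lambda>t. dmon n N i a (x(i := x i + t))) has_vector_derivative
     (\<Sum>l<N. kap n l i * of_nat (a l) * dmon n N i (down a l) x)) (at 0)"
  unfolding dmon_def[of n N i a]
  by (intro has_vector_derivative_sum has_vector_derivative_mult_right mon_has_derivative)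

lemma ee_pd2: "has_pd N i (\<lambda>x. cas (dmon n N i a x))
    (\<lambda>x. cas (\<Sum>l<N. kap n l i * of_nat (a l) * dmon n N i (down a l) x))"
  by (rule cas_has_pd) (rule dmon_has_derivative)

lemma ee_laplacian:
  assumes "2 * n \<le> N"
  shows "(\<Sum>i<N. cas (\<Sum>l<N. kap n l i * of_nat (a l) * dmon n N i (down a l) x)) =
     (\<Sum>l<N. \<Sum>m<N. Kr n l m * real (a l) * real (down a l m) * ee n N (down (down a l) m) x)"
proof -
  have "(\<Sum>i<N. cas (\<Sum>l<N. kap n l i * of_nat (a l) * dmon n N i (down a l) x)) =
     cas (\<Sum>i<N. \<Sum>l<N. \<Sum>m<N. kap n l i * kap n m i *
        (of_nat (a l) * of_nat (down a l m) * mon n N (down (down a l) m) x))"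
    unfolding cas_sum[symmetric] dmon_def by (simp add: sum_distrib_left algebra_simps)
  also have "(\<Sum>i<N. \<Sum>l<N. \<Sum>m<N. kap n l i * kap n m i *
        (of_nat (a l) * of_nat (down a l m) * mon n N (down (down a l) m) x)) =
     (\<Sum>l<N. \<Sum>m<N. (\<Sum>i<N. kap n l i * kap n m i) *
        (of_nat (a l) * of_nat (down a l m) * mon n N (down (down a l) m) x))"
    unfolding sum_distrib_right
    by (subst sum.swap, rule sum.cong[OF refl], rule sum.swap)
  also have "\<dots> = (\<Sum>l<N. \<Sum>m<N. of_real (Kr n l m * real (a l) * real (down a l m)) *
        mon n N (down (down a l) m) x)"
    by (intro sum.cong refl) (simp add: kap_kap assms)
  finally show ?thesis by (simp only: cas_sum cas_scale ee_def)
qed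

lemma ee_euler:
  assumes "2 * n \<le> N" "a \<in> Idx N k"
  shows "(\<Sum>i<N. x i * cas (dmon n N i a x)) = real k * ee n N a x"
proof -
  have "(\<Sum>i<N. x i * cas (dmon n N i a x)) = cas (\<Sum>i<N. of_real (x i) * dmon n N i a x)"
    by (simp only: cas_sum cas_scale)
  also have "(\<Sum>i<N. of_real (x i) * dmon n N i a x) =
      (\<Sum>l<N. (\<Sum>i<N. of_real (x i) * kap n l i) * of_nat (a l) * mon n N (down a l) x)"
    unfolding dmon_def sum_distrib_left sum_distrib_right
    by (subst sum.swap) (simp add: algebra_simps)
  also have "\<dots> = (\<Sum>l<N. of_nat (a l) * mon n N a x)"
  proof (rule sum.cong[OF refl])
    fix l assume l: "l \<in> {..<N}"
    have "(\<Sum>i<N. of_real (x i) * kap n l i) * of_nat (a l) * mon n N (down a l) x =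
        of_nat (a l) * (zeta n l x * zeta n l x ^ (a l - 1)) * (\<Prod>m\<in>{..<N}-{l}. zeta n m x ^ a m)"
      using l by (simp add: zeta_kap[OF assms(1), symmetric] mon_down)
    also have "\<dots> = of_nat (a l) * mon n N a x"
      using l by (cases "a l") (simp_all add: mon_split)
    finally show "(\<Sum>i<N. of_real (x i) * kap n l i) * of_nat (a l) * mon n N (down a l) x =
        of_nat (a l) * mon n N a x" .
  qed
  also have "\<dots> = of_real (real k) * mon n N a x"
    using assms(2) by (simp add: sum_distrib_right[symmetric] Idx_def flip: of_nat_sum)
  finally show ?thesis by (simp only: cas_scale ee_def)
qed

lemma zeta_scale: "zeta n l (\<lambda>i. c * x i) = of_real c * zeta n l x"
  by (simp add: zeta_def algebra_simps)

lemma mon_scale: "a \<in> Idx N k \<Longrightarrow> mon n N a (\<lambda>i. c * x i) = of_real c ^ k * mon n N a x"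
  by (simp add: mon_def zeta_scale power_mult_distrib prod.distrib power_sum[symmetric] Idx_def)

lemma ee_scale: "a \<in> Idx N k \<Longrightarrow> ee n N a (\<lambda>i. c * x i) = c ^ k * ee n N a x"
  unfolding ee_def by (simp add: mon_scale cas_scale flip: of_real_power)

definition cnice :: "nat \<Rightarrow> (pt \<Rightarrow> complex) \<Rightarrow> bool" where
  "cnice N f \<longleftrightarrow> (\<lambda>x. Re (f x)) \<in> nice N \<and> (\<lambda>x. Im (f x)) \<in> nice N"

lemma nice_cmult: "f \<in> nice N \<Longrightarrow> (\<lambda>x. c * f x) \<in> nice N"
  by (rule nice.mult[OF nice.const])

lemma nice_diff: "f \<in> nice N \<Longrightarrow> g \<in> nice N \<Longrightarrow> (\<lambda>x. f x - g x) \<in> nice N"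
  using nice.add[OF _ nice_cmult[of g N "-1"], of f] by simp

lemma cnice_const: "cnice N (\<lambda>x. c)"
  by (simp add: cnice_def nice.const)

lemma cnice_coord: "i < N \<Longrightarrow> cnice N (\<lambda>x. of_real (x i))"
  by (simp add: cnice_def nice.const nice.coord)

lemma cnice_add: "cnice N f \<Longrightarrow> cnice N g \<Longrightarrow> cnice N (\<lambda>x. f x + g x)"
  by (simp add: cnice_def nice.add)

lemma cnice_mult: "cnice N f \<Longrightarrow> cnice N g \<Longrightarrow> cnice N (\<lambda>x. f x * g x)"
  by (simp add: cnice_def nice.add nice.mult nice_diff)

lemma cnice_power: "cnice N f \<Longrightarrow> cnice N (\<lambda>x. f x ^ k)"
  by (induction k) (simp_all add: cnice_const cnice_mult)

lemma cnice_prod: "(\<And>a. a \<in> A \<Longrightarrow> cnice N (f a)) \<Longrightarrow> cnice N (\<lambda>x. \<Prod>a\<in>A. f a x)"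
  by (induction A rule: infinite_finite_induct) (simp_all add: cnice_const cnice_mult)

lemma ee_nice: "2 * n \<le> N \<Longrightarrow> ee n N a \<in> nice N"
proof -
  assume "2 * n \<le> N"
  then have "cnice N (mon n N a)"
    unfolding mon_def[abs_def] zeta_def
    by (intro cnice_prod cnice_power cnice_add cnice_mult cnice_const cnice_coord) (auto intro: par_lt)
  then show ?thesis unfolding ee_def[abs_def] cas_def cnice_def by (intro nice.add) auto
qed

lemma inv_norm_power_pd: "i < N \<Longrightarrow> has_pd N i (\<lambda>x. inv_norm N x ^ k) (\<lambda>x. - real k * x i * inv_norm N x ^ (k + 2))"
proof (induction k)
  case 0
  then show ?case using has_pd_const[of N i 1] by simp
next
  case (Suc k)
  have "has_pd N i (\<lambda>x. inv_norm N x * inv_norm N x ^ k)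
     (\<lambda>x. (- x i * inv_norm N x ^ 3) * inv_norm N x ^ k + inv_norm N x * (- real k * x i * inv_norm N x ^ (k + 2)))"
    by (rule has_pd_mult[OF has_pd_inv_norm[OF Suc.prems] Suc.IH[OF Suc.prems]])
  then show ?case
    by (rule has_pd_cong[OF _ Suc.prems]) (simp_all add: algebra_simps power_add power3_eq_cube)
qed

text \<open>The extension is e times the norm to the power -k. Two product rules give four terms; on
  the sphere Euler's relation and \<open>nsq N x = 1\<close> collapse the last three to -2 k^2 - N k
  + k (k + 2), that is -k (k + N - 2), times e.\<close>

lemma sph_laplacian_homogeneous:
  assumes nice: "e \<in> nice N"
    and hom: "\<And>c x. e (\<lambda>i. c * x i) = c ^ k * e x"
    and e1: "\<And>i. i < N \<Longrightarrow> has_pd N i e (e1 i)"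
    and e2: "\<And>i. i < N \<Longrightarrow> has_pd N i (e1 i) (e2 i)"
    and euler: "\<And>x. (\<Sum>i<N. x i * e1 i x) = real k * e x"
  shows "smooth_punct N (ext0 N e)"
    and "x \<in> sphere_pts N \<Longrightarrow>
      sph_laplacian N e x = (\<Sum>i<N. e2 i x) - real k * (real k + real N - 2) * e x"
proof -
  let ?F = "\<lambda>x. e x * inv_norm N x ^ k"
  have F: "ext0 N e x = ?F x" for x
  proof -
    have "proj N x = (\<lambda>i. inv_norm N x * x i)" by (simp add: proj_def inv_norm_def)
    then show ?thesis by (simp add: ext0_proj hom)
  qed
  have Fn: "?F \<in> nice N" by (intro nice.mult nice nice_power nice.inv_norm)
  then show sm: "smooth_punct N (ext0 N e)"
    using nice_smooth[of ?F N] by (simp add: F[abs_def])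
  assume x: "x \<in> sphere_pts N"
  then have xp: "x \<in> punctured N" using sphere_pts_punctured by blast
  have r1: "inv_norm N x = 1" using x by (simp add: inv_norm_def sphere_pts_iff)
  have lap: "pds [i, i] (ext0 N e) x = e2 i x - 2 * real k * (x i * e1 i x)
      - real k * e x + real k * (real k + 2) * e x * (x i)\<^sup>2" if i: "i < N" for i
  proof -
    let ?F1 = "\<lambda>x. e1 i x * inv_norm N x ^ k + (e x * - real k) * (x i * inv_norm N x ^ (k + 2))"
    have 1: "has_pd N i ?F ?F1"
      by (rule has_pd_cong[OF has_pd_mult[OF e1[OF i] inv_norm_power_pd[OF i]] i]) (auto simp: algebra_simps)
    have xi: "has_pd N i (\<lambda>x. x i) (\<lambda>x. 1)" using has_pd_coord[of N i i] by simp
    have 2: "has_pd N i ?F1 (\<lambda>x. (e2 i x * inv_norm N x ^ k + e1 i x * (- real k * x i * inv_norm N x ^ (k + 2)))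
      + ((e1 i x * - real k + e x * 0) * (x i * inv_norm N x ^ (k + 2))
      + (e x * - real k) * (1 * inv_norm N x ^ (k + 2) + x i * (- real (k + 2) * x i * inv_norm N x ^ (k + 2 + 2)))))"
      by (intro has_pd_add has_pd_mult e1 e2 i inv_norm_power_pd has_pd_const xi)
    have "pds [i] (ext0 N e) y = ?F1 y" if "y \<in> punctured N" for y
      by (rule pds_step(1)[OF 1 i _ that]) (simp add: F)
    then have "pds [i, i] (ext0 N e) x = (e2 i x * inv_norm N x ^ k + e1 i x * (- real k * x i * inv_norm N x ^ (k + 2)))
      + ((e1 i x * - real k + e x * 0) * (x i * inv_norm N x ^ (k + 2))
      + (e x * - real k) * (1 * inv_norm N x ^ (k + 2) + x i * (- real (k + 2) * x i * inv_norm N x ^ (k + 2 + 2))))"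
      by (rule pds_step(1)[OF 2 i _ xp])
    then show ?thesis by (simp add: r1 algebra_simps power2_eq_square del: pds.simps)
  qed
  have "sph_laplacian N e x = (\<Sum>i<N. e2 i x - 2 * real k * (x i * e1 i x)
      - real k * e x + real k * (real k + 2) * e x * (x i)\<^sup>2)"
    unfolding sph_laplacian_def by (rule sum.cong[OF refl]) (rule lap, simp)
  also have "\<dots> = (\<Sum>i<N. e2 i x) - 2 * real k * (\<Sum>i<N. x i * e1 i x) - real N * (real k * e x)
      + real k * (real k + 2) * e x * nsq N x"
    by (simp add: sum.distrib sum_subtractf sum_distrib_left nsq_def)
  also have "nsq N x = 1" using x by (simp add: sphere_pts_iff)
  finally show "sph_laplacian N e x = (\<Sum>i<N. e2 i x) - real k * (real k + real N - 2) * e x"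
    by (simp add: euler algebra_simps)
qed

lemma ee_sph_laplacian:
  assumes "2 * n \<le> N" "a \<in> Idx N k"
  shows "smooth_punct N (ext0 N (ee n N a))"
    and "x \<in> sphere_pts N \<Longrightarrow> sph_laplacian N (ee n N a) x =
     (\<Sum>l<N. \<Sum>m<N. Kr n l m * real (a l) * real (down a l m) * ee n N (down (down a l) m) x)
       - real k * (real k + real N - 2) * ee n N a x"
proof -
  note hom = ee_nice[OF assms(1)] ee_scale[OF assms(2)] ee_pd1 ee_pd2 ee_euler[OF assms]
  show "smooth_punct N (ext0 N (ee n N a))"
    by (rule sph_laplacian_homogeneous(1)[OF hom])
  show "sph_laplacian N (ee n N a) x =
     (\<Sum>l<N. \<Sum>m<N. Kr n l m * real (a l) * real (down a l m) * ee n N (down (down a l) m) x)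
       - real k * (real k + real N - 2) * ee n N a x" if "x \<in> sphere_pts N"
    using sph_laplacian_homogeneous(2)[OF hom that] by (simp only: ee_laplacian[OF assms(1)])
qed

section \<open>Linear independence of the monomials\<close>

lemma digits_inject:
  fixes a b :: "nat \<Rightarrow> nat"
  assumes "\<And>l. l < N \<Longrightarrow> a l < K" "\<And>l. l < N \<Longrightarrow> b l < K"
    and "(\<Sum>l<N. K ^ l * a l) = (\<Sum>l<N. K ^ l * b l)" "l < N"
  shows "a l = b l"
  using assms
proof (induction N arbitrary: a b l)
  case (Suc N)
  have sh: "(\<Sum>l<Suc N. K ^ l * c l) = c 0 + K * (\<Sum>l<N. K ^ l * c (Suc l))" for c :: "nat \<Rightarrow> nat"
    by (simp only: sum.lessThan_Suc_shift sum_distrib_left) (simp add: algebra_simps)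
  have eq: "a 0 + K * (\<Sum>l<N. K ^ l * a (Suc l)) = b 0 + K * (\<Sum>l<N. K ^ l * b (Suc l))"
    using Suc.prems(3) unfolding sh .
  have lt: "a 0 < K" "b 0 < K" using Suc.prems(1,2) by auto
  have "(a 0 + K * (\<Sum>l<N. K ^ l * a (Suc l))) mod K = (b 0 + K * (\<Sum>l<N. K ^ l * b (Suc l))) mod K"
    using eq by simp
  then have z: "a 0 = b 0" using lt by simp
  then have s: "(\<Sum>l<N. K ^ l * a (Suc l)) = (\<Sum>l<N. K ^ l * b (Suc l))"
    using eq lt by simp
  show ?case
  proof (cases l)
    case 0
    then show ?thesis using z by simp
  next
    case (Suc m)
    then show ?thesis using Suc.IH[of "\<lambda>l. a (Suc l)" "\<lambda>l. b (Suc l)" m, OF _ _ s] Suc.prems by auto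
  qed
qed simp

lemma Idx_le: "a \<in> Idx N k \<Longrightarrow> a l \<le> k"
proof (cases "l < N")
  case True
  assume "a \<in> Idx N k"
  then show ?thesis using member_le_sum[of l "{..<N}" a] True by (auto simp: Idx_def)
qed (auto simp: Idx_def)

text \<open>The identity is polynomial in x, hence extends to complex points, where the
  coordinates zeta take arbitrary values.\<close>
lemma mon_independent:
  assumes nN: "2 * n \<le> N"
    and zero: "\<And>x. x \<in> vecs N \<Longrightarrow> (\<Sum>a\<in>Idx N k. c a * mon n N a x) = 0"
    and a: "a \<in> Idx N k"
  shows "c a = 0"
proof -
  \<comment> \<open>Kronecker substitution: with s to the power \<open>Suc k ^ l\<close> in place of
    the l-th coordinate, the monomial with exponents b becomes s to the power \<open>e b\<close>.
    The exponents are at most k, so they are the digits of \<open>e b\<close> in base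
    \<open>Suc k\<close>.\<close>
  define e where "e b = (\<Sum>l<N. Suc k ^ l * b l)" for b :: "nat \<Rightarrow> nat"
  have pow: "(\<Sum>b\<in>Idx N k. c b * s ^ e b) = 0" for s :: complex
  proof -
    define u where "u l = s ^ (Suc k ^ l)" for l
    \<comment> \<open>The complex vector whose zeta coordinates are the \<open>u l\<close>; p and q
      are its real and imaginary parts.\<close>
    define y where "y l = (if l < 2 * n then if even l then (u l + u (l + 1)) / 2
        else (u (l - 1) - u l) / (2 * \<i>) else u l)" for l
    define p where "p l = (if l < N then Re (y l) else 0)" for l
    define q where "q l = (if l < N then Im (y l) else 0)" for l
    have pq: "of_real (p l) + \<i> * of_real (q l) = y l" if "l < N" for l
      using that by (simp add: p_def q_def complex_eq_iff)
    have zu: "zeta n l p + \<i> * zeta n l q = u l" if l: "l < N" for l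
    proof -
      have "zeta n l p + \<i> * zeta n l q = kA n l * (of_real (p l) + \<i> * of_real (q l))
          + kB n l * (of_real (p (par n l)) + \<i> * of_real (q (par n l)))"
        by (simp add: zeta_def algebra_simps)
      also have "\<dots> = kA n l * y l + kB n l * y (par n l)"
        using pq l par_lt[OF nN l] by simp
      also have "\<dots> = u l"
      proof (cases "l < 2 * n")
        case True
        have pl: "par n l < 2 * n" "even (par n l) \<longleftrightarrow> odd l" using True par_lt2 even_par by auto
        show ?thesis
        proof (cases "even l")
          case True
          then have "y l = (u l + u (l + 1)) / 2" "y (par n l) = (u l - u (l + 1)) / (2 * \<i>)"
            using \<open>l < 2 * n\<close> pl by (auto simp: y_def par_def)
          then have "kA n l * y l + kB n l * y (par n l) =
              (u l + u (l + 1)) / 2 + \<i> * ((u l - u (l + 1)) / (2 * \<i>))"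
            using True \<open>l < 2 * n\<close> by (simp only: kA_def kB_def) simp
          then show ?thesis by (simp add: field_simps)
        next
          case False
          then have "par n l + 1 = l" using \<open>l < 2 * n\<close> by (auto simp: par_def elim: oddE)
          then have pl1: "l - Suc 0 = par n l" by simp
          then have "y l = (u (l - 1) - u l) / (2 * \<i>)" "y (par n l) = (u (l - 1) + u l) / 2"
            using \<open>l < 2 * n\<close> pl False \<open>par n l + 1 = l\<close> by (auto simp: y_def pl1)
          then have "kA n l * y l + kB n l * y (par n l) =
              - \<i> * ((u (l - 1) - u l) / (2 * \<i>)) + (u (l - 1) + u l) / 2"
            using False \<open>l < 2 * n\<close> by (simp only: kA_def kB_def) simp
          then show ?thesis by (simp add: field_simps)
        qed
      qed (simp add: kA_def kB_def y_def)
      finally show ?thesis .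
    qed
    \<comment> \<open>The relation along the line through p in direction q. It vanishes for all real
      t, hence as a polynomial, hence at the imaginary unit.\<close>
    define H where "H = (\<Sum>b\<in>Idx N k. smult (c b) (\<Prod>l<N. [:zeta n l p, zeta n l q:] ^ b l))"
    have "poly H (of_real t) = 0" for t :: real
    proof -
      have "zeta n l (\<lambda>i. p i + t * q i) = zeta n l p + of_real t * zeta n l q" for l
        by (simp add: zeta_def algebra_simps)
      then have "poly H (of_real t) = (\<Sum>b\<in>Idx N k. c b * mon n N b (\<lambda>i. p i + t * q i))"
        by (simp add: H_def poly_sum poly_prod mon_def)
      also have "\<dots> = 0" by (rule zero) (auto simp: vecs_def p_def q_def)
      finally show ?thesis .
    qed
    then have "range complex_of_real \<subseteq> {z. poly H z = 0}" by auto
    moreover have "infinite (range complex_of_real)"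
      using finite_imageD[of complex_of_real UNIV] infinite_UNIV_char_0 by (auto simp: inj_on_def)
    ultimately have "H = 0" using poly_roots_finite finite_subset by blast
    then have "poly H \<i> = 0" by simp
    moreover have "poly H \<i> = (\<Sum>b\<in>Idx N k. c b * (\<Prod>l<N. u l ^ b l))"
      by (simp add: H_def poly_sum poly_prod zu)
    moreover have "(\<Prod>l<N. u l ^ b l) = s ^ e b" for b
      by (simp add: u_def e_def power_mult[symmetric] power_sum)
    ultimately show ?thesis by simp
  qed
  define G where "G = (\<Sum>b\<in>Idx N k. monom (c b) (e b))"
  have "poly G s = 0" for s using pow[of s] by (simp add: G_def poly_sum poly_monom)
  then have "G = 0" using poly_all_0_iff_0 by blast
  then have "coeff G (e a) = 0" by simp
  moreover have "coeff G (e a) = (\<Sum>b\<in>Idx N k. if b = a then c b else 0)"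
    unfolding G_def coeff_sum
  proof (rule sum.cong[OF refl])
    fix b assume b: "b \<in> Idx N k"
    have "b = a" if eq: "e b = e a"
    proof
      fix l
      show "b l = a l"
      proof (cases "l < N")
        case True
        show ?thesis
          by (rule digits_inject[of N b "Suc k" a, OF _ _ eq[unfolded e_def] True])
            (use a b Idx_le in \<open>auto simp: less_Suc_eq_le\<close>)
      qed (use a b in \<open>auto simp: Idx_def\<close>)
    qed
    then show "coeff (monom (c b) (e b)) (e a) = (if b = a then c b else 0)" by auto
  qed
  ultimately show ?thesis using a finite_Idx by simp
qed

lemma zeta_par: "zeta n (par n l) x = cnj (zeta n l x)"
proof (cases "l < 2 * n")
  case True
  then show ?thesis using par_lt2[of n l] even_par[of l n]
    by (cases "even l") (auto simp: zeta_def kA_def kB_def par_par)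
qed (simp add: zeta_def kA_def kB_def par_def)

lemma bij_par: "2 * n \<le> N \<Longrightarrow> bij_betw (par n) {..<N} {..<N}"
  by (rule bij_betw_byWitness[of _ "par n"]) (auto simp: par_par par_lt)

lemma mon_par: "2 * n \<le> N \<Longrightarrow> mon n N (\<lambda>l. a (par n l)) x = cnj (mon n N a x)"
proof -
  assume nN: "2 * n \<le> N"
  have "cnj (mon n N a x) = (\<Prod>l<N. zeta n (par n l) x ^ a l)"
    by (simp add: mon_def cnj_prod zeta_par)
  also have "\<dots> = (\<Prod>l<N. zeta n (par n (par n l)) x ^ a (par n l))"
    using prod.reindex_bij_betw[OF bij_par[OF nN], of "\<lambda>l. zeta n (par n l) x ^ a l"] by simp
  finally show ?thesis by (simp add: mon_def par_par)
qed

lemma Idx_par: "2 * n \<le> N \<Longrightarrow> a \<in> Idx N k \<Longrightarrow> (\<lambda>l. a (par n l)) \<in> Idx N k"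
proof -
  assume nN: "2 * n \<le> N" and a: "a \<in> Idx N k"
  have "(\<Sum>l<N. a (par n l)) = (\<Sum>l<N. a l)"
    using sum.reindex_bij_betw[OF bij_par[OF nN], of a] by simp
  moreover have "par n l = l" if "l \<ge> N" for l using that nN by (simp add: par_def)
  ultimately show ?thesis using a by (auto simp: Idx_def)
qed

lemma ee_independent:
  assumes nN: "2 * n \<le> N" and "N > 0"
    and zero: "\<And>x. x \<in> sphere_pts N \<Longrightarrow> (\<Sum>a\<in>Idx N k. c a * ee n N a x) = 0"
    and a: "a \<in> Idx N k"
  shows "c a = 0"
proof -
  let ?s = "\<lambda>a l. a (par n l) :: nat"
  have v0: "(\<Sum>a\<in>Idx N k. c a * ee n N a x) = 0" if x: "x \<in> vecs N" for x
  proof -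
    \<comment> \<open>Homogeneity carries the relation from the sphere to all of
      \<open>vecs N\<close>; at the origin any point of the sphere serves, with factor r =
      0.\<close>
    define y :: pt where "y = (if x \<in> punctured N then proj N x else (\<lambda>i. if i = 0 then 1 else 0))"
    define r where "r = sqrt (nsq N x)"
    have "(\<lambda>i::nat. if i = 0 then 1 else 0::real) \<in> sphere_pts N"
    proof -
      have "nsq N (\<lambda>i::nat. if i = 0 then 1 else 0::real) = (\<Sum>i<N. if i = 0 then 1 else 0)"
        unfolding nsq_def by (rule sum.cong) auto
      then show ?thesis using \<open>N > 0\<close> by (auto simp: sphere_pts_iff vecs_def)
    qed
    then have y: "y \<in> sphere_pts N" by (auto simp: y_def proj_sphere)
    have xy: "x = (\<lambda>i. r * y i)"
    proof (cases "x \<in> punctured N")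
      case True
      then show ?thesis using nsq_pos[OF True] by (auto simp: y_def r_def proj_def)
    next
      case False
      then have "nsq N x = 0" using x nsq_nonneg[of N x] by (auto simp: punctured_iff)
      then have "x = (\<lambda>_. 0)" "r = 0" using nsq_eq_0_iff[OF x] by (auto simp: r_def)
      then show ?thesis by simp
    qed
    have "(\<Sum>a\<in>Idx N k. c a * ee n N a x) = (\<Sum>a\<in>Idx N k. r ^ k * (c a * ee n N a y))"
      unfolding xy by (rule sum.cong[OF refl]) (simp add: ee_scale)
    also have "\<dots> = 0" using zero[OF y] by (simp add: sum_distrib_left[symmetric])
    finally show ?thesis .
  qed
  \<comment> \<open>\<open>cas z\<close> is \<open>(1 - i) / 2\<close> times z plus
    \<open>(1 + i) / 2\<close> times the conjugate of z, and conjugation permutes the monomials. So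
    a real relation between the \<open>ee\<close> is a complex relation between the
    \<open>mon\<close> with these coefficients.\<close>
  define d where "d a = (of_real (c a) * (1 - \<i>) + of_real (c (?s a)) * (1 + \<i>)) / 2" for a
  have "(\<Sum>a\<in>Idx N k. d a * mon n N a x) = 0" if x: "x \<in> vecs N" for x
  proof -
    have bij: "bij_betw ?s (Idx N k) (Idx N k)"
      by (rule bij_betw_byWitness[of _ ?s]) (auto simp: par_par Idx_par nN)
    have "(\<Sum>a\<in>Idx N k. of_real (c (?s a)) * mon n N a x) =
        (\<Sum>a\<in>Idx N k. of_real (c (?s (?s a))) * mon n N (?s a) x)"
      using sum.reindex_bij_betw[OF bij, of "\<lambda>a. of_real (c (?s a)) * mon n N a x"] by simp
    also have "\<dots> = (\<Sum>a\<in>Idx N k. of_real (c a) * cnj (mon n N a x))"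
      by (simp add: par_par mon_par nN)
    finally have sw: "(\<Sum>a\<in>Idx N k. of_real (c (?s a)) * mon n N a x) =
        (\<Sum>a\<in>Idx N k. of_real (c a) * cnj (mon n N a x))" .
    have "(\<Sum>a\<in>Idx N k. d a * mon n N a x) = (1 - \<i>) / 2 * (\<Sum>a\<in>Idx N k. of_real (c a) * mon n N a x)
        + (1 + \<i>) / 2 * (\<Sum>a\<in>Idx N k. of_real (c (?s a)) * mon n N a x)"
    proof -
      have "d a * z = (1 - \<i>) / 2 * (of_real (c a) * z) + (1 + \<i>) / 2 * (of_real (c (?s a)) * z)" for a z
        by (simp add: d_def field_simps)
      then show ?thesis by (simp only: sum.distrib sum_distrib_left)
    qed
    also have "\<dots> = (\<Sum>a\<in>Idx N k. of_real (c a) * ((1 - \<i>) / 2 * mon n N a x + (1 + \<i>) / 2 * cnj (mon n N a x)))"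
      unfolding sw by (simp add: sum_distrib_left sum.distrib[symmetric] algebra_simps)
    also have "\<dots> = (\<Sum>a\<in>Idx N k. of_real (c a * ee n N a x))"
    proof (rule sum.cong[OF refl])
      fix a
      have "(1 - \<i>) / 2 * z + (1 + \<i>) / 2 * cnj z = of_real (cas z)" for z
        by (simp add: complex_eq_iff cas_def field_simps)
      then show "of_real (c a) * ((1 - \<i>) / 2 * mon n N a x + (1 + \<i>) / 2 * cnj (mon n N a x)) =
          of_real (c a * ee n N a x)" by (simp add: ee_def)
    qed
    also have "\<dots> = of_real (\<Sum>a\<in>Idx N k. c a * ee n N a x)" by simp
    finally show ?thesis using v0[OF x] by simp
  qed
  from mon_independent[OF nN this a] have "d a = 0" .
  then have "Re (d a) = 0" "Im (d a) = 0" by simp_all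
  then show ?thesis by (simp add: d_def)
qed

section \<open>The real vector space of functions on points\<close>

interpretation fs: vector_space "\<lambda>(c::real) (f::pt \<Rightarrow> real). (\<lambda>x. c * f x)"
  by unfold_locales (auto simp: fun_eq_iff algebra_simps)

lemma fs_add: "f \<in> fs.span A \<Longrightarrow> g \<in> fs.span A \<Longrightarrow> (\<lambda>x. f x + g x) \<in> fs.span A"
  using fs.span_add[of f A g] by (simp add: plus_fun_def)

lemma fs_cmult: "f \<in> fs.span A \<Longrightarrow> (\<lambda>x. c * f x) \<in> fs.span A"
  by (rule fs.span_scale)

lemma fs_diff: "f \<in> fs.span A \<Longrightarrow> g \<in> fs.span A \<Longrightarrow> (\<lambda>x. f x - g x) \<in> fs.span A"
  using fs_add[of f A "\<lambda>x. (-1) * g x"] fs_cmult[of g A "-1"] by simp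

lemma fs_zero: "(\<lambda>x. 0) \<in> fs.span A"
  using fs.span_zero[of A] by (simp add: zero_fun_def)

lemma fs_sum: "(\<And>a. a \<in> I \<Longrightarrow> f a \<in> fs.span A) \<Longrightarrow> (\<lambda>x. \<Sum>a\<in>I. f a x) \<in> fs.span A"
  by (induction I rule: infinite_finite_induct) (auto intro: fs_zero fs_add)

lemma fs_induct [consumes 1, case_names zero step]:
  assumes "f \<in> fs.span A" "P (\<lambda>x. 0)"
    and "\<And>c a g. a \<in> A \<Longrightarrow> g \<in> fs.span A \<Longrightarrow> P g \<Longrightarrow> P (\<lambda>x. c * a x + g x)"
  shows "P f"
proof -
  have "f \<in> fs.span A \<and> P f"
    using assms(1)
  proof (induction rule: fs.span_induct_alt)
    case base
    then show ?case using assms(2) fs_zero by (simp add: zero_fun_def)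
  next
    case (step c a g)
    then show ?case using assms(3)[of a g c] fs_add[OF fs_cmult[OF fs.span_base]]
      by (simp add: plus_fun_def)
  qed
  then show ?thesis by simp
qed

section \<open>Spherical harmonics\<close>

text \<open>With values outside the sphere set to 0, equality in the vector space \<open>fs\<close>
  is equality on the sphere.\<close>

definition restr :: "nat \<Rightarrow> (pt \<Rightarrow> real) \<Rightarrow> pt \<Rightarrow> real" where
  "restr N f = (\<lambda>x. if x \<in> sphere_pts N then f x else 0)"

definition EE :: "nat \<Rightarrow> nat \<Rightarrow> (nat \<Rightarrow> nat) \<Rightarrow> pt \<Rightarrow> real" where
  "EE n N a = restr N (ee n N a)"

definition wt :: "nat \<Rightarrow> (nat \<Rightarrow> int) \<Rightarrow> (nat \<Rightarrow> nat) \<Rightarrow> int" where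
  "wt N w a = (\<Sum>l<N. w l * int (a l))"

text \<open>Exponents of the invariant monomials: by \<open>mon_lens_act\<close> the group element
  of index j multiplies a monomial by the root of unity with exponent
  \<open>- (j * wt N w a)\<close>.\<close>

definition II :: "nat \<Rightarrow> (nat \<Rightarrow> int) \<Rightarrow> nat \<Rightarrow> nat \<Rightarrow> (nat \<Rightarrow> nat) set" where
  "II N w q k = {a \<in> Idx N k. int q dvd wt N w a}"

definition VV :: "nat \<Rightarrow> nat \<Rightarrow> (nat \<Rightarrow> int) \<Rightarrow> nat \<Rightarrow> nat \<Rightarrow> (pt \<Rightarrow> real) set" where
  "VV n N w q k = fs.span (EE n N ` II N w q k)"

text \<open>The polynomials of two degrees less; the case distinction guards against the truncated
  difference \<open>k - 2\<close>.\<close>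

definition VVp :: "nat \<Rightarrow> nat \<Rightarrow> (nat \<Rightarrow> int) \<Rightarrow> nat \<Rightarrow> nat \<Rightarrow> (pt \<Rightarrow> real) set" where
  "VVp n N w q k = (if k < 2 then {\<lambda>x. 0} else VV n N w q (k - 2))"

definition lamk :: "nat \<Rightarrow> nat \<Rightarrow> real" where
  "lamk N k = real k * (real k + real N - 2)"

text \<open>By the formula of \<open>sph_laplacian_homogeneous\<close>, the eigenvalue equation
  singles out the harmonic polynomials.\<close>

definition HH :: "nat \<Rightarrow> nat \<Rightarrow> (nat \<Rightarrow> int) \<Rightarrow> nat \<Rightarrow> nat \<Rightarrow> (pt \<Rightarrow> real) set" where
  "HH n N w q k = {f \<in> VV n N w q k. \<forall>x\<in>sphere_pts N. sph_laplacian N f x = - lamk N k * f x}"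

lemma lamk_inject: "N \<ge> 2 \<Longrightarrow> lamk N j = lamk N k \<Longrightarrow> j = k"
proof -
  assume "N \<ge> 2"
  have "lamk N j < lamk N k" if "j < k" for j k
  proof -
    have "real j * (real j + real N - 2) \<le> real j * (real k + real N - 2)"
      using that by (intro mult_left_mono) auto
    also have "\<dots> < real k * (real k + real N - 2)"
      using that \<open>N \<ge> 2\<close> by (intro mult_strict_right_mono) auto
    finally show ?thesis by (simp add: lamk_def)
  qed
  then show "lamk N j = lamk N k \<Longrightarrow> j = k" by (metis linorder_neqE_nat less_irrefl)
qed

lemma pds_lin:
  assumes "smooth_punct N F" "smooth_punct N G" "set is \<subseteq> {..<N}" "x \<in> punctured N"
  shows "pds is (\<lambda>x. c * F x + G x) x = c * pds is F x + pds is G x"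
  using assms(3,4)
proof (induction "is" arbitrary: x)
  case (Cons i "is")
  have i: "i < N" and S: "set is \<subseteq> {..<N}" using Cons.prems by auto
  have "has_pd N i (\<lambda>x. c * pds is F x + pds is G x) (\<lambda>x. (0 * pds is F x + c * pds (i # is) F x) + pds (i # is) G x)"
    by (intro has_pd_add has_pd_mult has_pd_const smooth_punct_has_pd assms i S)
  from pds_step(1)[OF this i Cons.IH[OF S] Cons.prems(2)] show ?case by simp
qed simp

lemma smooth_lin:
  assumes "smooth_punct N F" "smooth_punct N G"
  shows "smooth_punct N (\<lambda>x. c * F x + G x)"
  unfolding smooth_punct_def
proof (intro allI impI conjI ballI)
  fix "is" :: "nat list" assume S: "set is \<subseteq> {..<N}"
  note eq = pds_lin[OF assms S, symmetric]
  show "continuous_on (punctured N) (pds is (\<lambda>x. c * F x + G x))"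
    by (rule continuous_on_eq[OF _ eq])
      (intro continuous_on_add continuous_on_mult continuous_on_const smooth_punct_cont assms S)
  fix i x assume i: "i < N" and x: "x \<in> punctured N"
  have "has_pd N i (\<lambda>x. c * pds is F x + pds is G x) (\<lambda>x. (0 * pds is F x + c * pds (i # is) F x) + pds (i # is) G x)"
    by (intro has_pd_add has_pd_mult has_pd_const smooth_punct_has_pd assms i S)
  from pds_step(2)[OF this i eq[symmetric] x]
  show "(\<lambda>t. pds is (\<lambda>x. c * F x + G x) (x(i := x i + t))) differentiable (at 0)"
    by (auto simp: real_differentiable_def)
qed

lemma ext0_lin: "ext0 N (\<lambda>x. c * f x + g x) = (\<lambda>x. c * ext0 N f x + ext0 N g x)"
  by (simp add: ext0_proj[abs_def])

definition smf :: "nat \<Rightarrow> (pt \<Rightarrow> real) \<Rightarrow> bool" where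
  "smf N f \<longleftrightarrow> smooth_punct N (ext0 N f)"

lemma smf_lin: "smf N f \<Longrightarrow> smf N g \<Longrightarrow> smf N (\<lambda>x. c * f x + g x)"
  unfolding smf_def ext0_lin by (rule smooth_lin)

lemma sph_laplacian_lin:
  assumes "smf N f" "smf N g" "x \<in> sphere_pts N"
  shows "sph_laplacian N (\<lambda>x. c * f x + g x) x = c * sph_laplacian N f x + sph_laplacian N g x"
  unfolding sph_laplacian_def ext0_lin sum_distrib_left sum.distrib[symmetric]
  using assms sphere_pts_punctured by (intro sum.cong refl pds_lin) (auto simp: smf_def)

lemma sph_laplacian_cong:
  assumes "\<And>x. x \<in> sphere_pts N \<Longrightarrow> f x = g x" "x \<in> sphere_pts N"
  shows "sph_laplacian N f x = sph_laplacian N g x"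
  unfolding sph_laplacian_def
  using assms sphere_pts_punctured by (intro sum.cong refl pds_cong ext0_cong) auto

lemma smf_cong:
  assumes "\<And>x. x \<in> sphere_pts N \<Longrightarrow> f x = g x" "smf N f"
  shows "smf N g"
  using smooth_punct_cong[OF ext0_cong[OF assms(1)]] assms(2) by (simp add: smf_def)

lemma smf_cont: "smf N f \<Longrightarrow> continuous_on (sphere_pts N) f"
  unfolding smf_def by (rule smooth_continuous_sphere)

lemma smf_zero: "smf N (\<lambda>x. 0)"
  using nice_smooth[OF nice.const[of 0 N]] by (simp add: smf_def ext0_proj[abs_def])

lemma smf_diff: "smf N f \<Longrightarrow> smf N g \<Longrightarrow> smf N (\<lambda>x. f x - g x)"
  using smf_lin[of N g f "-1"] by simp

lemma sph_laplacian_diff: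
  assumes "smf N f" "smf N g" "x \<in> sphere_pts N"
  shows "sph_laplacian N (\<lambda>x. f x - g x) x = sph_laplacian N f x - sph_laplacian N g x"
  using sph_laplacian_lin[OF assms(2,1,3), of "-1"] by simp

lemma ip_diff:
  assumes "continuous_on (sphere_pts N) f" "continuous_on (sphere_pts N) g" "continuous_on (sphere_pts N) h"
  shows "ip N (\<lambda>x. f x - g x) h = ip N f h - ip N g h"
  using ip_add[OF assms(1) continuous_on_mult_left[OF assms(2), of "-1"] assms(3)]
    ip_cmult[of N "-1" g h] by simp

lemma finite_II: "finite (II N w q k)"
  by (simp add: II_def finite_Idx)

lemma restr_id: "x \<in> sphere_pts N \<Longrightarrow> restr N f x = f x"
  by (simp add: restr_def)

lemma VV_props:
  assumes "2 * n \<le> N" "f \<in> VV n N w q k"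
  shows "smf N f" "restr N f = f"
proof -
  have "smf N f \<and> restr N f = f"
    using assms(2) unfolding VV_def
  proof (induction rule: fs_induct)
    case zero
    then show ?case using smf_zero by (simp add: restr_def fun_eq_iff)
  next
    case (step c a g)
    then obtain b where b: "b \<in> Idx N k" "a = EE n N b" by (auto simp: II_def)
    have "smf N a"
      using smf_cong[of N "ee n N b" a] ee_sph_laplacian(1)[OF assms(1) b(1)]
      by (simp add: b EE_def restr_id smf_def)
    then have "smf N (\<lambda>x. c * a x + g x)" using step by (intro smf_lin) auto
    moreover have "c * a x + g x = 0" if "x \<notin> sphere_pts N" for x
    proof -
      have "g x = restr N g x" using step by simp
      then show ?thesis using that by (simp add: b EE_def restr_def)
    qed
    ultimately show ?case by (auto simp: restr_def fun_eq_iff)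
  qed
  then show "smf N f" "restr N f = f" by auto
qed

section \<open>Invariant polynomials restricted to the sphere\<close>

definition dot :: "nat \<Rightarrow> pt \<Rightarrow> pt \<Rightarrow> real" where
  "dot N x y = (\<Sum>i<N. x i * y i)"

text \<open>The two conjugate coordinates of a plane have the same modulus, so each receives half
  the weight.\<close>

definition cf :: "nat \<Rightarrow> nat \<Rightarrow> real" where
  "cf n l = (if l < 2 * n then 1 / 2 else 1)"

lemma dot_zeta:
  assumes nN: "2 * n \<le> N"
  shows "(\<Sum>l<N. cf n l * Re (zeta n l x * cnj (zeta n l y))) = dot N x y"
proof -
  have cz: "cf n l * Re (zeta n l x * cnj (zeta n l y)) =
      cf n l * (x l * y l + (if l < 2 * n then x (par n l) * y (par n l) else 0))" for l
    by (cases "l < 2 * n"; cases "even l") (simp_all add: zeta_def kA_def kB_def algebra_simps)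
  have "(\<Sum>l<N. cf n l * (if l < 2 * n then x (par n l) * y (par n l) else 0)) =
      (\<Sum>l<N. cf n (par n l) * (if par n l < 2 * n then x (par n (par n l)) * y (par n (par n l)) else 0))"
    using sum.reindex_bij_betw[OF bij_par[OF nN], of "\<lambda>l. cf n l * (if l < 2 * n then x (par n l) * y (par n l) else 0)"]
    by simp
  also have "\<dots> = (\<Sum>l<N. if l < 2 * n then x l * y l / 2 else 0)"
    by (rule sum.cong) (auto simp: cf_def par_lt2 par_par)
  finally have "(\<Sum>l<N. cf n l * Re (zeta n l x * cnj (zeta n l y))) =
      (\<Sum>l<N. cf n l * (x l * y l) + (if l < 2 * n then x l * y l / 2 else 0))"
    unfolding cz distrib_left sum.distrib by simp
  also have "\<dots> = dot N x y" unfolding dot_def by (rule sum.cong) (auto simp: cf_def)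
  finally show ?thesis .
qed

text \<open>Conjugate coordinates carry opposite weights; from \<open>2 * n\<close> on
  \<open>par\<close> fixes the index, which forces weight 0 there.\<close>

locale weights =
  fixes n N :: nat and w :: "nat \<Rightarrow> int" and q :: nat
  assumes nN: "2 * n \<le> N" and N2: "N \<ge> 2"
    and w_par: "\<And>l. l < N \<Longrightarrow> w (par n l) = - w l"
begin

abbreviation "V \<equiv> VV n N w q"
abbreviation "Vp \<equiv> VVp n N w q"
abbreviation "H \<equiv> HH n N w q"

lemma wt_upd: "l < N \<Longrightarrow> wt N w (a(l := v)) = wt N w a + w l * (int v - int (a l))"
  by (simp add: wt_def sum.remove[of _ l] algebra_simps)

lemma Kr_w: "l < N \<Longrightarrow> m < N \<Longrightarrow> Kr n l m \<noteq> 0 \<Longrightarrow> w l + w m = 0"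
  using w_par[of l] by (auto simp: Kr_def par_def split: if_splits)

lemma Vp_span: "\<exists>A. Vp k = fs.span A"
  unfolding VVp_def VV_def
  by (cases "k < 2") (auto intro: exI[of _ "{}"] simp: zero_fun_def)

lemma Vp_zero: "(\<lambda>x. 0) \<in> Vp k"
  using Vp_span[of k] fs_zero by auto

lemma Vp_lin: "f \<in> Vp k \<Longrightarrow> g \<in> Vp k \<Longrightarrow> (\<lambda>x. c * f x + g x) \<in> Vp k"
proof -
  obtain A where "Vp k = fs.span A" using Vp_span by blast
  then show "f \<in> Vp k \<Longrightarrow> g \<in> Vp k \<Longrightarrow> (\<lambda>x. c * f x + g x) \<in> Vp k"
    by (simp add: fs_add fs_cmult)
qed

lemma Vp_sum: "(\<And>a. a \<in> I \<Longrightarrow> f a \<in> Vp k) \<Longrightarrow> (\<lambda>x. \<Sum>a\<in>I. f a x) \<in> Vp k"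
proof -
  obtain A where "Vp k = fs.span A" using Vp_span by blast
  then show "(\<And>a. a \<in> I \<Longrightarrow> f a \<in> Vp k) \<Longrightarrow> (\<lambda>x. \<Sum>a\<in>I. f a x) \<in> Vp k"
    by (simp add: fs_sum)
qed

lemma V_lin: "f \<in> V k \<Longrightarrow> g \<in> V k \<Longrightarrow> (\<lambda>x. c * f x + g x) \<in> V k"
  unfolding VV_def by (intro fs_add fs_cmult)

lemma V_diff: "f \<in> V k \<Longrightarrow> g \<in> V k \<Longrightarrow> (\<lambda>x. f x - g x) \<in> V k"
  unfolding VV_def by (rule fs_diff)

text \<open>A nonzero \<open>Kr\<close> removes a coordinate together with its conjugate, of total
  weight 0, so invariance persists. In degrees below 2 the coefficient vanishes.\<close>

lemma laplacian_term:
  assumes "a \<in> II N w q k" "l < N" "m < N"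
  shows "(\<lambda>x. Kr n l m * real (a l) * real (down a l m) * EE n N (down (down a l) m) x) \<in> Vp k"
proof (cases "Kr n l m * real (a l) * real (down a l m) = 0")
  case True
  show ?thesis unfolding True using Vp_zero by simp
next
  case False
  then have nz: "Kr n l m \<noteq> 0" "a l \<noteq> 0" "down a l m \<noteq> 0" by auto
  have a: "a \<in> Idx N k" "int q dvd wt N w a" using assms(1) by (auto simp: II_def)
  have "k \<noteq> 0" using Idx_le[OF a(1), of l] nz by auto
  then obtain k1 where k1: "k = Suc k1" by (cases k) auto
  have d1: "down a l \<in> Idx N k1" using down_Idx a(1) assms(2) nz k1 by auto
  have "k1 \<noteq> 0" using Idx_le[OF d1, of m] nz by auto
  then obtain k2 where k2: "k1 = Suc k2" by (cases k1) auto
  have d2: "down (down a l) m \<in> Idx N k2" using down_Idx d1 assms(3) nz k2 by auto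
  have "wt N w (down (down a l) m) = wt N w a - w l - w m"
    unfolding down_def[of "down a l"] wt_upd[OF assms(3)] unfolding down_def[of a l] wt_upd[OF assms(2)]
    using nz by (simp add: down_def of_nat_diff)
  also have "\<dots> = wt N w a" using Kr_w[OF assms(2,3) nz(1)] by simp
  finally have "down (down a l) m \<in> II N w q k2" using d2 a(2) by (simp add: II_def)
  then have "EE n N (down (down a l) m) \<in> V k2" unfolding VV_def by (intro fs.span_base) auto
  then show ?thesis using k1 k2 fs_cmult by (auto simp: VVp_def VV_def)
qed

text \<open>Triangularity of the Laplacian with respect to the degree: a scalar on the diagonal and
  a remainder two degrees lower.\<close>

lemma laplacian_V:
  assumes "f \<in> V k"
  shows "\<exists>g\<in>Vp k. \<forall>x\<in>sphere_pts N. sph_laplacian N f x = g x - lamk N k * f x"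
  using assms unfolding VV_def
proof (induction rule: fs_induct)
  case zero
  have "sph_laplacian N (\<lambda>x. 0) x = 0" if "x \<in> sphere_pts N" for x
    using sph_laplacian_lin[OF smf_zero smf_zero that, of 1] by simp
  then show ?case using Vp_zero by (intro bexI[of _ "\<lambda>x. 0"]) auto
next
  case (step c b g)
  then obtain a where a: "a \<in> II N w q k" "b = EE n N a" by auto
  have aI: "a \<in> Idx N k" using a by (simp add: II_def)
  obtain h where h: "h \<in> Vp k" "\<And>x. x \<in> sphere_pts N \<Longrightarrow> sph_laplacian N g x = h x - lamk N k * g x"
    using step by auto
  define h' where "h' x = (\<Sum>l<N. \<Sum>m<N. Kr n l m * real (a l) * real (down a l m) * EE n N (down (down a l) m) x)" for x
  have h': "h' \<in> Vp k" unfolding h'_def[abs_def] using a(1) by (intro Vp_sum laplacian_term) auto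
  have lapb: "sph_laplacian N b x = h' x - lamk N k * b x" if x: "x \<in> sphere_pts N" for x
  proof -
    have "sph_laplacian N b x = sph_laplacian N (ee n N a) x"
      by (rule sph_laplacian_cong[OF _ x]) (simp add: a EE_def restr_id)
    also have "\<dots> = h' x - lamk N k * ee n N a x"
      unfolding ee_sph_laplacian(2)[OF nN aI x] h'_def by (simp add: EE_def restr_id x lamk_def)
    finally show ?thesis using x by (simp add: a EE_def restr_id)
  qed
  have "b \<in> V k" "g \<in> V k" using a step(2) fs.span_base by (auto simp: VV_def)
  then have sm: "smf N b" "smf N g" using VV_props(1)[OF nN] by auto
  show ?case
  proof (rule bexI[of _ "\<lambda>x. c * h' x + h x"])
    show "(\<lambda>x. c * h' x + h x) \<in> Vp k" by (rule Vp_lin[OF h' h(1)])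
    show "\<forall>x\<in>sphere_pts N. sph_laplacian N (\<lambda>x. c * b x + g x) x =
        (c * h' x + h x) - lamk N k * (c * b x + g x)"
    proof
      fix x assume x: "x \<in> sphere_pts N"
      show "sph_laplacian N (\<lambda>x. c * b x + g x) x = (c * h' x + h x) - lamk N k * (c * b x + g x)"
        unfolding sph_laplacian_lin[OF sm x] lapb[OF x] h(2)[OF x] by (simp add: algebra_simps)
    qed
  qed
qed

text \<open>On the sphere the squared norm is 1, so multiplication by it embeds degree k - 2
  into degree k.\<close>
lemma Vp_subset_V: "Vp k \<subseteq> V k"
proof (cases "k < 2")
  case True
  then show ?thesis using fs_zero by (auto simp: VVp_def VV_def)
next
  case False
  then have "k = Suc (Suc (k - 2))" by simp
  then obtain j where j: "k = Suc (Suc j)" by blast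
  have "EE n N a \<in> V k" if a: "a \<in> II N w q j" for a
  proof -
    have aI: "a \<in> Idx N j" using a by (simp add: II_def)
    \<comment> \<open>Multiplication by the squared modulus of the l-th coordinate: one more factor
      of it and one of its conjugate, which for a real coordinate is the same factor twice. The
      weight is unchanged.\<close>
    define up where "up l = (let b = a(l := Suc (a l)) in b(par n l := Suc (b (par n l))))" for l
    have upI: "up l \<in> II N w q k" if l: "l < N" for l
    proof -
      have p: "par n l < N" using par_lt[OF nN l] .
      have "up l \<in> Idx N k"
        using aI l p sum_fun_upd[OF l, of a "Suc (a l)"]
          sum_fun_upd[OF p, of "a(l := Suc (a l))" "Suc ((a(l := Suc (a l))) (par n l))"] j
        by (auto simp: Idx_def up_def Let_def simp del: fun_upd_apply) (auto)
      moreover have "wt N w (up l) = wt N w a + w l + w (par n l)"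
        unfolding up_def Let_def wt_upd[OF p] wt_upd[OF l] by simp
      ultimately show ?thesis using a w_par[OF l] by (simp add: II_def)
    qed
    have mon_up: "mon n N (up l) x = of_real ((cmod (zeta n l x))\<^sup>2) * mon n N a x" if l: "l < N" for l x
    proof -
      have p: "par n l < N" using par_lt[OF nN l] .
      have s: "mon n N (b(m := Suc (b m))) x = zeta n m x * mon n N b x" if "m < N" for b m
        using that by (simp add: mon_split[of m])
      have "mon n N (up l) x = zeta n (par n l) x * (zeta n l x * mon n N a x)"
        unfolding up_def Let_def s[OF p] s[OF l] ..
      then show ?thesis by (simp only: zeta_par complex_norm_square mult_ac)
    qed
    have nsq: "(\<Sum>l<N. cf n l * (cmod (zeta n l x))\<^sup>2) = nsq N x" for x
      using dot_zeta[OF nN, of x x] by (simp add: dot_def nsq_def power2_eq_square[symmetric] cmod_power2)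
    have "EE n N a = (\<lambda>x. \<Sum>l<N. cf n l * EE n N (up l) x)"
    proof
      fix x
      show "EE n N a x = (\<Sum>l<N. cf n l * EE n N (up l) x)"
      proof (cases "x \<in> sphere_pts N")
        case True
        have "(\<Sum>l<N. cf n l * EE n N (up l) x) = (\<Sum>l<N. cf n l * (cmod (zeta n l x))\<^sup>2) * ee n N a x"
          unfolding sum_distrib_right
          by (rule sum.cong) (auto simp: EE_def restr_id True ee_def mon_up cas_scale simp flip: of_real_power)
        then show ?thesis using True by (simp add: nsq sphere_pts_iff EE_def restr_id)
      qed (simp add: EE_def restr_def)
    qed
    moreover have "(\<lambda>x. \<Sum>l<N. cf n l * EE n N (up l) x) \<in> V k"
      unfolding VV_def by (intro fs_sum fs_cmult fs.span_base imageI upI) simp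
    ultimately show ?thesis by simp
  qed
  then have "fs.span (EE n N ` II N w q j) \<subseteq> V k"
    unfolding VV_def by (intro fs.span_minimal fs.subspace_span) auto
  then show ?thesis using j by (simp add: VVp_def VV_def)
qed

end

section \<open>Orthogonal projections and independent families\<close>

lemma projection_exists:
  assumes "finite B" "\<And>b. b \<in> B \<Longrightarrow> continuous_on (sphere_pts N) b" "continuous_on (sphere_pts N) f"
  shows "\<exists>h\<in>fs.span B. continuous_on (sphere_pts N) h \<and> (\<forall>b\<in>B. ip N (\<lambda>x. f x - h x) b = 0)"
  using assms
proof (induction B arbitrary: f rule: finite_induct)
  case empty
  then show ?case using fs_zero by (intro bexI[of _ "\<lambda>x. 0"]) (auto intro: continuous_on_const)
next
  case (insert b B)
  have sub: "fs.span B \<subseteq> fs.span (insert b B)" by (rule fs.span_mono) auto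
  have cb: "continuous_on (sphere_pts N) b" using insert.prems by auto
  obtain g where g: "g \<in> fs.span B" "continuous_on (sphere_pts N) g"
      "\<And>d. d \<in> B \<Longrightarrow> ip N (\<lambda>x. b x - g x) d = 0"
    using insert.IH[OF insert.prems(1) cb] by auto
  obtain h where h: "h \<in> fs.span B" "continuous_on (sphere_pts N) h"
      "\<And>d. d \<in> B \<Longrightarrow> ip N (\<lambda>x. f x - h x) d = 0"
    using insert.IH[OF insert.prems] by auto
  \<comment> \<open>Gram-Schmidt: the part of b orthogonal to B.\<close>
  define b' where "b' x = b x - g x" for x
  have cb': "continuous_on (sphere_pts N) b'" unfolding b'_def using cb g by (intro continuous_on_diff)
  define s where "s = ip N (\<lambda>x. f x - h x) b' / ip N b' b'"
  define h' where "h' x = s * b' x + h x" for x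
  have ch': "continuous_on (sphere_pts N) h'"
    unfolding h'_def by (intro continuous_on_add continuous_on_mult continuous_on_const cb' h)
  have cfh: "continuous_on (sphere_pts N) (\<lambda>x. f x - h x)" using insert.prems h by (intro continuous_on_diff)
  have exp: "ip N (\<lambda>x. f x - h' x) d = ip N (\<lambda>x. f x - h x) d - s * ip N b' d"
    if "continuous_on (sphere_pts N) d" for d
  proof -
    have "(\<lambda>x. f x - h' x) = (\<lambda>x. (f x - h x) - s * b' x)" by (auto simp: h'_def)
    then show ?thesis using ip_diff[OF cfh continuous_on_mult_left[OF cb', of s] that] ip_cmult by simp
  qed
  have z1: "ip N (\<lambda>x. f x - h' x) d = 0" if "d \<in> B" for d
    using exp[of d] h(3)[OF that] g(3)[OF that] insert.prems that by (simp add: b'_def[abs_def])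
  have z2: "ip N (\<lambda>x. f x - h' x) b' = 0"
  proof (cases "ip N b' b' = 0")
    case True
    have "b' x = 0" if "x \<in> sphere_pts N" for x using ip_eq_0_imp[OF cb' True that] .
    then have "ip N (\<lambda>x. f x - h' x) b' = ip N (\<lambda>x. f x - h' x) (\<lambda>x. 0)" by (intro ip_cong) auto
    also have "\<dots> = ip N (\<lambda>x. 0 * f x) (\<lambda>x. f x - h' x)" by (simp add: ip_commute)
    finally show ?thesis using ip_cmult[of N 0 f] by simp
  next
    case False
    then show ?thesis using exp[OF cb'] by (simp add: s_def)
  qed
  have spang: "ip N (\<lambda>x. f x - h' x) d = 0 \<and> continuous_on (sphere_pts N) d" if "d \<in> fs.span B" for d
    using that
  proof (induction rule: fs_induct)
    case zero
    have "ip N (\<lambda>x. f x - h' x) (\<lambda>x. 0) = ip N (\<lambda>x. 0 * f x) (\<lambda>x. f x - h' x)" by (simp add: ip_commute)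
    then show ?case using ip_cmult[of N 0 f] by (simp add: continuous_on_const)
  next
    case (step c a g)
    have ca: "continuous_on (sphere_pts N) a" using insert.prems(1) step(1) by auto
    have "ip N (\<lambda>x. f x - h' x) (\<lambda>x. c * a x + g x) = c * ip N a (\<lambda>x. f x - h' x) + ip N g (\<lambda>x. f x - h' x)"
      using ip_add[OF continuous_on_mult_left[OF ca, of c] conjunct2[OF step(3)]
          continuous_on_diff[OF insert.prems(2) ch']]
      unfolding ip_cmult ip_commute[of N "\<lambda>x. f x - h' x"] .
    moreover have "ip N a (\<lambda>x. f x - h' x) = 0" "ip N g (\<lambda>x. f x - h' x) = 0"
      using z1[OF step(1)] step(3) by (simp_all add: ip_commute[of N a] ip_commute[of N g])
    moreover have "continuous_on (sphere_pts N) (\<lambda>x. c * a x + g x)"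
      using step(3) by (intro continuous_on_add continuous_on_mult continuous_on_const ca) simp
    ultimately show ?case by simp
  qed
  have "ip N (\<lambda>x. f x - h' x) b = 0"
  proof -
    have "ip N b (\<lambda>x. f x - h' x) = ip N (\<lambda>x. b' x + g x) (\<lambda>x. f x - h' x)"
      by (rule ip_cong) (auto simp: b'_def)
    also have "\<dots> = ip N b' (\<lambda>x. f x - h' x) + ip N g (\<lambda>x. f x - h' x)"
      by (rule ip_add[OF cb' g(2)]) (intro continuous_on_diff insert.prems ch')
    finally show ?thesis using z2 spang[OF g(1)] by (simp add: ip_commute)
  qed
  moreover have "h' \<in> fs.span (insert b B)"
    unfolding h'_def b'_def using g(1) h(1) sub fs.span_base[of b "insert b B"]
    by (intro fs_add fs_cmult fs_diff) auto
  ultimately show ?case using z1 ch' by (intro bexI[of _ h']) auto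
qed

lemma fs_sum_apply: "(\<Sum>v\<in>S. f v) x = (\<Sum>v\<in>S. f v x)" for f :: "'a \<Rightarrow> pt \<Rightarrow> real"
  by (induction S rule: infinite_finite_induct) auto

lemma fs_dependent_iff:
  assumes "finite I" "inj_on h I"
  shows "fs.dependent (h ` I) \<longleftrightarrow> (\<exists>c. (\<exists>i\<in>I. c i \<noteq> 0) \<and> (\<forall>x. (\<Sum>i\<in>I. c i * h i x) = 0))"
    (is "_ \<longleftrightarrow> ?R")
proof -
  have re: "(\<Sum>v\<in>h ` I. (\<lambda>x. u v * v x)) = 0 \<longleftrightarrow> (\<forall>x. (\<Sum>i\<in>I. u (h i) * h i x) = 0)" for u
    by (auto simp: fun_eq_iff fs_sum_apply sum.reindex[OF assms(2)])
  show ?thesis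
    unfolding fs.dependent_finite[OF finite_imageI[OF assms(1)]] re
  proof
    let ?P = "\<lambda>u. (\<exists>v\<in>h ` I. u v \<noteq> 0) \<and> (\<forall>x. (\<Sum>i\<in>I. u (h i) * h i x) = 0)"
    assume ex: "\<exists>u. ?P u"
    define u where "u = (SOME u. ?P u)"
    have "?P u" unfolding u_def by (rule someI_ex[OF ex])
    then show ?R by (intro exI[of _ "\<lambda>i. u (h i)"]) auto
  next
    let ?P = "\<lambda>c. (\<exists>i\<in>I. c i \<noteq> 0) \<and> (\<forall>x. (\<Sum>i\<in>I. c i * h i x) = 0)"
    assume ex: ?R
    define c where "c = (SOME c. ?P c)"
    have c: "?P c" unfolding c_def by (rule someI_ex[OF ex])
    define u where "u v = c (the_inv_into I h v)" for v
    have "u (h i) = c i" if "i \<in> I" for i using that assms(2) by (simp add: u_def the_inv_into_f_f)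
    then have "(\<exists>v\<in>h ` I. u v \<noteq> 0) \<and> (\<forall>x. (\<Sum>i\<in>I. u (h i) * h i x) = 0)"
      using c by auto
    then show "\<exists>u. (\<exists>v\<in>h ` I. u v \<noteq> 0) \<and> (\<forall>x. (\<Sum>i\<in>I. u (h i) * h i x) = 0)" by (rule exI[of _ u])
  qed
qed

text \<open>Bases are sets of functions while relations come as indexed sums. Distinct indices give
  distinct functions, since a repetition would be the relation with coefficients 1 and -1.\<close>

lemma fs_independent_family:
  assumes "finite I"
    and z: "\<And>c i. (\<And>x. (\<Sum>i\<in>I. c i * h i x) = 0) \<Longrightarrow> i \<in> I \<Longrightarrow> c i = 0"
  shows "fs.independent (h ` I)" "inj_on h I"
proof -
  show inj: "inj_on h I"
  proof (rule inj_onI, rule ccontr)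
    fix a b assume ab: "a \<in> I" "b \<in> I" "h a = h b" "a \<noteq> b"
    define c where "c d = (if d = a then 1 else if d = b then -1 else 0 :: real)" for d
    have "(\<Sum>d\<in>I. c d * h d x) = 0" for x
    proof -
      have "(\<Sum>d\<in>I. c d * h d x) = (\<Sum>d\<in>{a, b}. c d * h d x)"
        by (rule sum.mono_neutral_right) (use ab assms(1) in \<open>auto simp: c_def\<close>)
      then show ?thesis using ab(3,4) by (simp add: c_def)
    qed
    from z[OF this ab(1)] show False by (simp add: c_def)
  qed
  show "fs.independent (h ` I)"
  proof
    assume "fs.dependent (h ` I)"
    then have ex: "\<exists>c. (\<exists>i\<in>I. c i \<noteq> 0) \<and> (\<forall>x. (\<Sum>i\<in>I. c i * h i x) = 0)"
      by (simp only: fs_dependent_iff[OF assms(1) inj])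
    define c where "c = (SOME c. (\<exists>i\<in>I. c i \<noteq> 0) \<and> (\<forall>x. (\<Sum>i\<in>I. c i * h i x) = 0))"
    have c: "(\<exists>i\<in>I. c i \<noteq> 0) \<and> (\<forall>x. (\<Sum>i\<in>I. c i * h i x) = 0)"
      unfolding c_def by (rule someI_ex[OF ex])
    then show False using z[of c] by blast
  qed
qed

lemma ip_zero_right: "ip N f (\<lambda>x. 0) = 0"
  using ip_cmult[of N 0 f f] ip_commute[of N f "\<lambda>x. 0"] by simp

lemma ip_lin_right:
  assumes "continuous_on (sphere_pts N) f" "continuous_on (sphere_pts N) g" "continuous_on (sphere_pts N) h"
  shows "ip N h (\<lambda>x. c * f x + g x) = c * ip N h f + ip N h g"
  using ip_add[OF continuous_on_mult_left[OF assms(1), of c] assms(2,3)]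
  unfolding ip_cmult ip_commute[of N h] .

lemma ip_span:
  assumes "continuous_on (sphere_pts N) f" "\<And>b. b \<in> B \<Longrightarrow> continuous_on (sphere_pts N) b"
    and "\<And>b. b \<in> B \<Longrightarrow> ip N f b = 0" "d \<in> fs.span B"
  shows "ip N f d = 0" "continuous_on (sphere_pts N) d"
proof -
  have "ip N f d = 0 \<and> continuous_on (sphere_pts N) d"
    using assms(4)
  proof (induction rule: fs_induct)
    case zero
    then show ?case by (simp add: ip_zero_right continuous_on_const)
  next
    case (step c a g)
    have "continuous_on (sphere_pts N) (\<lambda>x. c * a x + g x)"
      using step assms(2) by (intro continuous_on_add continuous_on_mult continuous_on_const) auto
    then show ?case using ip_lin_right[of N a g f c] step assms by simp
  qed
  then show "ip N f d = 0" "continuous_on (sphere_pts N) d" by auto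
qed

lemma eigen_orthogonal:
  assumes "smf N f" "smf N g"
    and "\<And>x. x \<in> sphere_pts N \<Longrightarrow> sph_laplacian N f x = - a * f x"
    and "\<And>x. x \<in> sphere_pts N \<Longrightarrow> sph_laplacian N g x = - b * g x" "a \<noteq> b"
  shows "ip N f g = 0"
proof -
  have "ip N (sph_laplacian N f) g = ip N (\<lambda>x. - a * f x) g" by (rule ip_cong) (simp_all add: assms)
  moreover have "ip N f (sph_laplacian N g) = ip N f (\<lambda>x. - b * g x)" by (rule ip_cong) (simp_all add: assms)
  ultimately have "- a * ip N f g = - b * ip N g f"
    using laplacian_selfadjoint[of N f g] assms(1,2)
    unfolding ip_cmult[symmetric] ip_commute[of N "\<lambda>x. - b * g x" f] smf_def by simp
  then show ?thesis using assms(5) ip_commute[of N f g] by simp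
qed

section \<open>Harmonic decomposition and its dimension count\<close>

context weights
begin

lemma V_smf: "f \<in> V k \<Longrightarrow> smf N f"
  using VV_props(1)[OF nN] .

lemma V_cont: "f \<in> V k \<Longrightarrow> continuous_on (sphere_pts N) f"
  using V_smf smf_cont by blast

lemma Vp_V: "f \<in> Vp k \<Longrightarrow> f \<in> V k"
  using Vp_subset_V by blast

lemma V_zero_eq: "f \<in> V k \<Longrightarrow> (\<And>x. x \<in> sphere_pts N \<Longrightarrow> f x = 0) \<Longrightarrow> f = (\<lambda>x. 0)"
proof
  fix x assume "f \<in> V k" "\<And>x. x \<in> sphere_pts N \<Longrightarrow> f x = 0"
  then show "f x = 0" using fun_cong[OF VV_props(2)[OF nN, of f w q k], of x] by (simp add: restr_def split: if_splits)
qed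

lemma Vp_finite_span: "\<exists>B. finite B \<and> B \<subseteq> Vp k \<and> Vp k = fs.span B"
proof (cases "k < 2")
  case True
  then have "Vp k = fs.span {}" unfolding fs.span_empty by (simp add: VVp_def zero_fun_def)
  then show ?thesis using finite.emptyI empty_subsetI by metis
next
  case False
  let ?B = "EE n N ` II N w q (k - 2)"
  have "Vp k = fs.span ?B" using False by (simp add: VVp_def VV_def)
  moreover have "?B \<subseteq> fs.span ?B" by (rule fs.span_superset)
  moreover have "finite ?B" by (rule finite_imageI[OF finite_II])
  ultimately show ?thesis by metis
qed

lemma Vp_projection:
  assumes "continuous_on (sphere_pts N) f"
  shows "\<exists>h\<in>Vp k. \<forall>d\<in>Vp k. ip N (\<lambda>x. f x - h x) d = 0"
proof -
  obtain B where B: "finite B" "B \<subseteq> Vp k" "Vp k = fs.span B" using Vp_finite_span by blast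
  have cB: "continuous_on (sphere_pts N) b" if "b \<in> B" for b using B(2) that Vp_V V_cont by blast
  obtain h where h: "h \<in> fs.span B" "continuous_on (sphere_pts N) h" "\<And>b. b \<in> B \<Longrightarrow> ip N (\<lambda>x. f x - h x) b = 0"
    using projection_exists[OF B(1) cB assms] by blast
  have "ip N (\<lambda>x. f x - h x) d = 0" if "d \<in> fs.span B" for d
    by (rule ip_span(1)[OF continuous_on_diff[OF assms h(2)] cB h(3) that])
  then show ?thesis using h(1) B(3) by blast
qed

text \<open>Let g be the part of the Laplacian of f that has lower degree. The Laplacian of g stays
  in \<open>Vp k\<close>, so self-adjointness and orthogonality kill both terms of <g, g> = <lap f,
  g> + lamk <f, g>.\<close>

lemma Vp_orth_laplacian:
  assumes f: "f \<in> V k" and orth: "\<And>d. d \<in> Vp k \<Longrightarrow> ip N f d = 0"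
  shows "f \<in> H k"
proof -
  obtain g where g: "g \<in> Vp k" "\<And>x. x \<in> sphere_pts N \<Longrightarrow> sph_laplacian N f x = g x - lamk N k * f x"
    using laplacian_V[OF f] by auto
  have gV: "g \<in> V k" using g Vp_V by blast
  have cg: "continuous_on (sphere_pts N) g" and cf: "continuous_on (sphere_pts N) f"
    using V_cont gV f by auto
  have lapg: "\<exists>d\<in>Vp k. \<forall>x\<in>sphere_pts N. sph_laplacian N g x = d x"
  proof (cases "k < 2")
    case True
    then have "g = (\<lambda>x. 0)" using g by (simp add: VVp_def)
    then have "sph_laplacian N g x = 0" if "x \<in> sphere_pts N" for x
      using sph_laplacian_lin[OF smf_zero smf_zero that, of 1] by simp
    then show ?thesis using Vp_zero by (intro bexI[of _ "\<lambda>x. 0"]) auto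
  next
    case False
    then have gk: "g \<in> V (k - 2)" using g by (simp add: VVp_def)
    obtain d where d: "d \<in> Vp (k - 2)" "\<And>x. x \<in> sphere_pts N \<Longrightarrow> sph_laplacian N g x = d x - lamk N (k - 2) * g x"
      using laplacian_V[OF gk] by auto
    have "(\<lambda>x. (- lamk N (k - 2)) * g x + d x) \<in> V (k - 2)" by (rule V_lin[OF gk Vp_V[OF d(1)]])
    then show ?thesis using False
      by (intro bexI[of _ "\<lambda>x. (- lamk N (k - 2)) * g x + d x"]) (simp_all add: d(2) VVp_def)
  qed
  have "ip N (sph_laplacian N f) g = ip N f (sph_laplacian N g)"
    using laplacian_selfadjoint[of N f g] V_smf[OF f] V_smf[OF gV] unfolding smf_def by blast
  also obtain d where d: "d \<in> Vp k" "\<And>x. x \<in> sphere_pts N \<Longrightarrow> sph_laplacian N g x = d x" using lapg by auto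
  have "ip N f (sph_laplacian N g) = ip N f d" by (rule ip_cong) (simp_all add: d)
  also have "\<dots> = 0" by (rule orth[OF d(1)])
  finally have z: "ip N (sph_laplacian N f) g = 0" .
  have "ip N g g = ip N (\<lambda>x. lamk N k * f x + sph_laplacian N f x) g"
    by (rule ip_cong) (simp_all add: g)
  also have "\<dots> = ip N (\<lambda>x. lamk N k * f x + (g x - lamk N k * f x)) g"
    by (rule ip_cong) (simp_all add: g)
  also have "\<dots> = ip N (\<lambda>x. lamk N k * f x) g + ip N (\<lambda>x. g x - lamk N k * f x) g"
    by (rule ip_add) (intro continuous_on_diff continuous_on_mult continuous_on_const cf cg)+
  also have "ip N (\<lambda>x. g x - lamk N k * f x) g = ip N (sph_laplacian N f) g"
    by (rule ip_cong) (simp_all add: g)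
  also have "ip N (\<lambda>x. lamk N k * f x) g = 0" by (simp add: ip_cmult orth[OF g(1)])
  finally have "ip N g g = 0" using z by simp
  then have "g x = 0" if "x \<in> sphere_pts N" for x using ip_eq_0_imp[OF cg _ that] by simp
  then show ?thesis using f g(2) by (simp add: HH_def)
qed

lemma V_decompose:
  assumes "f \<in> V k"
  shows "\<exists>h\<in>Vp k. (\<lambda>x. f x - h x) \<in> H k"
proof -
  obtain h where h: "h \<in> Vp k" "\<And>d. d \<in> Vp k \<Longrightarrow> ip N (\<lambda>x. f x - h x) d = 0"
    using Vp_projection[OF V_cont[OF assms]] by blast
  have "(\<lambda>x. f x - h x) \<in> V k" using assms Vp_V[OF h(1)] by (rule V_diff)
  from Vp_orth_laplacian[OF this h(2)] h(1) show ?thesis by blast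
qed

text \<open>Splitting off the harmonic part lowers the degree by two, so an induction reaches all of
  \<open>V k\<close>.\<close>

lemma orth_V:
  assumes "continuous_on (sphere_pts N) f" "\<And>j h. j \<le> k \<Longrightarrow> h \<in> H j \<Longrightarrow> ip N f h = 0" "g \<in> V k"
  shows "ip N f g = 0"
  using assms(2,3)
proof (induction k arbitrary: g rule: less_induct)
  case (less k)
  obtain h where h: "h \<in> Vp k" "(\<lambda>x. g x - h x) \<in> H k" using V_decompose[OF less.prems(2)] by blast
  have "ip N f h = 0"
  proof (cases "k < 2")
    case True
    then show ?thesis using h(1) by (simp add: VVp_def ip_zero_right)
  next
    case False
    then have "h \<in> V (k - 2)" using h(1) by (simp add: VVp_def)
    moreover have "ip N f d = 0" if "j \<le> k - 2" "d \<in> H j" for j d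
      by (rule less.prems(1)[of j d]) (use that in auto)
    ultimately show ?thesis using False less.IH[of "k - 2" h] by simp
  qed
  moreover have "ip N f (\<lambda>x. g x - h x) = 0" by (rule less.prems(1)[OF order_refl h(2)])
  moreover have "ip N f (\<lambda>x. 1 * (g x - h x) + h x) = 1 * ip N f (\<lambda>x. g x - h x) + ip N f h"
    by (intro ip_lin_right continuous_on_diff V_cont[OF less.prems(2)] V_cont[OF Vp_V[OF h(1)]] assms(1))
  ultimately show ?case by simp
qed

lemma H_eigen: "f \<in> H k \<Longrightarrow> x \<in> sphere_pts N \<Longrightarrow> sph_laplacian N f x = - lamk N k * f x"
  by (simp add: HH_def)

lemma H_V: "f \<in> H k \<Longrightarrow> f \<in> V k"
  by (simp add: HH_def)

text \<open>For k at least 2, f is orthogonal to all harmonics of degree at most k - 2, as the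
  eigenvalues differ, and hence to \<open>V (k - 2)\<close>, where f itself lies.\<close>

lemma H_Vp_disjoint:
  assumes "f \<in> H k" "f \<in> Vp k"
  shows "f = (\<lambda>x. 0)"
proof (cases "k < 2")
  case True
  then show ?thesis using assms by (simp add: VVp_def)
next
  case False
  have cf: "continuous_on (sphere_pts N) f" using assms H_V V_cont by blast
  have "ip N f h = 0" if "j \<le> k - 2" "h \<in> H j" for j h
  proof (rule eigen_orthogonal)
    show "smf N f" "smf N h" using assms that H_V V_smf by blast+
    show "lamk N k \<noteq> lamk N j" using lamk_inject[OF N2, of k j] that False by auto
  qed (use H_eigen assms that in auto)
  moreover have "f \<in> V (k - 2)" using assms False by (simp add: VVp_def)
  ultimately have "ip N f f = 0" using orth_V[OF cf] by blast
  then show ?thesis using ip_eq_0_imp[OF cf] V_zero_eq[OF H_V[OF assms(1)]] by blast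
qed

lemma EE_independent: "fs.independent (EE n N ` II N w q k)" "inj_on (EE n N) (II N w q k)"
proof -
  have z: "c a = 0" if "(\<And>x. (\<Sum>a\<in>II N w q k. c a * EE n N a x) = 0)" "a \<in> II N w q k" for c a
  proof -
    define d where "d b = (if b \<in> II N w q k then c b else 0)" for b
    have "(\<Sum>b\<in>Idx N k. d b * ee n N b x) = 0" if x: "x \<in> sphere_pts N" for x
    proof -
      have "(\<Sum>b\<in>Idx N k. d b * ee n N b x) = (\<Sum>b\<in>II N w q k. d b * ee n N b x)"
        by (rule sum.mono_neutral_right) (auto simp: d_def II_def finite_Idx)
      also have "\<dots> = (\<Sum>b\<in>II N w q k. c b * EE n N b x)"
        by (rule sum.cong) (auto simp: d_def EE_def restr_id x)
      finally show ?thesis using \<open>\<And>x. (\<Sum>a\<in>II N w q k. c a * EE n N a x) = 0\<close> by simp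
    qed
    moreover have "N > 0" "a \<in> Idx N k" using N2 that(2) by (auto simp: II_def)
    ultimately have "d a = 0" using ee_independent[OF nN, where k=k and c=d and a=a] by blast
    then show ?thesis using that(2) by (simp add: d_def)
  qed
  show "fs.independent (EE n N ` II N w q k)" "inj_on (EE n N) (II N w q k)"
    using fs_independent_family[OF finite_II, of "EE n N" N w q k] z by blast+
qed

lemma H_subspace: "fs.subspace (H k)"
proof (rule fs.subspaceI)
  show "0 \<in> H k"
  proof -
    have "(\<lambda>x. 0) \<in> V k" using fs_zero by (simp add: VV_def)
    moreover have "sph_laplacian N (\<lambda>x. 0) x = 0" if "x \<in> sphere_pts N" for x
      using sph_laplacian_lin[OF smf_zero smf_zero that, of 1] by simp
    ultimately show ?thesis by (simp add: HH_def zero_fun_def)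
  qed
  fix f g assume f: "f \<in> H k" and g: "g \<in> H k"
  have s: "smf N f" "smf N g" using f g H_V V_smf by blast+
  have "(\<lambda>x. 1 * f x + g x) \<in> V k" by (rule V_lin[OF H_V[OF f] H_V[OF g]])
  moreover have "sph_laplacian N (\<lambda>x. 1 * f x + g x) x = - lamk N k * (1 * f x + g x)" if "x \<in> sphere_pts N" for x
    unfolding sph_laplacian_lin[OF s that] H_eigen[OF f that] H_eigen[OF g that] by (simp add: algebra_simps)
  ultimately show "f + g \<in> H k" by (simp add: HH_def plus_fun_def)
next
  fix c f assume f: "f \<in> H k"
  have s: "smf N f" using f H_V V_smf by blast
  have "(\<lambda>x. c * f x + 0) \<in> V k" by (rule V_lin[OF H_V[OF f]]) (simp add: VV_def fs_zero)
  moreover have "sph_laplacian N (\<lambda>x. c * f x + 0) x = - lamk N k * (c * f x + 0)" if "x \<in> sphere_pts N" for x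
  proof -
    have "sph_laplacian N (\<lambda>x. 0) x = 0"
      using sph_laplacian_lin[OF smf_zero smf_zero that, of 1] by simp
    then show ?thesis unfolding sph_laplacian_lin[OF s smf_zero that] H_eigen[OF f that] by (simp add: algebra_simps)
  qed
  ultimately show "(\<lambda>x. c * f x) \<in> H k" by (simp add: HH_def)
qed

text \<open>\<open>V k\<close> is the direct sum of \<open>H k\<close> and \<open>Vp k\<close>, and
  the dimensions of \<open>V k\<close> and \<open>Vp k\<close> count invariant monomials because
  these are independent on the sphere. The cardinalities add up, so the subtraction does not
  truncate.\<close>

lemma H_dim:
  "\<exists>B. finite B \<and> fs.independent B \<and> fs.span B = H k \<and>
     card B = card (II N w q k) - (if k < 2 then 0 else card (II N w q (k - 2)))"
proof -
  let ?I = "EE n N ` II N w q k"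
  obtain B where B: "B \<subseteq> H k" "fs.independent B" "H k \<subseteq> fs.span B"
    by (rule fs.basis_exists[of "H k"])
  have spB: "fs.span B = H k"
    using B(1,3) fs.span_minimal[OF B(1) H_subspace] by blast
  have "B \<subseteq> fs.span ?I" using B(1) H_V by (auto simp: VV_def)
  then have finB: "finite B" using fs.independent_span_bound[of ?I B] B(2) finite_II by auto
  define C where "C = (if k < 2 then {} else EE n N ` II N w q (k - 2))"
  have C: "finite C" "fs.independent C" "fs.span C = Vp k"
    "card C = (if k < 2 then 0 else card (II N w q (k - 2)))"
  proof -
    show "finite C" by (simp add: C_def finite_II)
    show "fs.independent C" using EE_independent(1) fs.independent_empty by (simp add: C_def)
    show "fs.span C = Vp k" by (simp add: C_def VVp_def VV_def) (simp add: zero_fun_def)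
    show "card C = (if k < 2 then 0 else card (II N w q (k - 2)))"
      using card_image[OF EE_independent(2)] by (simp add: C_def)
  qed
  have disj: "B \<inter> C = {}"
  proof (rule ccontr)
    assume "B \<inter> C \<noteq> {}"
    then obtain v where v: "v \<in> B" "v \<in> C" by blast
    then have "v \<in> H k" "v \<in> Vp k" using spB C(3) fs.span_base by blast+
    then have "v = 0" using H_Vp_disjoint by (simp add: zero_fun_def)
    then show False using v(1) B(2) fs.dependent_zero by blast
  qed
  have key: "\<forall>v\<in>B \<union> C. u v = 0" if u: "(\<Sum>v\<in>B \<union> C. (\<lambda>x. u v * v x)) = 0" for u
  proof -
    define b where "b = (\<Sum>v\<in>B. (\<lambda>x. u v * v x))"
    define c where "c = (\<Sum>v\<in>C. (\<lambda>x. u v * v x))"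
    have bc: "b + c = 0" using u disj finB C(1) unfolding b_def c_def by (simp add: sum.union_disjoint)
    have bH: "b \<in> H k" unfolding b_def spB[symmetric] by (intro fs.span_sum fs.span_scale fs.span_base)
    have cV: "c \<in> Vp k" unfolding c_def C(3)[symmetric] by (intro fs.span_sum fs.span_scale fs.span_base)
    have "b = - c" using bc by (simp add: add_eq_0_iff2)
    moreover have "- c \<in> Vp k" using cV unfolding C(3)[symmetric] by (rule fs.span_neg)
    ultimately have b0: "b = 0" using H_Vp_disjoint[OF bH] by (simp add: zero_fun_def)
    then have c0: "c = 0" using bc by simp
    have "u v = 0" if "v \<in> B" for v
      using fs.independentD[of B B u v, OF B(2) finB subset_refl] b0 that unfolding b_def by simp
    moreover have "u v = 0" if "v \<in> C" for v
      using fs.independentD[of C C u v, OF C(2) C(1) subset_refl] c0 that unfolding c_def by simp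
    ultimately show ?thesis by blast
  qed
  have "fs.independent (B \<union> C)"
    unfolding fs.dependent_finite[OF finite_UnI[OF finB C(1)]]
  proof
    let ?P = "\<lambda>u. (\<exists>v\<in>B \<union> C. u v \<noteq> 0) \<and> (\<Sum>v\<in>B \<union> C. (\<lambda>x. u v * v x)) = 0"
    assume ex: "\<exists>u. ?P u"
    define u where "u = (SOME u. ?P u)"
    have "?P u" unfolding u_def by (rule someI_ex[OF ex])
    then show False using key[of u] by blast
  qed
  then have dBC: "fs.dim (B \<union> C) = card (B \<union> C)" by (rule fs.dim_eq_card_independent)
  have sp: "fs.span (B \<union> C) = fs.span ?I"
  proof
    have "B \<union> C \<subseteq> fs.span ?I"
    proof
      fix v assume "v \<in> B \<union> C"
      then have "v \<in> H k \<or> v \<in> Vp k" using B(1) fs.span_base[of v C] C(3) by blast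
      then have "v \<in> V k" using H_V Vp_V by blast
      then show "v \<in> fs.span ?I" by (simp add: VV_def)
    qed
    then show "fs.span (B \<union> C) \<subseteq> fs.span ?I" by (rule fs.span_minimal[OF _ fs.subspace_span])
    show "fs.span ?I \<subseteq> fs.span (B \<union> C)"
    proof
      fix f assume "f \<in> fs.span ?I"
      then have "f \<in> V k" by (simp add: VV_def)
      then obtain h where h: "h \<in> Vp k" "(\<lambda>x. f x - h x) \<in> H k" using V_decompose by blast
      have "h \<in> fs.span (B \<union> C)" using h(1) C(3) fs.span_mono[of C "B \<union> C"] by auto
      moreover have "(\<lambda>x. f x - h x) \<in> fs.span (B \<union> C)" using h(2) spB fs.span_mono[of B "B \<union> C"] by auto
      ultimately have "(\<lambda>x. (f x - h x) + h x) \<in> fs.span (B \<union> C)" by (rule fs_add[rotated])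
      then show "f \<in> fs.span (B \<union> C)" by simp
    qed
  qed
  have "card (B \<union> C) = fs.dim (fs.span (B \<union> C))" by (simp only: fs.dim_span dBC)
  also have "\<dots> = card ?I" unfolding sp fs.dim_span by (rule fs.dim_eq_card_independent[OF EE_independent(1)])
  finally have "card (B \<union> C) = card ?I" .
  then have "card B + card C = card (II N w q k)"
    using disj finB C(1) card_image[OF EE_independent(2)] by (simp add: card_Un_disjoint)
  then have "card B = card (II N w q k) - card C" by simp
  then show ?thesis using finB B(2) spB unfolding C(4) by (intro exI[of _ B] conjI)
qed

end

section \<open>Density of polynomials and completeness of the harmonics\<close>

definition PF :: "nat \<Rightarrow> nat \<Rightarrow> (pt \<Rightarrow> real) set" where
  "PF n N = fs.span (EE n N ` {a. \<forall>i\<ge>N. a i = 0})"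

lemma mon_add: "mon n N (\<lambda>l. a l + b l) x = mon n N a x * mon n N b x"
  by (simp add: mon_def power_add prod.distrib)

text \<open>The product is the real part of \<open>z * cnj w\<close> plus the imaginary part of
  \<open>z * w\<close>. Both are written through \<open>cas\<close> so that products of spanning
  functions of \<open>PF\<close> stay in the span.\<close>

lemma cas_mult:
  "cas z * cas w = 1 / 2 * (cas (z * cnj w) + cas (cnj z * w) + cas (z * w) - cas (cnj z * cnj w))"
  by (simp add: cas_def field_simps)

lemma PF_mult_base:
  assumes nN: "2 * n \<le> N" and a: "\<forall>i\<ge>N. a i = 0" and b: "\<forall>i\<ge>N. b i = 0"
  shows "(\<lambda>x. EE n N a x * EE n N b x) \<in> PF n N"
proof -
  let ?s = "\<lambda>a l. a (par n l) :: nat"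
  have s: "\<forall>i\<ge>N. ?s a i = 0" if "\<forall>i\<ge>N. a i = 0" for a
    using that nN by (auto simp: par_def)
  have ev: "EE n N c \<in> PF n N" if "\<forall>i\<ge>N. c i = 0" for c
    unfolding PF_def using that by (intro fs.span_base imageI) simp
  have "(\<lambda>x. EE n N a x * EE n N b x) = (\<lambda>x. 1 / 2 * (((EE n N (\<lambda>l. a l + ?s b l) x
      + EE n N (\<lambda>l. ?s a l + b l) x) + EE n N (\<lambda>l. a l + b l) x) - EE n N (\<lambda>l. ?s a l + ?s b l) x))"
    by (rule ext) (simp add: EE_def restr_def ee_def cas_mult mon_add mon_par[OF nN])
  also have "\<dots> \<in> PF n N"
    unfolding PF_def by (intro fs_cmult fs_diff fs_add ev[unfolded PF_def]) (use a b s[OF a] s[OF b] in auto)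
  finally show ?thesis .
qed

lemma PF_mult:
  assumes nN: "2 * n \<le> N" and "f \<in> PF n N" "g \<in> PF n N"
  shows "(\<lambda>x. f x * g x) \<in> PF n N"
  using assms(2) unfolding PF_def
proof (induction rule: fs_induct)
  case zero
  then show ?case using fs_zero by simp
next
  case (step c a h)
  have "(\<lambda>x. a x * g x) \<in> fs.span (EE n N ` {a. \<forall>i\<ge>N. a i = 0})"
    using assms(3) unfolding PF_def
  proof (induction rule: fs_induct)
    case zero
    then show ?case using fs_zero by simp
  next
    case (step d b k)
    obtain a' b' where ab: "a = EE n N a'" "\<forall>i\<ge>N. a' i = 0" "b = EE n N b'" "\<forall>i\<ge>N. b' i = 0"
      using step(1) \<open>a \<in> EE n N ` _\<close> by blast
    have "(\<lambda>x. a x * b x) \<in> fs.span (EE n N ` {a. \<forall>i\<ge>N. a i = 0})"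
      using PF_mult_base[OF nN ab(2,4)] by (simp add: ab PF_def)
    from fs_add[OF fs_cmult[OF this, of d] step(3)] show ?case by (simp add: algebra_simps)
  qed
  from fs_add[OF fs_cmult[OF this, of c] step(3)] show ?case by (simp add: algebra_simps)
qed

text \<open>\<open>cas\<close> of a coordinate and of its conjugate determine the coordinate, and
  the coordinates determine all inner products.\<close>

lemma PF_separates:
  assumes nN: "2 * n \<le> N" and x: "x \<in> sphere_pts N" and y: "y \<in> sphere_pts N" and "x \<noteq> y"
  shows "\<exists>f\<in>PF n N. f x \<noteq> f y"
proof (rule ccontr)
  assume c: "\<not> (\<exists>f\<in>PF n N. f x \<noteq> f y)"
  have eq: "cas (zeta n l x) = cas (zeta n l y)" if l: "l < N" for l
  proof -
    define a :: "nat \<Rightarrow> nat" where "a i = (if i = l then 1 else 0)" for i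
    have "EE n N a \<in> PF n N"
      unfolding PF_def by (intro fs.span_base imageI) (use l in \<open>auto simp: a_def\<close>)
    then have e: "EE n N a x = EE n N a y" using c by blast
    have "mon n N a z = zeta n l z" for z
      unfolding mon_split[OF l] by (simp add: a_def)
    then show ?thesis using e x y by (simp add: EE_def restr_def ee_def)
  qed
  have "zeta n l x = zeta n l y" if l: "l < N" for l
    using eq[OF l] eq[OF par_lt[OF nN l]] by (simp add: zeta_par cas_def complex_eq_iff)
  then have "dot N x z = dot N y z" for z
    unfolding dot_zeta[OF nN, symmetric] by simp
  then have "dot N x x = dot N y x" "dot N x y = dot N y y" by blast+
  moreover have "nsq N (\<lambda>i. x i - y i) = dot N x x - dot N x y - (dot N y x - dot N y y)"
    by (simp add: dot_def nsq_def power2_eq_square algebra_simps flip: sum_subtractf)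
  ultimately have "nsq N (\<lambda>i. x i - y i) = 0" by simp
  moreover have "(\<lambda>i. x i - y i) \<in> vecs N" using x y by (auto simp: sphere_pts_iff vecs_def)
  ultimately have "(\<lambda>i. x i - y i) = (\<lambda>_. 0)" using nsq_eq_0_iff by blast
  then have "x = y" by (auto simp: fun_eq_iff)
  then show False using \<open>x \<noteq> y\<close> by simp
qed

lemma PF_dense:
  assumes nN: "2 * n \<le> N" and f: "continuous_on (sphere_pts N) f" and "e > 0"
  shows "\<exists>g\<in>PF n N. continuous_on (sphere_pts N) g \<and> (\<forall>x\<in>sphere_pts N. \<bar>f x - g x\<bar> < e)"
proof -
  have cont: "continuous_on (sphere_pts N) g" if "g \<in> PF n N" for g
    using that unfolding PF_def
  proof (induction rule: fs_induct)
    case (step c b g)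
    then obtain a where a: "b = EE n N a" "\<forall>i\<ge>N. a i = 0" by blast
    then have "a \<in> Idx N (\<Sum>i<N. a i)" by (simp add: Idx_def)
    then have "continuous_on (sphere_pts N) (ee n N a)"
      using smf_cont ee_sph_laplacian(1)[OF nN] by (simp add: smf_def)
    then have "continuous_on (sphere_pts N) b" by (rule continuous_on_eq) (simp add: a EE_def restr_id)
    then show ?case using step(3) by (intro continuous_on_add continuous_on_mult continuous_on_const)
  qed (rule continuous_on_const)
  have EE0: "EE n N (\<lambda>_. 0) \<in> PF n N" unfolding PF_def by (intro fs.span_base imageI) simp
  define P where "P g \<longleftrightarrow> (\<exists>h\<in>PF n N. \<forall>x\<in>sphere_pts N. g x = h x)" for g
  have "\<exists>g. P g \<and> (\<forall>x\<in>sphere_pts N. \<bar>f x - g x\<bar> < e)"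
  proof (rule Stone_Weierstrass_HOL[OF compact_sphere _ _ _ _ _ f \<open>e > 0\<close>])
    show "P (\<lambda>x. c)" for c
    proof -
      have "(\<lambda>x. c * EE n N (\<lambda>_. 0) x) \<in> PF n N" using EE0 fs_cmult by (simp add: PF_def)
      then show ?thesis unfolding P_def
        by (rule rev_bexI) (simp add: EE_def restr_id ee_def mon_def cas_def)
    qed
    show "continuous_on (sphere_pts N) g" if "P g" for g
    proof -
      obtain h where h: "h \<in> PF n N" "\<And>x. x \<in> sphere_pts N \<Longrightarrow> g x = h x" using \<open>P g\<close> by (auto simp: P_def)
      show ?thesis by (rule continuous_on_eq[OF cont[OF h(1)]]) (simp add: h)
    qed
    show "P (\<lambda>x. g x + h x)" if gh: "P g \<and> P h" for g h
    proof -
      obtain g' h' where g': "g' \<in> PF n N" "\<forall>x\<in>sphere_pts N. g x = g' x"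
        and h': "h' \<in> PF n N" "\<forall>x\<in>sphere_pts N. h x = h' x" using gh unfolding P_def by blast
      have "(\<lambda>x. g' x + h' x) \<in> PF n N" using g'(1) h'(1) unfolding PF_def by (rule fs_add)
      then show ?thesis unfolding P_def by (rule rev_bexI) (use g'(2) h'(2) in simp)
    qed
    show "P (\<lambda>x. g x * h x)" if gh: "P g \<and> P h" for g h
    proof -
      obtain g' h' where g': "g' \<in> PF n N" "\<forall>x\<in>sphere_pts N. g x = g' x"
        and h': "h' \<in> PF n N" "\<forall>x\<in>sphere_pts N. h x = h' x" using gh unfolding P_def by blast
      show ?thesis unfolding P_def
        by (rule rev_bexI[OF PF_mult[OF nN g'(1) h'(1)]]) (use g'(2) h'(2) in simp)
    qed
    show "\<exists>g. P g \<and> g x \<noteq> g y" if "x \<in> sphere_pts N \<and> y \<in> sphere_pts N \<and> x \<noteq> y" for x y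
    proof -
      obtain g where "g \<in> PF n N" "g x \<noteq> g y" using PF_separates[OF nN, of x y] \<open>_ \<and> _ \<and> x \<noteq> y\<close> by blast
      then show ?thesis unfolding P_def by blast
    qed
  qed
  then obtain g where g: "P g" "\<And>x. x \<in> sphere_pts N \<Longrightarrow> \<bar>f x - g x\<bar> < e" by blast
  obtain h where h: "h \<in> PF n N" "\<And>x. x \<in> sphere_pts N \<Longrightarrow> g x = h x" using g(1) unfolding P_def by blast
  show ?thesis
    by (rule bexI[OF _ h(1)]) (use g(2) h(2) cont[OF h(1)] in auto)
qed

text \<open>Weight 0 and modulus 1 impose no condition on the exponents, so these are all spherical
  harmonics of degree k.\<close>

abbreviation Hfull :: "nat \<Rightarrow> nat \<Rightarrow> nat \<Rightarrow> (pt \<Rightarrow> real) set" where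
  "Hfull n N k \<equiv> HH n N (\<lambda>_. 0) 1 k"

text \<open>Orthogonality to harmonics extends to all polynomials by \<open>orth_V\<close>.
  Replacing f by f minus a uniform approximation in one argument then bounds \<open>ip N f f\<close>
  by an arbitrarily small multiple of a constant.\<close>

lemma orth_all_zero:
  assumes nN: "2 * n \<le> N" and N2: "N \<ge> 2" and f: "continuous_on (sphere_pts N) f"
    and orth: "\<And>k h. h \<in> Hfull n N k \<Longrightarrow> ip N f h = 0" and x: "x \<in> sphere_pts N"
  shows "f x = 0"
proof -
  interpret weights n N "\<lambda>_. 0" 1 by unfold_locales (use nN N2 in auto)
  have oV: "ip N f g = 0" if "g \<in> V k" for g k
    by (rule orth_V[OF f _ that]) (rule orth)
  have oP: "ip N f g = 0" if "g \<in> PF n N" for g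
  proof (rule ip_span(1)[OF f _ _ that[unfolded PF_def]])
    fix b assume "b \<in> EE n N ` {a. \<forall>i\<ge>N. a i = 0}"
    then obtain a where a: "b = EE n N a" "\<forall>i\<ge>N. a i = 0" by blast
    have "b \<in> V (\<Sum>i<N. a i)"
      unfolding VV_def a(1) by (intro fs.span_base imageI) (use a(2) in \<open>auto simp: II_def Idx_def\<close>)
    then show "continuous_on (sphere_pts N) b" "ip N f b = 0" using V_cont oV by blast+
  qed
  define C where "C = ip N (\<lambda>x. \<bar>f x\<bar>) (\<lambda>x. 1)"
  have le: "ip N f f \<le> e * C" if "e > 0" for e
  proof -
    obtain g where g: "g \<in> PF n N" "continuous_on (sphere_pts N) g"
        "\<And>x. x \<in> sphere_pts N \<Longrightarrow> \<bar>f x - g x\<bar> < e"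
      using PF_dense[OF nN f \<open>e > 0\<close>] by blast
    have "ip N f (\<lambda>x. 1 * (f x - g x) + g x) = 1 * ip N f (\<lambda>x. f x - g x) + ip N f g"
      by (rule ip_lin_right) (intro continuous_on_diff f g(2))+
    then have "ip N f f = ip N f (\<lambda>x. f x - g x)" using oP[OF g(1)] by simp
    also have "\<dots> \<le> e * C" unfolding C_def
      by (rule ip_sup_bound[OF f continuous_on_diff[OF f g(2)]]) (use g(3) in \<open>auto intro: less_imp_le\<close>)
    finally show ?thesis .
  qed
  have "ip N f f \<le> 0"
  proof (rule field_le_epsilon)
    fix e :: real assume "e > 0"
    have "ip N f f \<le> e / (1 + \<bar>C\<bar>) * C" by (rule le) (use \<open>e > 0\<close> in \<open>simp add: add_pos_nonneg\<close>)
    also have "\<dots> \<le> e / (1 + \<bar>C\<bar>) * (1 + \<bar>C\<bar>)" using \<open>e > 0\<close> by (intro mult_left_mono) auto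
    also have "\<dots> = e" by (simp add: add_nonneg_eq_0_iff)
    finally show "ip N f f \<le> 0 + e" by simp
  qed
  moreover have "ip N f f \<ge> 0"
    unfolding ip_def vint_def by (rule Bochner_Integration.integral_nonneg) (simp add: psi_nonneg)
  ultimately show ?thesis using ip_eq_0_imp[OF f _ x] by simp
qed

text \<open>Subtracting from f its projection to the harmonics with the same eigenvalue leaves an
  eigenfunction orthogonal to the harmonics of every degree, hence 0. If no \<open>lamk\<close>
  equals lam, f itself is such a function.\<close>

lemma eigenfunction_harmonic:
  assumes nN: "2 * n \<le> N" and N2: "N \<ge> 2" and f: "smf N f"
    and eig: "\<And>x. x \<in> sphere_pts N \<Longrightarrow> sph_laplacian N f x = - lam * f x"
  shows "(\<exists>k. lam = lamk N k \<and> (\<exists>h\<in>Hfull n N k. \<forall>x\<in>sphere_pts N. f x = h x)) \<or>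
    (\<forall>x\<in>sphere_pts N. f x = 0)"
proof -
  interpret weights n N "\<lambda>_. 0" 1 by unfold_locales (use nN N2 in auto)
  have cf: "continuous_on (sphere_pts N) f" using f by (rule smf_cont)
  have ort: "ip N g h = 0" if "smf N g" "\<And>x. x \<in> sphere_pts N \<Longrightarrow> sph_laplacian N g x = - lam * g x"
    "h \<in> H j" "lam \<noteq> lamk N j" for g h j
    by (rule eigen_orthogonal[OF that(1) V_smf[OF H_V[OF that(3)]] that(2) H_eigen[OF that(3)] that(4)])
  show ?thesis
  proof (cases "\<exists>k. lam = lamk N k")
    case False
    then have "f x = 0" if "x \<in> sphere_pts N" for x
      using orth_all_zero[OF nN N2 cf _ that] ort[OF f eig] by blast
    then show ?thesis by blast
  next
    case True
    then obtain k where k: "lam = lamk N k" by blast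
    obtain B where B: "finite B" "fs.span B = H k" using H_dim by blast
    have BH: "b \<in> H k" if "b \<in> B" for b using B(2) fs.span_base[OF that] by simp
    have cB: "continuous_on (sphere_pts N) b" if "b \<in> B" for b using BH[OF that] H_V V_cont by blast
    obtain h where h: "h \<in> fs.span B" "continuous_on (sphere_pts N) h"
        "\<And>b. b \<in> B \<Longrightarrow> ip N (\<lambda>x. f x - h x) b = 0"
      using projection_exists[OF B(1) cB cf] by blast
    have hH: "h \<in> H k" using h(1) B(2) by simp
    have smh: "smf N h" by (rule V_smf[OF H_V[OF hH]])
    have cg: "continuous_on (sphere_pts N) (\<lambda>x. f x - h x)" by (rule continuous_on_diff[OF cf h(2)])
    have eg: "sph_laplacian N (\<lambda>x. f x - h x) x = - lam * (f x - h x)" if "x \<in> sphere_pts N" for x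
      unfolding sph_laplacian_diff[OF f smh that] eig[OF that] H_eigen[OF hH that] k by (simp add: algebra_simps)
    have "ip N (\<lambda>x. f x - h x) d = 0" if "d \<in> H j" for d j
    proof (cases "j = k")
      case True
      have d: "d \<in> fs.span B" using that B(2) True by simp
      show ?thesis by (rule ip_span(1)[OF cg cB h(3) d])
    next
      case False
      then have ne: "lam \<noteq> lamk N j" using k lamk_inject[OF N2] by metis
      show ?thesis by (rule ort[OF smf_diff[OF f smh] eg that ne])
    qed
    then have "f x - h x = 0" if "x \<in> sphere_pts N" for x
      using orth_all_zero[OF nN N2 cg _ that] by blast
    then have "\<forall>x\<in>sphere_pts N. f x = h x" by simp
    then show ?thesis using k hH by blast
  qed
qed

section \<open>Spectra of lens spaces\<close>

definition gam :: "nat \<Rightarrow> int \<Rightarrow> complex" where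
  "gam q m = cis (2 * pi * of_int m / real q)"

lemma gam_add: "gam q (a + b) = gam q a * gam q b"
  by (simp add: gam_def cis_mult algebra_simps add_divide_distrib)

lemma gam_0 [simp]: "gam q 0 = 1"
  by (simp add: gam_def)

lemma gam_nonzero [simp]: "gam q a \<noteq> 0"
  by (simp add: gam_def)

lemma gam_minus: "gam q (- a) = cnj (gam q a)"
  by (simp add: gam_def cis_cnj)

lemma gam_power: "gam q a ^ k = gam q (int k * a)"
  by (induction k) (simp_all add: gam_add algebra_simps)

lemma gam_eq_1_iff:
  assumes "q > 0"
  shows "gam q m = 1 \<longleftrightarrow> int q dvd m"
proof
  assume "gam q m = 1"
  then have "cos (2 * pi * of_int m / real q) = 1" by (simp add: gam_def complex_eq_iff)
  then obtain n :: int where "2 * pi * of_int m / real q = of_int n * 2 * pi"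
    unfolding cos_one_2pi_int by blast
  then have "real_of_int m = real_of_int (n * int q)" using assms by (simp add: field_simps)
  then have "m = n * int q" by (simp only: of_int_eq_iff)
  then show "int q dvd m" by simp
next
  assume "int q dvd m"
  then obtain n where "m = int q * n" by blast
  then have "2 * pi * of_int m / real q = 2 * pi * of_int n" using assms by simp
  then show "gam q m = 1" unfolding gam_def by (simp only: cis_multiple_2pi[OF Ints_of_int])
qed

lemma gam_cong: "q > 0 \<Longrightarrow> int q dvd a - b \<Longrightarrow> gam q a = gam q b"
  using gam_add[of q "a - b" b] gam_eq_1_iff[of q "a - b"] by simp

lemma sum_gam:
  assumes "q > 0"
  shows "(\<Sum>k<q. gam q (int k * m)) = (if int q dvd m then of_nat q else 0)"
proof (cases "int q dvd m")
  case True
  then have "gam q (int k * m) = 1" for k using gam_eq_1_iff[OF assms] by simp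
  then show ?thesis using True by simp
next
  case False
  then have ne: "gam q m \<noteq> 1" using gam_eq_1_iff[OF assms] by simp
  have "gam q m ^ q = 1" using gam_eq_1_iff[OF assms, of "int q * m"] by (simp add: gam_power)
  then have "(\<Sum>k<q. gam q m ^ k) = 0" using geometric_sum[OF ne, of q] by simp
  then show ?thesis using False by (simp add: gam_power)
qed

section \<open>Action of the lens group on the monomials\<close>

definition lens_weight :: "int list \<Rightarrow> nat \<Rightarrow> int" where
  "lens_weight ps l = (if l < 2 * length ps then (if even l then ps ! (l div 2) else - ps ! (l div 2)) else 0)"

lemma lens_weight_par: "lens_weight ps (par (length ps) l) = - lens_weight ps l"
proof (cases "l < 2 * length ps")
  case True
  then show ?thesis using par_lt2[of "length ps" l]
    by (cases "even l") (auto simp: lens_weight_def par_def elim!: oddE)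
qed (simp add: lens_weight_def par_def)

text \<open>The matrix R turns clockwise, so a coordinate with even index receives the inverse root
  of unity and its conjugate the root itself; \<open>lens_weight\<close> records the sign.\<close>

lemma zeta_lens_act:
  "zeta (length ps) l (lens_act (q, ps, W) k x) = gam q (- (k * lens_weight ps l)) * zeta (length ps) l x"
proof (cases "l < 2 * length ps")
  case True
  define th where "th = 2 * pi * of_int (k * ps ! (l div 2)) / real q"
  have l': "par (length ps) l < 2 * length ps" "par (length ps) l div 2 = l div 2"
    using True par_lt2 by (auto simp: par_def elim!: oddE)
  show ?thesis
  proof (cases "even l")
    case ev: True
    have "gam q (- (k * lens_weight ps l)) = cis (- th)"
      using ev True by (simp add: lens_weight_def th_def gam_def)
    moreover have "lens_act (q, ps, W) k x l = cos th * x l + sin th * x (Suc l)"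
      "lens_act (q, ps, W) k x (Suc l) = - sin th * x l + cos th * x (Suc l)"
      using ev True l' by (auto simp: lens_act_def th_def Let_def par_def)
    ultimately show ?thesis using ev True
      by (simp add: zeta_def kA_def kB_def par_def complex_eq_iff algebra_simps)
  next
    case od: False
    then obtain m where m: "l = Suc m" "even m" by (cases l) auto
    have "gam q (- (k * lens_weight ps l)) = cis th"
      using od True by (simp add: lens_weight_def th_def gam_def)
    moreover have "lens_act (q, ps, W) k x m = cos th * x m + sin th * x (Suc m)"
      "lens_act (q, ps, W) k x (Suc m) = - sin th * x m + cos th * x (Suc m)"
      using m True l' by (auto simp: lens_act_def th_def Let_def par_def)
    ultimately show ?thesis using m True
      by (simp add: zeta_def kA_def kB_def par_def complex_eq_iff algebra_simps)
  qed
qed (simp add: zeta_def kB_def kA_def lens_weight_def lens_act_def)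

lemma lens_act_vecs: "x \<in> vecs N \<Longrightarrow> 2 * length ps \<le> N \<Longrightarrow> lens_act (q, ps, W) k x \<in> vecs N"
  by (auto simp: vecs_def lens_act_def)

lemma lens_act_dot:
  assumes "2 * length ps \<le> N"
  shows "dot N (lens_act (q, ps, W) k x) (lens_act (q, ps, W) k y) = dot N x y"
proof -
  have ph: "gam q t * u * cnj (gam q t * v) = u * cnj v" for t u v
  proof -
    have "gam q t * u * cnj (gam q t * v) = gam q (t + - t) * (u * cnj v)"
      unfolding gam_add gam_minus by simp
    then show ?thesis by simp
  qed
  show ?thesis
    unfolding dot_zeta[OF assms, symmetric] zeta_lens_act ph ..
qed

lemma dot_self: "dot N x x = nsq N x"
  by (simp add: dot_def nsq_def power2_eq_square)

lemma lens_act_sphere: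
  assumes "2 * length ps \<le> N" "x \<in> sphere_pts N"
  shows "lens_act (q, ps, W) k x \<in> sphere_pts N"
  using assms lens_act_vecs lens_act_dot[OF assms(1), of q W k x x] by (simp add: sphere_pts_iff dot_self)

lemma gam_sum: "finite A \<Longrightarrow> (\<Prod>l\<in>A. gam q (f l)) = gam q (\<Sum>l\<in>A. f l)"
  by (induction A rule: finite_induct) (simp_all add: gam_add)

lemma mon_lens_act:
  "mon (length ps) N a (lens_act (q, ps, W) k x) =
     gam q (- (k * wt N (lens_weight ps) a)) * mon (length ps) N a x"
proof -
  have "(\<Prod>l<N. gam q (- (k * lens_weight ps l)) ^ a l) = gam q (- (k * wt N (lens_weight ps) a))"
    by (simp add: gam_power gam_sum wt_def sum_distrib_left sum_negf algebra_simps)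
  then show ?thesis
    by (simp add: mon_def zeta_lens_act power_mult_distrib prod.distrib)
qed

section \<open>Eigenspaces of a lens space\<close>

locale lens =
  fixes q :: nat and ps :: "int list" and W :: nat
  assumes q0: "q > 0" and ps_ne: "ps \<noteq> []"
begin

abbreviation "n \<equiv> length ps"
abbreviation "N \<equiv> 2 * length ps + W"
abbreviation "g k x \<equiv> lens_act (q, ps, W) k x"

sublocale weights "length ps" "2 * length ps + W" "lens_weight ps" q
proof
  show "2 \<le> 2 * length ps + W" using ps_ne by (cases ps) auto
qed (auto simp: lens_weight_par)

lemma g_sphere: "x \<in> sphere_pts N \<Longrightarrow> g k x \<in> sphere_pts N"
  by (rule lens_act_sphere) auto

lemma EE_act:
  "x \<in> sphere_pts N \<Longrightarrow> EE n N a (g k x) = cas (gam q (- (k * wt N (lens_weight ps) a)) * mon n N a x)"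
  by (simp add: EE_def restr_id g_sphere ee_def mon_lens_act)

lemma V_invariant: "f \<in> V k \<Longrightarrow> x \<in> sphere_pts N \<Longrightarrow> f (g j x) = f x"
  unfolding VV_def
proof (induction rule: fs_induct)
  case (step c b h)
  then obtain a where a: "b = EE n N a" "int q dvd wt N (lens_weight ps) a" by (auto simp: II_def)
  have "gam q (- (j * wt N (lens_weight ps) a)) = 1" using a(2) gam_eq_1_iff[OF q0] by simp
  then have "b (g j x) = b x" using step.prems by (simp add: a EE_act) (simp add: EE_def restr_id ee_def)
  then show ?case using step by simp
qed simp

text \<open>Averaging over the group fixes f; by \<open>sum_gam\<close> it keeps the invariant
  monomials and annihilates the others.\<close>

lemma invariant_V:
  assumes f: "f \<in> VV n N (\<lambda>_. 0) 1 k"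
    and inv: "\<And>x j. x \<in> sphere_pts N \<Longrightarrow> j < q \<Longrightarrow> f (g (int j) x) = f x"
  shows "f \<in> V k"
proof -
  define A where "A f x = (if x \<in> sphere_pts N then 1 / real q * (\<Sum>j<q. f (g (int j) x)) else 0)" for f x
  have "A f \<in> V k"
    using f unfolding VV_def[of n N "\<lambda>_. 0"]
  proof (induction rule: fs_induct)
    case zero
    have "A (\<lambda>x. 0) = (\<lambda>x. 0)" by (simp add: A_def fun_eq_iff)
    then show ?case using fs_zero by (simp add: VV_def)
  next
    case (step c b h)
    then obtain a where a: "b = EE n N a" "a \<in> Idx N k" by (auto simp: II_def)
    have Ab: "A b = (if int q dvd wt N (lens_weight ps) a then EE n N a else (\<lambda>x. 0))"
    proof
      fix x
      show "A b x = (if int q dvd wt N (lens_weight ps) a then EE n N a else (\<lambda>x. 0)) x"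
      proof (cases "x \<in> sphere_pts N")
        case True
        have "(\<Sum>j<q. b (g (int j) x)) = cas ((\<Sum>j<q. gam q (int j * - wt N (lens_weight ps) a)) * mon n N a x)"
          by (simp add: a EE_act True sum_distrib_right cas_sum)
        also have "\<dots> = (if int q dvd wt N (lens_weight ps) a then real q * ee n N a x else 0)"
          unfolding sum_gam[OF q0] by (simp add: cas_def ee_def algebra_simps)
        finally show ?thesis using True q0 by (simp add: A_def EE_def restr_id)
      qed (simp add: A_def EE_def restr_def)
    qed
    have "EE n N a \<in> V k" if "int q dvd wt N (lens_weight ps) a"
      unfolding VV_def using a that by (intro fs.span_base imageI) (simp add: II_def)
    then have "A b \<in> V k" using fs_zero unfolding Ab by (simp add: VV_def)
    moreover have "A (\<lambda>x. c * b x + h x) = (\<lambda>x. c * A b x + A h x)"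
      by (rule ext) (simp add: A_def sum.distrib sum_distrib_left algebra_simps)
    ultimately show ?case using V_lin[OF _ step(3)] by simp
  qed
  moreover have "A f = f"
  proof
    fix x
    show "A f x = f x"
    proof (cases "x \<in> sphere_pts N")
      case True
      then show ?thesis using q0 inv[OF True] by (simp add: A_def)
    next
      case False
      then show ?thesis
        using fun_cong[OF VV_props(2)[OF nN f], of x] by (simp add: A_def restr_def)
    qed
  qed
  ultimately show ?thesis by simp
qed

text \<open>The second disjunct is there because the zero function satisfies
  \<open>lens_eigenfun\<close> for every lam.\<close>

lemma lens_eigenfun_iff:
  "lens_eigenfun (q, ps, W) lam f \<longleftrightarrow>
     (\<exists>k. lam = lamk N k \<and> (\<exists>h\<in>H k. \<forall>x\<in>sphere_pts N. f x = h x)) \<or> (\<forall>x\<in>sphere_pts N. f x = 0)"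
proof -
  have ef: "lens_eigenfun (q, ps, W) lam f \<longleftrightarrow> smf N f \<and>
      (\<forall>x\<in>sphere_pts N. \<forall>k<q. f (g (int k) x) = f x) \<and>
      (\<forall>x\<in>sphere_pts N. sph_laplacian N f x = - lam * f x)"
    by (simp add: lens_eigenfun_def lens_N_def smf_def lens_invariant_def lens_order_def)
  show ?thesis
  proof
    assume "lens_eigenfun (q, ps, W) lam f"
    then have f: "smf N f" "\<And>x k. x \<in> sphere_pts N \<Longrightarrow> k < q \<Longrightarrow> f (g (int k) x) = f x"
      "\<And>x. x \<in> sphere_pts N \<Longrightarrow> sph_laplacian N f x = - lam * f x" unfolding ef by blast+
    show "(\<exists>k. lam = lamk N k \<and> (\<exists>h\<in>H k. \<forall>x\<in>sphere_pts N. f x = h x)) \<or> (\<forall>x\<in>sphere_pts N. f x = 0)"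
    proof (cases "\<forall>x\<in>sphere_pts N. f x = 0")
      case False
      then obtain k h where k: "lam = lamk N k" "h \<in> Hfull n N k" "\<And>x. x \<in> sphere_pts N \<Longrightarrow> f x = h x"
        using eigenfunction_harmonic[OF nN N2 f(1,3)] by blast
      have "h (g (int j) x) = h x" if "x \<in> sphere_pts N" "j < q" for x j
        using f(2)[OF that] k(3) g_sphere that(1) by simp
      then have "h \<in> V k" using invariant_V k(2) by (simp add: HH_def)
      then have "h \<in> H k" using k(2) by (simp add: HH_def)
      then show ?thesis using k by blast
    qed blast
  next
    assume "(\<exists>k. lam = lamk N k \<and> (\<exists>h\<in>H k. \<forall>x\<in>sphere_pts N. f x = h x)) \<or> (\<forall>x\<in>sphere_pts N. f x = 0)"
    then obtain h where h: "smf N h" "\<And>x k. x \<in> sphere_pts N \<Longrightarrow> h (g k x) = h x"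
       "\<And>x. x \<in> sphere_pts N \<Longrightarrow> sph_laplacian N h x = - lam * h x"
       "\<And>x. x \<in> sphere_pts N \<Longrightarrow> h x = f x"
    proof (elim disjE exE conjE bexE)
      fix k h assume k: "lam = lamk N k" "h \<in> H k" "\<forall>x\<in>sphere_pts N. f x = h x"
      show thesis
        by (rule that[of h]) (use k V_smf[OF H_V[OF k(2)]] V_invariant[OF H_V[OF k(2)]] H_eigen[OF k(2)] in auto)
    next
      assume z: "\<forall>x\<in>sphere_pts N. f x = 0"
      show thesis
      proof (rule that[of "\<lambda>x. 0"])
        show "sph_laplacian N (\<lambda>x. 0) x = - lam * 0" if "x \<in> sphere_pts N" for x
          using sph_laplacian_lin[OF smf_zero smf_zero that, of 1] by simp
      qed (use z smf_zero in auto)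
    qed
    show "lens_eigenfun (q, ps, W) lam f"
      unfolding ef
    proof (intro conjI ballI allI impI)
      show "smf N f" by (rule smf_cong[OF h(4,1)])
      fix x assume x: "x \<in> sphere_pts N"
      show "f (g (int k) x) = f x" for k using h(2)[OF x] h(4)[OF x] h(4)[OF g_sphere[OF x]] by simp
      show "sph_laplacian N f x = - lam * f x"
        using sph_laplacian_cong[of N h f x, OF h(4) x] h(3)[OF x] h(4)[OF x] by simp
    qed
  qed
qed

lemma eigenspace_basis:
  "\<exists>B. finite B \<and> fs.independent B \<and> (\<forall>b\<in>fs.span B. restr N b = b) \<and>
     (\<forall>f. lens_eigenfun (q, ps, W) lam f \<longleftrightarrow> (\<exists>h\<in>fs.span B. \<forall>x\<in>sphere_pts N. f x = h x)) \<and>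
     (\<forall>k. lam = lamk N k \<longrightarrow> card B = card (II N (lens_weight ps) q k) -
        (if k < 2 then 0 else card (II N (lens_weight ps) q (k - 2)))) \<and>
     ((\<forall>k. lam \<noteq> lamk N k) \<longrightarrow> card B = 0)"
proof (cases "\<exists>k. lam = lamk N k")
  case True
  then obtain k where k: "lam = lamk N k" by blast
  obtain B where B: "finite B" "fs.independent B" "fs.span B = H k"
     "card B = card (II N (lens_weight ps) q k) - (if k < 2 then 0 else card (II N (lens_weight ps) q (k - 2)))"
    using H_dim by blast
  have u: "k' = k" if "lam = lamk N k'" for k' using lamk_inject[OF N2] that k by metis
  have e: "lens_eigenfun (q, ps, W) lam f \<longleftrightarrow> (\<exists>h\<in>fs.span B. \<forall>x\<in>sphere_pts N. f x = h x)" for f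
  proof -
    have z: "\<exists>h\<in>H k. \<forall>x\<in>sphere_pts N. f x = h x" if "\<forall>x\<in>sphere_pts N. f x = 0"
      using fs_zero[of B] that unfolding B(3) by (intro bexI[of _ "\<lambda>x. 0"]) auto
    show ?thesis unfolding lens_eigenfun_iff B(3)
    proof
      assume "(\<exists>k. lam = lamk N k \<and> (\<exists>h\<in>H k. \<forall>x\<in>sphere_pts N. f x = h x)) \<or> (\<forall>x\<in>sphere_pts N. f x = 0)"
      then show "\<exists>h\<in>H k. \<forall>x\<in>sphere_pts N. f x = h x"
      proof
        assume "\<exists>k. lam = lamk N k \<and> (\<exists>h\<in>H k. \<forall>x\<in>sphere_pts N. f x = h x)"
        then obtain k' where "lam = lamk N k'" "\<exists>h\<in>H k'. \<forall>x\<in>sphere_pts N. f x = h x" by blast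
        then show ?thesis using u[of k'] by simp
      qed (rule z)
    qed (use k in blast)
  qed
  have v: "restr N b = b" if "b \<in> fs.span B" for b
    by (rule VV_props(2)[OF nN H_V]) (use that B(3) in simp)
  have w: "card B = card (II N (lens_weight ps) q k') - (if k' < 2 then 0 else card (II N (lens_weight ps) q (k' - 2)))"
    if "lam = lamk N k'" for k'
    unfolding u[OF that] by (rule B(4))
  have nk: "card B = 0" if "\<forall>k. lam \<noteq> lamk N k" using that k by blast
  show ?thesis
    by (intro exI[of _ B] conjI allI ballI impI B(1,2) e) (erule v, erule w, erule nk)
next
  case False
  have "lens_eigenfun (q, ps, W) lam f \<longleftrightarrow> (\<exists>h\<in>fs.span {}. \<forall>x\<in>sphere_pts N. f x = h x)" for f
    unfolding lens_eigenfun_iff using False by (simp add: zero_fun_def)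
  moreover have "restr N b = b" if "b \<in> fs.span {}" for b
    using that by (auto simp: restr_def zero_fun_def)
  ultimately show ?thesis using False fs.independent_empty
    by (intro exI[of _ "{}"]) simp
qed

text \<open>The lists in \<open>eig_mult\<close> are independent and spanning only as functions on
  the sphere. After \<open>restr\<close> such a list becomes a basis of the span of B, so its length
  is the dimension.\<close>

lemma eig_mult_iff:
  "eig_mult (q, ps, W) lam d \<longleftrightarrow>
     (\<forall>k. lam = lamk N k \<longrightarrow> d = card (II N (lens_weight ps) q k) -
        (if k < 2 then 0 else card (II N (lens_weight ps) q (k - 2)))) \<and>
     ((\<forall>k. lam \<noteq> lamk N k) \<longrightarrow> d = 0)"
    (is "_ \<longleftrightarrow> ?R d")
proof -
  let ?S = "sphere_pts N" and ?E = "lens_eigenfun (q, ps, W) lam"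
  obtain B where B0: "finite B \<and> fs.independent B \<and> (\<forall>b\<in>fs.span B. restr N b = b) \<and>
     (\<forall>f. ?E f \<longleftrightarrow> (\<exists>h\<in>fs.span B. \<forall>x\<in>?S. f x = h x)) \<and>
     (\<forall>k. lam = lamk N k \<longrightarrow> card B = card (II N (lens_weight ps) q k) -
        (if k < 2 then 0 else card (II N (lens_weight ps) q (k - 2)))) \<and>
     ((\<forall>k. lam \<noteq> lamk N k) \<longrightarrow> card B = 0)"
    using eigenspace_basis[of lam] by (rule exE)
  then have B: "finite B" "fs.independent B" "\<And>b. b \<in> fs.span B \<Longrightarrow> restr N b = b"
    "\<And>f. ?E f \<longleftrightarrow> (\<exists>h\<in>fs.span B. \<forall>x\<in>?S. f x = h x)"
    and cardB: "(\<forall>k. lam = lamk N k \<longrightarrow> card B = card (II N (lens_weight ps) q k) -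
        (if k < 2 then 0 else card (II N (lens_weight ps) q (k - 2)))) \<and>
     ((\<forall>k. lam \<noteq> lamk N k) \<longrightarrow> card B = 0)"
    by simp_all
  have out: "f x = 0" if "f \<in> fs.span B" "x \<notin> ?S" for f x
    using fun_cong[OF B(3)[OF that(1)], of x] that(2) by (simp add: restr_def)
  have EN: "lens_N (q, ps, W) = N" by (simp add: lens_N_def)
  have "eig_mult (q, ps, W) lam d \<longleftrightarrow> d = card B"
  proof
    assume "d = card B"
    obtain bs where bs: "set bs = B" "distinct bs" using finite_distinct_list[OF B(1)] by blast
    have len: "length bs = d" using bs \<open>d = card B\<close> distinct_card by metis
    have bij: "inj_on (nth bs) {..<d}" "nth bs ` {..<d} = B"
      using bs len by (auto simp: inj_on_def nth_eq_iff_index_eq in_set_conv_nth image_def)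
    have bspan: "bs ! j \<in> fs.span B" if "j < d" for j using bij(2) that by (intro fs.span_base) auto
    have ind: "\<forall>j<d. c j = 0" if c: "\<forall>x\<in>?S. (\<Sum>j<d. c j * (bs ! j) x) = 0" for c
    proof -
      have cz: "(\<Sum>j<d. c j * (bs ! j) x) = 0" for x
        using c out[OF bspan] by (cases "x \<in> ?S") auto
      show ?thesis
      proof (intro allI impI, rule ccontr)
        fix i assume "i < d" "c i \<noteq> 0"
        then have "(\<exists>i\<in>{..<d}. c i \<noteq> 0) \<and> (\<forall>x. (\<Sum>j<d. c j * (bs ! j) x) = 0)"
          using cz by auto
        then have "fs.dependent (nth bs ` {..<d})"
          unfolding fs_dependent_iff[OF finite_lessThan bij(1)] by (rule exI[of _ c])
        then show False using B(2) bij(2) by simp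
      qed
    qed
    have spn: "\<exists>c. \<forall>x\<in>?S. f x = (\<Sum>j<d. c j * (bs ! j) x)" if "?E f" for f
    proof -
      obtain h where h: "h \<in> fs.span B" "\<And>x. x \<in> ?S \<Longrightarrow> f x = h x" using B(4)[of f] \<open>?E f\<close> by blast
      obtain u where "h = (\<Sum>v\<in>B. (\<lambda>x. u v * v x))" using h(1) unfolding fs.span_finite[OF B(1)] by blast
      then have "h x = (\<Sum>v\<in>B. u v * v x)" for x by (simp add: fs_sum_apply)
      then have "h x = (\<Sum>j<d. u (bs ! j) * (bs ! j) x)" for x
        using sum.reindex[OF bij(1), of "\<lambda>v. u v * v x"] bij(2) by simp
      then show ?thesis using h(2) by (intro exI[of _ "\<lambda>j. u (bs ! j)"]) simp
    qed
    have eb: "?E b" if "b \<in> set bs" for b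
      using B(4)[of b] fs.span_base[of b B] that bs(1) by blast
    show "eig_mult (q, ps, W) lam d"
      unfolding eig_mult_def EN
    proof (intro exI[of _ bs] conjI ballI len)
      show "\<forall>c. (\<forall>x\<in>?S. (\<Sum>j<d. c j * (bs ! j) x) = 0) \<longrightarrow> (\<forall>j<d. c j = 0)"
        using ind by simp
      show "\<forall>f. ?E f \<longrightarrow> (\<exists>c. \<forall>x\<in>?S. f x = (\<Sum>j<d. c j * (bs ! j) x))"
        using spn by simp
    qed (rule eb)
  next
    assume "eig_mult (q, ps, W) lam d"
    then obtain fs where F: "length fs = d \<and> (\<forall>f\<in>set fs. ?E f) \<and>
        (\<forall>c::nat \<Rightarrow> real. (\<forall>x\<in>?S. (\<Sum>j<d. c j * (fs ! j) x) = 0) \<longrightarrow> (\<forall>j<d. c j = 0)) \<and>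
        (\<forall>f. ?E f \<longrightarrow> (\<exists>c::nat \<Rightarrow> real. \<forall>x\<in>?S. f x = (\<Sum>j<d. c j * (fs ! j) x)))"
      unfolding eig_mult_def EN by (rule exE)
    then have fs: "length fs = d" "\<And>f. f \<in> set fs \<Longrightarrow> ?E f"
      "\<And>c. \<forall>x\<in>?S. (\<Sum>j<d. c j * (fs ! j) x) = 0 \<Longrightarrow> \<forall>j<d. c j = 0"
      "\<And>f. ?E f \<Longrightarrow> \<exists>c. \<forall>x\<in>?S. f x = (\<Sum>j<d. c j * (fs ! j) x)"
      by simp_all
    define h where "h j = restr N (fs ! j)" for j
    have hB: "h j \<in> fs.span B" if j: "j < d" for j
    proof -
      obtain h' where h': "h' \<in> fs.span B" "\<forall>x\<in>?S. (fs ! j) x = h' x"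
        using B(4)[of "fs ! j"] fs(1) fs(2)[of "fs ! j"] j nth_mem[of j fs] by auto
      have "restr N (fs ! j) = restr N h'" using h'(2) by (auto simp: restr_def)
      then show ?thesis using B(3)[OF h'(1)] h'(1) by (simp add: h_def)
    qed
    have z: "c i = 0" if "\<And>x. (\<Sum>j<d. c j * h j x) = 0" "i < d" for c i
    proof -
      have "\<forall>x\<in>?S. (\<Sum>j<d. c j * (fs ! j) x) = 0"
      proof
        fix x assume "x \<in> ?S"
        then show "(\<Sum>j<d. c j * (fs ! j) x) = 0" using that(1)[of x] by (simp add: h_def restr_id)
      qed
      then show ?thesis using fs(3) that(2) by blast
    qed
    have ind: "fs.independent (h ` {..<d})" "inj_on h {..<d}"
      using fs_independent_family[of "{..<d}" h] z by blast+
    have "fs.span (h ` {..<d}) = fs.span B"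
    proof
      show "fs.span (h ` {..<d}) \<subseteq> fs.span B"
        by (rule fs.span_minimal[OF _ fs.subspace_span]) (use hB in auto)
      show "fs.span B \<subseteq> fs.span (h ` {..<d})"
      proof
        fix f assume f: "f \<in> fs.span B"
        then obtain c where c: "\<And>x. x \<in> ?S \<Longrightarrow> f x = (\<Sum>j<d. c j * (fs ! j) x)"
          using fs(4)[of f] B(4)[of f] by blast
        have "f = (\<lambda>x. \<Sum>j<d. c j * h j x)"
        proof
          fix x
          show "f x = (\<Sum>j<d. c j * h j x)"
            using c[of x] out[OF f, of x] by (cases "x \<in> ?S") (simp_all add: h_def restr_def)
        qed
        moreover have "(\<lambda>x. \<Sum>j<d. c j * h j x) \<in> fs.span (h ` {..<d})"
          by (intro fs_sum fs_cmult fs.span_base imageI)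
        ultimately show "f \<in> fs.span (h ` {..<d})" by simp
      qed
    qed
    then have "card (h ` {..<d}) = card B"
      using fs.dim_span_eq_card_independent[OF ind(1)] fs.dim_span_eq_card_independent[OF B(2)] by simp
    then show "d = card B" using card_image[OF ind(2)] by simp
  qed
  moreover have "?R d \<longleftrightarrow> d = card B"
  proof
    assume R: "?R d"
    show "d = card B"
    proof (cases "\<exists>k. lam = lamk N k")
      case True
      then obtain k where "lam = lamk N k" by blast
      then show ?thesis using R cardB by simp
    next
      case False
      then show ?thesis using R cardB by simp
    qed
  qed (use cardB in simp)
  ultimately show ?thesis by simp
qed

end

lemma isospectral_if_card_eq:
  assumes "q > 0" "ps \<noteq> []" "length ps = length ps'"
    and "\<And>k. card (II (2 * length ps + W) (lens_weight ps) q k) = card (II (2 * length ps + W) (lens_weight ps') q k)"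
  shows "isospectral (q, ps, W) (q, ps', W)"
proof -
  interpret A: lens q ps W using assms by unfold_locales
  interpret B: lens q ps' W using assms by unfold_locales auto
  show ?thesis
    unfolding isospectral_def A.eig_mult_iff B.eig_mult_iff using assms(3,4) by simp
qed

section \<open>Generating functions of the invariants\<close>

text \<open>Generating function of the complete homogeneous symmetric polynomials in the first N
  values of c; \<open>hser_prod\<close> gives its product form.\<close>

definition hser :: "nat \<Rightarrow> (nat \<Rightarrow> complex) \<Rightarrow> complex fps" where
  "hser N c = Abs_fps (\<lambda>k. \<Sum>a\<in>Idx N k. \<Prod>l<N. c l ^ a l)"

lemma fps_geometric: "Abs_fps (\<lambda>k. (c::complex) ^ k) * (1 - fps_const c * fps_X) = 1"
proof (rule fps_ext)
  fix k
  have "Abs_fps (\<lambda>k. c ^ k) * (1 - fps_const c * fps_X) =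
      Abs_fps (\<lambda>k. c ^ k) - fps_const c * (Abs_fps (\<lambda>k. c ^ k) * fps_X)"
    by (simp add: algebra_simps)
  then show "fps_nth (Abs_fps (\<lambda>k. c ^ k) * (1 - fps_const c * fps_X)) k = fps_nth 1 k"
    by (cases k) simp_all
qed

lemma hser_Suc: "hser (Suc N) c = hser N c * Abs_fps (\<lambda>k. c N ^ k)"
proof (rule fps_ext)
  fix k
  have "(\<Sum>a\<in>Idx (Suc N) k. \<Prod>l<Suc N. c l ^ a l) =
      (\<Sum>(i, b)\<in>(SIGMA i:{..k}. Idx N i). (\<Prod>l<N. c l ^ b l) * c N ^ (k - i))"
  proof (rule sum.reindex_bij_witness[where
        j="\<lambda>a. (k - a N, a(N := 0))" and i="\<lambda>(i, b). b(N := k - i)"])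
    fix a assume a: "a \<in> Idx (Suc N) k"
    then have le: "a N \<le> k" by (rule Idx_le)
    show "(case (k - a N, a(N := 0)) of (i, b) \<Rightarrow> b(N := k - i)) = a" using le by auto
    show "(k - a N, a(N := 0)) \<in> (SIGMA i:{..k}. Idx N i)"
      using a by (auto simp: Idx_def)
    show "(case (k - a N, a(N := 0)) of (i, b) \<Rightarrow> (\<Prod>l<N. c l ^ b l) * c N ^ (k - i)) =
        (\<Prod>l<Suc N. c l ^ a l)" using le by simp
  next
    fix p assume "p \<in> (SIGMA i:{..k}. Idx N i)"
    then obtain i b where p: "p = (i, b)" "i \<le> k" "b \<in> Idx N i" by auto
    show "(k - (case p of (i, b) \<Rightarrow> b(N := k - i)) N, (case p of (i, b) \<Rightarrow> b(N := k - i))(N := 0)) = p"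
      using p by (auto simp: Idx_def fun_eq_iff)
    show "(case p of (i, b) \<Rightarrow> b(N := k - i)) \<in> Idx (Suc N) k"
      using p by (auto simp: Idx_def)
  qed
  also have "\<dots> = (\<Sum>i\<le>k. (\<Sum>b\<in>Idx N i. \<Prod>l<N. c l ^ b l) * c N ^ (k - i))"
    by (simp add: sum.Sigma[symmetric] finite_Idx sum_distrib_right)
  finally show "fps_nth (hser (Suc N) c) k = fps_nth (hser N c * Abs_fps (\<lambda>k. c N ^ k)) k"
    by (simp add: hser_def fps_mult_nth atLeast0AtMost)
qed

lemma hser_prod: "hser N c * (\<Prod>l<N. 1 - fps_const (c l) * fps_X) = 1"
proof (induction N)
  case 0
  have I: "Idx 0 k = (if k = 0 then {\<lambda>_. 0} else {})" for k by (auto simp: Idx_def)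
  then have "hser 0 c = 1" by (intro fps_ext) (simp add: hser_def I)
  then show ?case by simp
next
  case (Suc N)
  have "hser (Suc N) c * (\<Prod>l<Suc N. 1 - fps_const (c l) * fps_X) =
      (hser N c * (\<Prod>l<N. 1 - fps_const (c l) * fps_X)) *
      (Abs_fps (\<lambda>k. c N ^ k) * (1 - fps_const (c N) * fps_X))"
    by (simp add: hser_Suc mult_ac)
  then show ?case by (simp only: Suc.IH fps_geometric mult_1)
qed

text \<open>The formula before division by q: summing characters over the group tests whether q
  divides the weight.\<close>

lemma card_II:
  assumes "q > 0"
  shows "of_nat q * of_nat (card (II N w q k)) =
     (\<Sum>j<q. fps_nth (hser N (\<lambda>l. gam q (int j * w l))) k)"
proof -
  have "(\<Sum>j<q. fps_nth (hser N (\<lambda>l. gam q (int j * w l))) k) =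
      (\<Sum>j<q. \<Sum>a\<in>Idx N k. gam q (int j * wt N w a))"
    by (simp add: hser_def gam_power gam_sum wt_def sum_distrib_left algebra_simps)
  also have "\<dots> = (\<Sum>a\<in>Idx N k. \<Sum>j<q. gam q (int j * wt N w a))" by (rule sum.swap)
  also have "\<dots> = (\<Sum>a\<in>Idx N k. if int q dvd wt N w a then of_nat q else 0)"
    by (simp add: sum_gam[OF assms])
  also have "\<dots> = (\<Sum>a\<in>II N w q k. of_nat q)"
    by (rule sum.mono_neutral_cong_right) (auto simp: II_def finite_Idx)
  finally show ?thesis by (simp add: mult.commute)
qed

section \<open>Reversed characteristic polynomials and multiplication by units\<close>

definition sig :: "nat \<Rightarrow> int \<Rightarrow> int \<Rightarrow> complex" where
  "sig q j s = gam q (j * s) + gam q (- (j * s))"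

text \<open>The factor contributed by a plane with rotation number p to the reversed characteristic
  polynomial of the j-th power of the generator.\<close>

definition FF :: "nat \<Rightarrow> int \<Rightarrow> int \<Rightarrow> complex fps" where
  "FF q j p = (1 - fps_const (gam q (j * p)) * fps_X) * (1 - fps_const (gam q (- (j * p))) * fps_X)"

lemma FF_sig: "FF q j p = 1 - fps_const (sig q j p) * fps_X + fps_X\<^sup>2"
proof -
  have "fps_const (gam q (j * p)) * fps_const (gam q (- (j * p))) = 1"
    using gam_add[of q "j * p" "- (j * p)"] by (simp add: fps_const_mult)
  then have "FF q j p = 1 - (fps_const (gam q (j * p)) + fps_const (gam q (- (j * p)))) * fps_X + 1 * fps_X\<^sup>2"
    unfolding FF_def by (simp add: algebra_simps power2_eq_square)
  then show ?thesis by (simp add: sig_def fps_const_add)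
qed

lemma sig_mult: "sig q j s * sig q j t = sig q j (s + t) + sig q j (s - t)"
proof -
  have "j * (s + t) = j * s + j * t" "j * (s - t) = j * s + - (j * t)"
    "- (j * (s + t)) = - (j * s) + - (j * t)" "- (j * (s - t)) = - (j * s) + j * t"
    by (simp_all add: algebra_simps)
  then have "sig q j (s + t) + sig q j (s - t) = (gam q (j * s) * gam q (j * t) + gam q (- (j * s)) * gam q (- (j * t)))
     + (gam q (j * s) * gam q (- (j * t)) + gam q (- (j * s)) * gam q (j * t))"
    by (simp only: sig_def gam_add)
  then show ?thesis by (simp add: sig_def algebra_simps)
qed

lemma FF_mult:
  "FF q j s * FF q j t = (1 + 2 * fps_X\<^sup>2 + fps_X ^ 4)
     - (fps_X + fps_X ^ 3) * (fps_const (sig q j s) + fps_const (sig q j t))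
     + fps_X\<^sup>2 * (fps_const (sig q j (s + t)) + fps_const (sig q j (s - t)))"
proof -
  have "fps_const (sig q j (s + t)) + fps_const (sig q j (s - t)) = fps_const (sig q j s) * fps_const (sig q j t)"
    by (simp add: sig_mult fps_const_add fps_const_mult)
  moreover have "(1 - A * x + x\<^sup>2) * (1 - B * x + x\<^sup>2) = (1 + 2 * x\<^sup>2 + x ^ 4) - (x + x ^ 3) * (A + B) + x\<^sup>2 * (A * B)"
    for A B x :: "complex fps"
    by (simp add: algebra_simps power2_eq_square power3_eq_cube power4_eq_xxxx)
  ultimately show ?thesis unfolding FF_sig by simp
qed

lemma FF_cong: "q > 0 \<Longrightarrow> int q dvd j * p - j' * p' \<Longrightarrow> FF q j p = FF q j' p'"
  using gam_cong[of q "j * p" "j' * p'"] gam_cong[of q "- (j * p)" "- (j' * p')"]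
    dvd_minus_iff[of "int q" "j * p - j' * p'"] by (simp add: FF_def)

lemma FF_uminus: "FF q j (- p) = FF q j p"
  by (simp add: FF_def mult.commute)

text \<open>The reversed characteristic polynomial with no plane deleted.\<close>

definition full :: "nat \<Rightarrow> nat \<Rightarrow> int \<Rightarrow> complex fps" where
  "full q W j = (1 - fps_X) ^ W * (\<Prod>p\<in>{1..int (q div 2)}. FF q j p)"

lemma full_cong: "q > 0 \<Longrightarrow> int q dvd j - j' \<Longrightarrow> full q W j = full q W j'"
  unfolding full_def
  by (intro arg_cong2[where f="(*)"] prod.cong refl FF_cong) (auto simp flip: left_diff_distrib)

lemma full_nth_0: "fps_nth (full q W j) 0 = 1"
proof -
  have "fps_nth (\<Prod>p\<in>A. FF q j p) 0 = 1" if "finite A" for A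
    using that by (induction rule: finite_induct) (simp_all add: FF_def)
  then show ?thesis by (simp add: full_def fps_power_zeroth)
qed

text \<open>The difference is below q in absolute value, and the sum is at most q, with equality
  only if both numbers are q / 2.\<close>

lemma half_residue_eq:
  fixes p p' :: int
  assumes "p \<in> {1..int (q div 2)}" "p' \<in> {1..int (q div 2)}" "int q dvd p - p' \<or> int q dvd p + p'"
  shows "p = p'"
proof -
  have b: "0 < p" "0 < p'" "2 * p \<le> int q" "2 * p' \<le> int q" using assms(1,2) by auto
  show ?thesis
  proof (cases "int q dvd p - p'")
    case True
    then have "p - p' = 0 \<or> int q \<le> \<bar>p - p'\<bar>" using dvd_imp_le_int[of "p - p'" "int q"] by auto
    then show ?thesis using b by auto
  next
    case False
    then have "int q dvd p + p'" using assms(3) by simp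
    then have "int q \<le> p + p'" using b by (intro zdvd_imp_le) auto
    then show ?thesis using b by auto
  qed
qed

text \<open>Up to sign, the numbers from 1 to \<open>q div 2\<close> represent each nonzero residue
  once. A unit permutes these classes, and \<open>FF\<close> depends only on the class of its last
  argument.\<close>

lemma full_unit:
  assumes "q > 0" "coprime u (int q)"
  shows "full q W (u * j) = full q W j"
proof -
  let ?R = "{1..int (q div 2)}"
  \<comment> \<open>The representative of x modulo q and sign; it lies in the range as soon as q
    does not divide x.\<close>
  define rep where "rep x = (let r = x mod int q in if r \<le> int (q div 2) then r else int q - r)" for x
  have rep: "int q dvd x - rep x \<or> int q dvd x + rep x" for x
  proof -
    have "int q dvd x - x mod int q" by (simp add: dvd_minus_mod)
    moreover have "x + (int q - x mod int q) = (x - x mod int q) + int q" by simp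
    ultimately show ?thesis unfolding rep_def Let_def by (metis dvd_add dvd_refl)
  qed
  have repR: "rep x \<in> ?R" if "\<not> int q dvd x" for x
  proof -
    have "x mod int q \<noteq> 0" using that by (simp add: dvd_eq_mod_eq_0)
    moreover have "0 \<le> x mod int q" "x mod int q < int q" using assms(1) by auto
    ultimately show ?thesis by (auto simp: rep_def Let_def)
  qed
  have nz: "\<not> int q dvd u * p" if "p \<in> ?R" for p
  proof
    assume "int q dvd u * p"
    then have "int q dvd p" using assms(2) by (simp add: coprime_dvd_mult_right_iff coprime_commute)
    then have "int q \<le> p" using that by (intro zdvd_imp_le) auto
    then show False using that by auto
  qed
  have inj: "inj_on (\<lambda>p. rep (u * p)) ?R"
  proof (rule inj_onI)
    fix p p' assume p: "p \<in> ?R" "p' \<in> ?R" and eq: "rep (u * p) = rep (u * p')"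
    have d: "int q dvd u * (p - p') \<or> int q dvd u * (p + p')"
      using rep[of "u * p"] rep[of "u * p'"] unfolding eq
    proof (elim disjE)
      assume "int q dvd u * p - rep (u * p')" "int q dvd u * p' - rep (u * p')"
      from dvd_diff[OF this] show ?thesis by (simp add: algebra_simps)
    next
      assume "int q dvd u * p - rep (u * p')" "int q dvd u * p' + rep (u * p')"
      from dvd_add[OF this] show ?thesis by (simp add: algebra_simps)
    next
      assume "int q dvd u * p + rep (u * p')" "int q dvd u * p' - rep (u * p')"
      from dvd_add[OF this] show ?thesis by (simp add: algebra_simps)
    next
      assume "int q dvd u * p + rep (u * p')" "int q dvd u * p' + rep (u * p')"
      from dvd_diff[OF this] show ?thesis by (simp add: algebra_simps)
    qed
    have "int q dvd p - p' \<or> int q dvd p + p'"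
      using d assms(2) by (simp add: coprime_dvd_mult_right_iff coprime_commute)
    then show "p = p'" by (rule half_residue_eq[OF p])
  qed
  have surj: "(\<lambda>p. rep (u * p)) ` ?R = ?R"
    by (rule endo_inj_surj[OF _ _ inj]) (use repR nz in auto)
  have "(\<Prod>p\<in>?R. FF q j p) = (\<Prod>p\<in>?R. FF q j (rep (u * p)))"
    using prod.reindex[OF inj, of "FF q j"] surj by simp
  also have "\<dots> = (\<Prod>p\<in>?R. FF q (u * j) p)"
  proof (rule prod.cong[OF refl])
    fix p
    show "FF q j (rep (u * p)) = FF q (u * j) p"
      using rep[of "u * p"]
    proof
      assume "int q dvd u * p - rep (u * p)"
      then have "int q dvd j * (u * p - rep (u * p))" by simp
      then have "int q dvd u * j * p - j * rep (u * p)" by (simp add: algebra_simps)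
      then show ?thesis using FF_cong[OF assms(1)] by metis
    next
      assume "int q dvd u * p + rep (u * p)"
      then have "int q dvd j * (u * p + rep (u * p))" by simp
      then have "int q dvd u * j * p - j * - rep (u * p)" by (simp add: algebra_simps)
      then have "FF q (u * j) p = FF q j (- rep (u * p))" by (rule FF_cong[OF assms(1)])
      then show ?thesis by (simp add: FF_uminus)
    qed
  qed
  finally show ?thesis by (simp add: full_def)
qed

text \<open>A generating-function analogue of Ramanujan sums: it depends on s only up to units.\<close>
definition ramanujan_fps :: "nat \<Rightarrow> nat \<Rightarrow> int \<Rightarrow> complex fps" where
  "ramanujan_fps q W s = (\<Sum>j<q. fps_const (sig q (int j) s) * inverse (full q W (int j)))"

lemma sig_cong: "q > 0 \<Longrightarrow> int q dvd j * s - j' * s' \<Longrightarrow> sig q j s = sig q j' s'"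
  using gam_cong[of q "j * s" "j' * s'"] gam_cong[of q "- (j * s)" "- (j' * s')"]
    dvd_minus_iff[of "int q" "j * s - j' * s'"] by (simp add: sig_def)

lemma ramanujan_fps_cong: "q > 0 \<Longrightarrow> int q dvd s - s' \<Longrightarrow> ramanujan_fps q W s = ramanujan_fps q W s'"
  unfolding ramanujan_fps_def
  by (intro sum.cong refl arg_cong2[where f="(*)"] arg_cong[where f=fps_const] sig_cong)
    (auto simp flip: right_diff_distrib)

lemma ramanujan_fps_uminus: "ramanujan_fps q W (- s) = ramanujan_fps q W s"
  by (simp add: ramanujan_fps_def sig_def add.commute)

text \<open>Summation over j is replaced by summation over u j modulo q: \<open>full\<close> does
  not notice the unit, and in \<open>sig\<close> it passes to s.\<close>

lemma ramanujan_fps_unit: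
  assumes "q > 0" "coprime u (int q)"
  shows "ramanujan_fps q W (u * s) = ramanujan_fps q W s"
proof -
  define m where "m j = nat ((u * int j) mod int q)" for j :: nat
  have m: "int (m j) = (u * int j) mod int q" for j using assms(1) by (simp add: m_def)
  have md: "int q dvd int (m j) - u * int j" for j
    unfolding m by (metis dvd_minus_mod dvd_minus_iff minus_diff_eq)
  have inj: "inj_on m {..<q}"
  proof (rule inj_onI)
    fix i j assume ij: "i \<in> {..<q}" "j \<in> {..<q}" "m i = m j"
    have "int q dvd (int (m j) - u * int j) - (int (m i) - u * int i)" by (intro dvd_diff md)
    then have "int q dvd u * (int i - int j)" using ij(3) by (simp add: algebra_simps)
    then have "int q dvd int i - int j"
      using assms(2) by (simp add: coprime_dvd_mult_right_iff coprime_commute)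
    then have "int i - int j = 0 \<or> int q \<le> \<bar>int i - int j\<bar>" using dvd_imp_le_int[of "int i - int j" "int q"] by auto
    then show "i = j" using ij(1,2) by auto
  qed
  have "m ` {..<q} = {..<q}"
  proof (rule endo_inj_surj[OF _ _ inj])
    show "m ` {..<q} \<subseteq> {..<q}"
    proof
      fix y assume "y \<in> m ` {..<q}"
      then obtain j where "y = m j" by blast
      then have "int y < int q" using m[of j] assms(1) by simp
      then show "y \<in> {..<q}" by simp
    qed
  qed simp
  then have "ramanujan_fps q W s = (\<Sum>j<q. fps_const (sig q (int (m j)) s) * inverse (full q W (int (m j))))"
    unfolding ramanujan_fps_def using sum.reindex[OF inj, of "\<lambda>j. fps_const (sig q (int j) s) * inverse (full q W (int j))"]
    by simp
  also have "\<dots> = ramanujan_fps q W (u * s)"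
    unfolding ramanujan_fps_def
  proof (rule sum.cong[OF refl])
    fix j
    have "full q W (int (m j)) = full q W (u * int j)" by (rule full_cong[OF assms(1) md])
    then have "full q W (int (m j)) = full q W (int j)" by (simp add: full_unit[OF assms])
    moreover have "int q dvd (int (m j) - u * int j) * s" using md by (rule dvd_mult2)
    then have "sig q (int (m j)) s = sig q (int j) (u * s)"
      by (intro sig_cong[OF assms(1)]) (simp add: algebra_simps)
    ultimately show "fps_const (sig q (int (m j)) s) * inverse (full q W (int (m j))) =
        fps_const (sig q (int j) (u * s)) * inverse (full q W (int j))" by simp
  qed
  finally show ?thesis by simp
qed

lemma ramanujan_fps_coprime: "q > 0 \<Longrightarrow> coprime s (int q) \<Longrightarrow> ramanujan_fps q W s = ramanujan_fps q W 1"
  using ramanujan_fps_unit[of q s W 1] by simp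

section \<open>Isospectrality of the complementary spaces\<close>

definition complement_weights :: "nat \<Rightarrow> int \<Rightarrow> int list" where
  "complement_weights q a = filter (\<lambda>p. p \<noteq> 1 \<and> p \<noteq> a) [1..int (q div 2)]"

lemma set_complement_weights: "set (complement_weights q a) = {1..int (q div 2)} - {1, a}"
  by (auto simp: complement_weights_def)

lemma length_complement_weights:
  assumes "a \<in> {2..int (q div 2)}"
  shows "length (complement_weights q a) = q div 2 - 2"
proof -
  have "length (complement_weights q a) = card (set (complement_weights q a))"
    unfolding complement_weights_def by (rule distinct_card[symmetric]) simp
  also have "\<dots> = card {1..int (q div 2)} - card {1, a}"
    unfolding set_complement_weights using assms by (intro card_Diff_subset) auto
  also have "\<dots> = q div 2 - 2" using assms by simp
  finally show ?thesis .
qed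

lemma prod_lens_weight:
  "(\<Prod>l<2 * length ps + W. 1 - fps_const (gam q (j * lens_weight ps l)) * fps_X) =
     (\<Prod>p\<leftarrow>ps. FF q j p) * (1 - fps_X) ^ W"
proof -
  let ?f = "\<lambda>l. 1 - fps_const (gam q (j * lens_weight ps l)) * fps_X"
  have "(\<Prod>l<2 * length ps + W. ?f l) = (\<Prod>l<2 * length ps. ?f l) * (1 - fps_X) ^ W"
    by (induction W) (simp_all add: lens_weight_def mult_ac)
  moreover have "(\<Prod>l<2 * m. ?f l) = (\<Prod>i<m. FF q j (ps ! i))" if "m \<le> length ps" for m
    using that by (induction m) (simp_all add: lens_weight_def FF_def mult_ac)
  moreover have "(\<Prod>i<length ps. FF q j (ps ! i)) = (\<Prod>p\<leftarrow>ps. FF q j p)"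
    by (simp add: prod.list_conv_set_nth atLeast0LessThan)
  ultimately show ?thesis by simp
qed

text \<open>The two missing factors complete the denominator of \<open>hser\<close> to
  \<open>full\<close>.\<close>

lemma hser_complement_weights:
  assumes a: "a \<in> {2..int (q div 2)}"
  shows "hser (2 * length (complement_weights q a) + W) (\<lambda>l. gam q (j * lens_weight (complement_weights q a) l)) =
     FF q j 1 * FF q j a * inverse (full q W j)"
proof -
  let ?H = "hser (2 * length (complement_weights q a) + W) (\<lambda>l. gam q (j * lens_weight (complement_weights q a) l))"
  have "(\<Prod>p\<leftarrow>complement_weights q a. FF q j p) = (\<Prod>p\<in>set (complement_weights q a). FF q j p)"
    by (rule prod.distinct_set_conv_list[symmetric]) (simp add: complement_weights_def)
  then have P: "(\<Prod>p\<leftarrow>complement_weights q a. FF q j p) = (\<Prod>p\<in>{1..int (q div 2)} - {1, a}. FF q j p)"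
    by (simp add: set_complement_weights)
  have "(\<Prod>p\<in>{1..int (q div 2)}. FF q j p) =
      (\<Prod>p\<in>{1..int (q div 2)} - {1, a}. FF q j p) * (\<Prod>p\<in>{1, a}. FF q j p)"
    by (rule prod.subset_diff) (use a in auto)
  also have "(\<Prod>p\<in>{1, a}. FF q j p) = FF q j 1 * FF q j a" using a by auto
  finally have "?H * full q W j = (?H * ((\<Prod>p\<leftarrow>complement_weights q a. FF q j p) * (1 - fps_X) ^ W)) * (FF q j 1 * FF q j a)"
    unfolding full_def P by (simp add: mult_ac)
  also have "\<dots> = FF q j 1 * FF q j a"
    unfolding prod_lens_weight[symmetric] hser_prod by simp
  finally have "?H * full q W j * inverse (full q W j) = FF q j 1 * FF q j a * inverse (full q W j)" by simp
  moreover have "full q W j * inverse (full q W j) = 1"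
    by (rule inverse_mult_eq_1') (simp add: full_nth_0)
  ultimately show ?thesis by (simp add: mult.assoc)
qed

text \<open>By \<open>FF_mult\<close> the sum over the group depends on a only through
  \<open>ramanujan_fps\<close> at a and through the sum of its values at 1 + a and 1 - a.\<close>

lemma isospectral_complement_weights:
  assumes q: "q > 0" and a: "a \<in> {2..int (q div 2)}" and b: "b \<in> {2..int (q div 2)}"
    and ne: "complement_weights q a \<noteq> []"
    and T1: "ramanujan_fps q W a = ramanujan_fps q W b"
    and T2: "ramanujan_fps q W (1 + a) + ramanujan_fps q W (1 - a) = ramanujan_fps q W (1 + b) + ramanujan_fps q W (1 - b)"
  shows "isospectral (q, complement_weights q a, W) (q, complement_weights q b, W)"
proof (rule isospectral_if_card_eq[OF q ne])
  show len: "length (complement_weights q a) = length (complement_weights q b)" using length_complement_weights[OF a] length_complement_weights[OF b] by simp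
  fix k
  have S: "(\<Sum>j<q. hser (2 * length (complement_weights q c) + W) (\<lambda>l. gam q (int j * lens_weight (complement_weights q c) l))) =
     (1 + 2 * fps_X\<^sup>2 + fps_X ^ 4) * (\<Sum>j<q. inverse (full q W (int j)))
     - (fps_X + fps_X ^ 3) * (ramanujan_fps q W 1 + ramanujan_fps q W c) + fps_X\<^sup>2 * (ramanujan_fps q W (1 + c) + ramanujan_fps q W (1 - c))"
    if c: "c \<in> {2..int (q div 2)}" for c
  proof -
    have e: "(A - B * (x + y) + C * (z + v)) * G = A * G - B * (x * G + y * G) + C * (z * G + v * G)"
      for A B C x y z v G :: "complex fps"
      by (simp add: algebra_simps)
    show ?thesis
      unfolding hser_complement_weights[OF c] FF_mult ramanujan_fps_def e
      by (simp only: sum.distrib sum_subtractf sum_distrib_left[symmetric])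
  qed
  have "(\<Sum>j<q. hser (2 * length (complement_weights q a) + W) (\<lambda>l. gam q (int j * lens_weight (complement_weights q a) l))) =
      (\<Sum>j<q. hser (2 * length (complement_weights q a) + W) (\<lambda>l. gam q (int j * lens_weight (complement_weights q b) l)))"
    using S[OF a] S[OF b] T1 T2 len by simp
  then have "of_nat q * (of_nat (card (II (2 * length (complement_weights q a) + W) (lens_weight (complement_weights q a)) q k)) :: complex) =
      of_nat q * of_nat (card (II (2 * length (complement_weights q a) + W) (lens_weight (complement_weights q b)) q k))"
    unfolding card_II[OF q] by (simp flip: fps_sum_nth)
  then show "card (II (2 * length (complement_weights q a) + W) (lens_weight (complement_weights q a)) q k) =
      card (II (2 * length (complement_weights q a) + W) (lens_weight (complement_weights q b)) q k)" using q by simp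
qed

section \<open>Isometries of quotients of the sphere\<close>

definition sc :: "real \<Rightarrow> pt \<Rightarrow> pt" where
  "sc c x = (\<lambda>i. c * x i)"

definition nrm :: "nat \<Rightarrow> pt \<Rightarrow> real" where
  "nrm N x = sqrt (nsq N x)"

lemma dot_commute: "dot N x y = dot N y x"
  by (simp add: dot_def mult.commute)

lemma dot_add: "dot N (x + y) z = dot N x z + dot N y z" "dot N z (x + y) = dot N z x + dot N z y"
  by (simp_all add: dot_def sum.distrib algebra_simps)

lemma dot_diff: "dot N (x - y) z = dot N x z - dot N y z" "dot N z (x - y) = dot N z x - dot N z y"
  by (simp_all add: dot_def sum_subtractf algebra_simps)

lemma dot_sc: "dot N (sc c x) z = c * dot N x z" "dot N z (sc c x) = c * dot N z x"
  by (simp_all add: dot_def sc_def sum_distrib_left algebra_simps)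

lemmas dot_simps = dot_add dot_diff dot_sc

lemma vecs_ops: "x \<in> vecs N \<Longrightarrow> y \<in> vecs N \<Longrightarrow> x + y \<in> vecs N"
  "x \<in> vecs N \<Longrightarrow> y \<in> vecs N \<Longrightarrow> x - y \<in> vecs N" "x \<in> vecs N \<Longrightarrow> sc c x \<in> vecs N"
  by (auto simp: vecs_def sc_def)

lemma sphere_vecs: "x \<in> sphere_pts N \<Longrightarrow> x \<in> vecs N"
  by (simp add: sphere_pts_iff)

lemma sphere_dot: "x \<in> sphere_pts N \<Longrightarrow> dot N x x = 1"
  by (simp add: sphere_pts_iff dot_self)

lemma vec_eqI:
  assumes "x \<in> vecs N" "y \<in> vecs N" "dot N (x - y) (x - y) = 0"
  shows "x = y"
proof -
  have "x - y = (\<lambda>_. 0)" using assms nsq_eq_0_iff[of "x - y" N] vecs_ops(2) by (simp add: dot_self)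
  then show ?thesis by (auto simp: fun_eq_iff)
qed

lemma sphere_eqI:
  assumes "x \<in> sphere_pts N" "y \<in> sphere_pts N" "dot N x y = 1"
  shows "x = y"
proof (rule vec_eqI[of _ N])
  show "dot N (x - y) (x - y) = 0" using assms by (simp add: dot_simps sphere_dot dot_commute[of N y x])
qed (use assms in \<open>auto simp: sphere_vecs\<close>)

lemma nrm_L2: "nrm N x = L2_set x {..<N}"
  by (simp add: nrm_def nsq_def L2_set_def)

lemma nrm_triangle: "nrm N (x + y) \<le> nrm N x + nrm N y"
  using L2_set_triangle_ineq[of x y "{..<N}"] by (simp add: nrm_L2 plus_fun_def)

lemma nrm_nonneg: "nrm N x \<ge> 0"
  by (simp add: nrm_def nsq_nonneg)

lemma nrm_sq: "(nrm N x)\<^sup>2 = dot N x x"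
  by (simp add: nrm_def nsq_nonneg dot_self)

lemma nrm_minus: "nrm N (x - y) = nrm N (y - x)"
  by (simp add: nrm_def nsq_def power2_commute)

lemma nrm_dist_triangle: "nrm N (x - z) \<le> nrm N (x - y) + nrm N (y - z)"
  using nrm_triangle[of N "x - y" "y - z"] by simp

lemma nrm_sphere: "x \<in> sphere_pts N \<Longrightarrow> nrm N x = 1"
  by (simp add: nrm_def sphere_pts_iff)

lemma dot_CS: "\<bar>dot N x y\<bar> \<le> nrm N x * nrm N y"
proof -
  have "\<bar>dot N x y\<bar> \<le> (\<Sum>i<N. \<bar>x i\<bar> * \<bar>y i\<bar>)"
    unfolding dot_def by (rule order_trans[OF sum_abs]) (simp add: abs_mult)
  also have "\<dots> \<le> nrm N x * nrm N y" unfolding nrm_L2 by (rule L2_set_mult_ineq)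
  finally show ?thesis .
qed

lemma dot_le_1: "x \<in> sphere_pts N \<Longrightarrow> y \<in> sphere_pts N \<Longrightarrow> \<bar>dot N x y\<bar> \<le> 1"
  using dot_CS[of N x y] by (simp add: nrm_sphere)

lemma sphere_dist: "x \<in> sphere_pts N \<Longrightarrow> y \<in> sphere_pts N \<Longrightarrow> (nrm N (x - y))\<^sup>2 = 2 - 2 * dot N x y"
  by (simp add: nrm_sq dot_simps sphere_dot dot_commute)

lemma proj_sc: "proj N x = sc (1 / nrm N x) x"
  by (simp add: proj_def sc_def nrm_def)

text \<open>The device for perturbing a point within the sphere: move off in a direction D and
  project back.\<close>

lemma proj_near:
  assumes u: "u \<in> sphere_pts N" and D: "D \<in> vecs N" and "r > 0"
  shows "\<forall>\<^sub>F t in at_right 0. u + sc t D \<in> punctured N \<and> nrm N (proj N (u + sc t D) - u) < r"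
proof -
  define p where "p t = 1 + 2 * t * dot N u D + t\<^sup>2 * dot N D D" for t
  have p: "nsq N (u + sc t D) = p t" for t
    unfolding dot_self[symmetric] dot_simps sphere_dot[OF u] dot_commute[of N D u] p_def
    by (simp add: power2_eq_square algebra_simps)
  have "(p \<longlongrightarrow> 1 + 2 * 0 * dot N u D + 0\<^sup>2 * dot N D D) (at_right 0)"
    unfolding p_def by (intro tendsto_add tendsto_mult tendsto_power tendsto_const tendsto_ident_at)
  then have p1: "(p \<longlongrightarrow> 1) (at_right 0)" by simp
  then have ev1: "\<forall>\<^sub>F t in at_right 0. p t > 0" by (intro order_tendstoD) auto
  have "((\<lambda>t. 2 - 2 * (1 / sqrt (p t) * (1 + t * dot N D u))) \<longlongrightarrow> 2 - 2 * (1 / sqrt 1 * (1 + 0 * dot N D u))) (at_right 0)"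
    by (intro tendsto_diff tendsto_mult tendsto_divide tendsto_real_sqrt tendsto_add tendsto_const tendsto_ident_at p1) simp
  then have "((\<lambda>t. 2 - 2 * (1 / sqrt (p t) * (1 + t * dot N D u))) \<longlongrightarrow> 0) (at_right 0)" by simp
  then have ev2: "\<forall>\<^sub>F t in at_right 0. 2 - 2 * (1 / sqrt (p t) * (1 + t * dot N D u)) < r\<^sup>2"
    using \<open>r > 0\<close> by (intro order_tendstoD) auto
  show ?thesis using ev1 ev2
  proof eventually_elim
    case (elim t)
    have pu: "u + sc t D \<in> punctured N"
      using elim(1) p u D by (simp add: punctured_iff vecs_ops sphere_vecs)
    have "dot N (proj N (u + sc t D)) u = 1 / sqrt (p t) * (1 + t * dot N D u)"
      unfolding proj_sc dot_simps nrm_def p sphere_dot[OF u] ..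
    then have "(nrm N (proj N (u + sc t D) - u))\<^sup>2 < r\<^sup>2"
      using elim(2) sphere_dist[OF proj_sphere[OF pu] u] by simp
    then have "nrm N (proj N (u + sc t D) - u) < r"
      using power2_less_imp_less[of "nrm N (proj N (u + sc t D) - u)" r] \<open>r > 0\<close> by linarith
    then show ?case using pu by simp
  qed
qed

definition unitv :: "nat \<Rightarrow> pt" where
  "unitv i = (\<lambda>j. if j = i then 1 else 0)"

lemma unitv_vecs: "i < N \<Longrightarrow> unitv i \<in> vecs N"
  by (auto simp: unitv_def vecs_def)

lemma dot_unitv: "i < N \<Longrightarrow> dot N x (unitv i) = x i" "i < N \<Longrightarrow> dot N (unitv i) x = x i"
  by (simp_all add: dot_def unitv_def if_distrib if_distribR cong: if_cong)

definition lincomb :: "nat \<Rightarrow> (nat \<Rightarrow> pt) \<Rightarrow> pt \<Rightarrow> pt" where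
  "lincomb N a x = (\<lambda>j. \<Sum>i<N. x i * a i j)"

lemma dot_lincomb: "dot N (lincomb N a x) z = (\<Sum>i<N. x i * dot N (a i) z)"
  unfolding dot_def lincomb_def sum_distrib_right sum_distrib_left
  by (subst sum.swap) (simp add: mult.assoc)

lemma lincomb_add: "lincomb N a (x + y) = lincomb N a x + lincomb N a y"
  by (simp add: lincomb_def fun_eq_iff sum.distrib algebra_simps)

lemma lincomb_sc: "lincomb N a (sc c x) = sc c (lincomb N a x)"
  by (simp add: lincomb_def sc_def sum_distrib_left mult.assoc)

lemma dot_lincomb_orthonormal:
  assumes "\<And>i j. i < N \<Longrightarrow> j < N \<Longrightarrow> dot N (a i) (a j) = (if i = j then 1 else 0)"
  shows "dot N (lincomb N a x) (lincomb N a y) = dot N x y"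
proof -
  have "dot N (a i) (lincomb N a y) = y i" if i: "i < N" for i
  proof -
    have "dot N (a i) (lincomb N a y) = (\<Sum>k<N. y k * dot N (a k) (a i))"
      unfolding dot_commute[of N "a i"] dot_lincomb ..
    also have "\<dots> = (\<Sum>k<N. if k = i then y k else 0)"
    proof (rule sum.cong[OF refl])
      fix k assume "k \<in> {..<N}"
      then show "y k * dot N (a k) (a i) = (if k = i then y k else 0)"
        using assms[of k i] i by simp
    qed
    finally show ?thesis using i by simp
  qed
  then show ?thesis unfolding dot_lincomb[of N a x] by (simp add: dot_def)
qed

lemma sc_proj: "v \<in> punctured N \<Longrightarrow> sc (nrm N v) (proj N v) = v"
  using nsq_pos[of v N] by (simp add: sc_def proj_def nrm_def)

text \<open>The linear map is found by difference quotients at \<open>u\<close> along the coordinate directions.\<close>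
lemma local_isometry_linear:
  assumes u: "u \<in> sphere_pts N" and "r > 0"
    and S: "\<And>x. x \<in> sphere_pts N \<Longrightarrow> nrm N (x - u) < r \<Longrightarrow> F x \<in> sphere_pts N"
    and iso: "\<And>x y. x \<in> sphere_pts N \<Longrightarrow> nrm N (x - u) < r \<Longrightarrow> y \<in> sphere_pts N \<Longrightarrow> nrm N (y - u) < r
       \<Longrightarrow> dot N (F x) (F y) = dot N x y"
  obtains a where "\<And>i. i < N \<Longrightarrow> a i \<in> vecs N"
    "\<And>i j. i < N \<Longrightarrow> j < N \<Longrightarrow> dot N (a i) (a j) = (if i = j then 1 else 0)"
    "\<And>x. x \<in> sphere_pts N \<Longrightarrow> nrm N (x - u) < r \<Longrightarrow> F x = lincomb N a x"
proof -
  have "\<forall>\<^sub>F t in at_right 0. \<forall>i\<in>{..<N}. u + sc t (unitv i) \<in> punctured N \<and> nrm N (proj N (u + sc t (unitv i)) - u) < r"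
    by (intro eventually_ball_finite ballI proj_near u unitv_vecs \<open>r > 0\<close>) auto
  from eventually_conj[OF eventually_at_right_less this]
  have "\<exists>t>0. \<forall>i\<in>{..<N}. u + sc t (unitv i) \<in> punctured N \<and> nrm N (proj N (u + sc t (unitv i)) - u) < r"
    by (rule eventually_happens'[rotated]) simp
  then obtain t where t: "t > 0" "\<And>i. i < N \<Longrightarrow> u + sc t (unitv i) \<in> punctured N"
      "\<And>i. i < N \<Longrightarrow> nrm N (proj N (u + sc t (unitv i)) - u) < r"
    by blast
  \<comment> \<open>A point of the sphere near u, displaced in the i-th coordinate
    direction.\<close>
  define w where "w i = proj N (u + sc t (unitv i))" for i
  define s where "s i = nrm N (u + sc t (unitv i))" for i
  have sp: "s i > 0" if "i < N" for i using t(2)[OF that] by (simp add: s_def nrm_def punctured_iff)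
  have sw: "sc (s i) (w i) = u + sc t (unitv i)" if "i < N" for i
    unfolding w_def s_def by (rule sc_proj[OF t(2)[OF that]])
  have wS: "w i \<in> sphere_pts N" "nrm N (w i - u) < r" if "i < N" for i
    using proj_sphere[OF t(2)[OF that]] t(3)[OF that] by (auto simp: w_def)
  have uu: "nrm N (u - u) < r" using \<open>r > 0\<close> by (simp add: nrm_def nsq_def)
  \<comment> \<open>Difference quotient of the 1-homogeneous extension of F between
    \<open>u + sc t (unitv i)\<close> and u. No limit is taken: inner products with values of F
    already come out exactly.\<close>
  define a where "a i = sc (1 / t) (sc (s i) (F (w i)) - F u)" for i
  have av: "a i \<in> vecs N" if "i < N" for i
    unfolding a_def by (intro vecs_ops sphere_vecs S wS u uu that)
  have Fa: "dot N (F x) (a i) = x i" if x: "x \<in> sphere_pts N" "nrm N (x - u) < r" and i: "i < N" for x i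
  proof -
    have "dot N (F x) (a i) = 1 / t * (s i * dot N x (w i) - dot N x u)"
      by (simp add: a_def dot_simps iso[OF x wS[OF i]] iso[OF x u uu])
    also have "s i * dot N x (w i) = dot N x (u + sc t (unitv i))"
      unfolding sw[OF i, symmetric] dot_sc ..
    finally show ?thesis using t(1) i by (simp add: dot_simps dot_unitv)
  qed
  have aa: "dot N (a i) (a j) = (if i = j then 1 else 0)" if ij: "i < N" "j < N" for i j
  proof -
    have "dot N (a i) (a j) = 1 / t * (s i * dot N (F (w i)) (a j) - dot N (F u) (a j))"
      by (simp only: a_def[of i] dot_simps)
    also have "\<dots> = 1 / t * (s i * w i j - u j)"
      by (simp add: Fa[OF wS[OF ij(1)] ij(2)] Fa[OF u uu ij(2)])
    also have "s i * w i j = u j + t * unitv i j"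
      using fun_cong[OF sw[OF ij(1)], of j] by (simp add: sc_def)
    finally show ?thesis using t(1) by (simp add: unitv_def)
  qed
  have Fl: "F x = lincomb N a x" if x: "x \<in> sphere_pts N" "nrm N (x - u) < r" for x
  proof (rule vec_eqI)
    show "F x \<in> vecs N" using S[OF x] by (rule sphere_vecs)
    show "lincomb N a x \<in> vecs N" unfolding lincomb_def vecs_def
    proof (intro CollectI allI impI sum.neutral ballI)
      fix j i assume "N \<le> j" "i \<in> {..<N}"
      then show "x i * a i j = 0" using av[of i] by (simp add: vecs_def)
    qed
    have 1: "dot N (lincomb N a x) (F x) = 1"
    proof -
      have "dot N (lincomb N a x) (F x) = (\<Sum>i<N. x i * x i)"
        unfolding dot_lincomb by (rule sum.cong) (simp_all add: dot_commute[of N "a _"] Fa[OF x])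
      then show ?thesis using sphere_dot[OF x(1)] by (simp add: dot_def)
    qed
    have 2: "dot N (lincomb N a x) (lincomb N a x) = 1"
    proof -
      have "dot N (lincomb N a x) (lincomb N a x) = dot N x x"
        by (rule dot_lincomb_orthonormal) (rule aa)
      then show ?thesis using sphere_dot[OF x(1)] by simp
    qed
    show "dot N (F x - lincomb N a x) (F x - lincomb N a x) = 0"
      using 1 2 sphere_dot[OF S[OF x]] dot_commute[of N "F x" "lincomb N a x"] by (simp add: dot_simps)
  qed
  show ?thesis by (rule that[OF av aa Fl])
qed

section \<open>Finite cyclic groups of linear isometries\<close>

locale isom_cyclic =
  fixes N q :: nat and g :: "int \<Rightarrow> pt \<Rightarrow> pt"
  assumes q_pos: "q > 0"
    and g_vecs: "x \<in> vecs N \<Longrightarrow> g k x \<in> vecs N"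
    and g_dot: "dot N (g k x) (g k y) = dot N x y"
    and g_plus: "x \<in> vecs N \<Longrightarrow> g (i + j) x = g i (g j x)"
    and g_linear: "g k (x + y) = g k x + g k y" "g k (sc c x) = sc c (g k x)"
    and g_period: "x \<in> vecs N \<Longrightarrow> int q dvd i - j \<Longrightarrow> g i x = g j x"
    and g_zero: "x \<in> vecs N \<Longrightarrow> g 0 x = x"
begin

text \<open>The cosine of the orbit distance, see \<open>orbit_dist_MX\<close>.\<close>

definition MX :: "pt \<Rightarrow> pt \<Rightarrow> real" where
  "MX x y = Max ((\<lambda>k. dot N x (g (int k) y)) ` {..<q})"

lemma g_sphere: "x \<in> sphere_pts N \<Longrightarrow> g k x \<in> sphere_pts N"
  using g_vecs g_dot[of k x x] by (simp add: sphere_pts_iff dot_self)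

lemma g_inv: "x \<in> vecs N \<Longrightarrow> g (- k) (g k x) = x"
  using g_plus[of x "- k" k] g_zero by simp

lemma g_adjoint: "x \<in> vecs N \<Longrightarrow> dot N (g k x) y = dot N x (g (- k) y)"
  using g_dot[of "- k" "g k x" y] by (simp add: g_inv)

lemma g_mod: "y \<in> vecs N \<Longrightarrow> g (int (nat (k mod int q))) y = g k y"
  using q_pos by (intro g_period) (auto simp: dvd_diff_commute dvd_minus_mod)

lemma MX_ge: "y \<in> vecs N \<Longrightarrow> dot N x (g k y) \<le> MX x y"
proof -
  assume y: "y \<in> vecs N"
  have "nat (k mod int q) \<in> {..<q}" using q_pos by (simp add: nat_less_iff)
  then have "dot N x (g (int (nat (k mod int q))) y) \<le> MX x y"
    unfolding MX_def
    by (intro Max_ge finite_imageI finite_lessThan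
        imageI[of "nat (k mod int q)" "{..<q}" "\<lambda>k. dot N x (g (int k) y)"])
  then show ?thesis using g_mod[OF y] by simp
qed

lemma MX_attained: "\<exists>k. MX x y = dot N x (g k y)"
proof -
  have "MX x y \<in> (\<lambda>k. dot N x (g (int k) y)) ` {..<q}"
    unfolding MX_def using q_pos by (intro Max_in) auto
  then show ?thesis by auto
qed

lemma MX_eqI:
  assumes "y \<in> vecs N" "\<And>k. dot N x (g k y) \<le> c" "dot N x (g k y) = c"
  shows "MX x y = c"
proof (rule antisym)
  obtain j where "MX x y = dot N x (g j y)" using MX_attained by blast
  then show "MX x y \<le> c" using assms(2)[of j] by simp
  show "c \<le> MX x y" using MX_ge[OF assms(1), of x k] assms(3) by simp
qed

lemma MX_left: "x \<in> vecs N \<Longrightarrow> y \<in> vecs N \<Longrightarrow> MX (g k x) y = MX x y"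
proof -
  assume x: "x \<in> vecs N" and y: "y \<in> vecs N"
  have e: "dot N (g k x) (g j y) = dot N x (g (j - k) y)" for j
    using g_adjoint[OF x, of k "g j y"] g_plus[OF y, of "- k" j] by simp
  obtain j where j: "MX x y = dot N x (g j y)" using MX_attained by blast
  show ?thesis
    by (rule MX_eqI[OF y, where k="j + k"]) (simp_all add: e j[symmetric] MX_ge[OF y])
qed

lemma MX_right: "x \<in> vecs N \<Longrightarrow> y \<in> vecs N \<Longrightarrow> MX x (g k y) = MX x y"
proof -
  assume x: "x \<in> vecs N" and y: "y \<in> vecs N"
  have e: "dot N x (g j (g k y)) = dot N x (g (j + k) y)" for j
    by (simp add: g_plus[OF y])
  obtain j where j: "MX x y = dot N x (g j y)" using MX_attained by blast
  show ?thesis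
    by (rule MX_eqI[OF g_vecs[OF y], where k="j - k"]) (simp_all add: e j[symmetric] MX_ge[OF y])
qed

lemma MX_1: "x \<in> sphere_pts N \<Longrightarrow> y \<in> sphere_pts N \<Longrightarrow> MX x y = 1 \<Longrightarrow> \<exists>k. x = g k y"
proof -
  assume xy: "x \<in> sphere_pts N" "y \<in> sphere_pts N" "MX x y = 1"
  obtain k where "MX x y = dot N x (g k y)" using MX_attained by blast
  then have "x = g k y" using xy by (intro sphere_eqI[OF xy(1) g_sphere[OF xy(2)]]) simp
  then show ?thesis by blast
qed

lemma MX_self: "x \<in> sphere_pts N \<Longrightarrow> MX x (g k x) = 1"
proof -
  assume x: "x \<in> sphere_pts N"
  have xv: "x \<in> vecs N" using x by (rule sphere_vecs)
  have "MX x x = 1"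
  proof (rule MX_eqI[OF xv, where k=0])
    show "dot N x (g k x) \<le> 1" for k using dot_le_1[OF x g_sphere[OF x], of k] by simp
    show "dot N x (g 0 x) = 1" using x xv by (simp add: g_zero sphere_dot)
  qed
  then show ?thesis by (simp add: MX_right xv)
qed

lemma g_diff: "g k (x - y) = g k x - g k y"
proof -
  have e: "x - y = x + sc (- 1) y" for x y by (simp add: fun_eq_iff sc_def)
  show ?thesis unfolding e by (simp only: g_linear)
qed

lemma dot_g_lipschitz:
  assumes "x \<in> sphere_pts N" "x' \<in> sphere_pts N" "y \<in> sphere_pts N" "y' \<in> sphere_pts N"
  shows "dot N x (g k y) \<le> dot N x' (g k y') + nrm N (x - x') + nrm N (y - y')"
proof -
  have 1: "dot N x (g k y) - dot N x' (g k y') = dot N (x - x') (g k y) + dot N x' (g k (y - y'))"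
    by (simp only: g_diff dot_simps)
  have 2: "dot N (x - x') (g k y) \<le> nrm N (x - x')"
    using dot_CS[of N "x - x'" "g k y"] nrm_sphere[OF g_sphere[OF assms(3), of k]] by simp
  have "nrm N (g k (y - y')) = nrm N (y - y')"
    using g_dot[of k "y - y'" "y - y'"] by (simp only: nrm_def dot_self)
  then have 3: "dot N x' (g k (y - y')) \<le> nrm N (y - y')"
    using dot_CS[of N x' "g k (y - y')"] nrm_sphere[OF assms(2)] by simp
  show ?thesis using 1 2 3 by linarith
qed

lemma free_gap:
  assumes u: "u \<in> sphere_pts N" and free: "\<And>k. \<not> int q dvd k \<Longrightarrow> g k u \<noteq> u"
  obtains m where "m > 0" "\<And>k. \<not> int q dvd k \<Longrightarrow> dot N u (g k u) \<le> 1 - m"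
proof -
  \<comment> \<open>The entry -1 keeps the set nonempty when q = 1.\<close>
  define A where "A = insert (-1) ((\<lambda>k. dot N u (g (int k) u)) ` {1..<q})"
  have fin: "finite A" "A \<noteq> {}" by (auto simp: A_def)
  have lt: "Max A < 1"
  proof (subst Max_less_iff[OF fin], intro ballI)
    fix c assume "c \<in> A"
    then consider "c = -1" | k where "k \<in> {1..<q}" "c = dot N u (g (int k) u)" by (auto simp: A_def)
    then show "c < 1"
    proof cases
      case 2
      have "\<not> int q dvd int k" using 2(1) by (auto dest: dvd_imp_le)
      then have "g (int k) u \<noteq> u" by (rule free)
      then have "dot N u (g (int k) u) \<noteq> 1" using sphere_eqI[OF u g_sphere[OF u], of "int k"] by auto
      then show ?thesis using dot_le_1[OF u g_sphere[OF u], of "int k"] 2(2) by simp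
    qed simp
  qed
  have "dot N u (g k u) \<le> 1 - (1 - Max A)" if "\<not> int q dvd k" for k
  proof -
    have "k mod int q \<noteq> 0" "0 \<le> k mod int q" "k mod int q < int q" using that q_pos by (auto simp: dvd_eq_mod_eq_0)
    then have "nat (k mod int q) \<in> {1..<q}" by auto
    then have "dot N u (g (int (nat (k mod int q))) u) \<in> A" unfolding A_def by blast
    then show ?thesis using Max_ge[OF fin(1)] g_mod[OF sphere_vecs[OF u], of k] by simp
  qed
  then show ?thesis using that[of "1 - Max A"] lt by simp
qed

text \<open>Close to a point with trivial stabilizer no nontrivial group element brings y nearer to
  x, so distances of orbits are distances on the sphere.\<close>

lemma MX_near:
  assumes u: "u \<in> sphere_pts N" and m: "m > 0" "\<And>k. \<not> int q dvd k \<Longrightarrow> dot N u (g k u) \<le> 1 - m"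
    and x: "x \<in> sphere_pts N" "nrm N (x - u) < m / 8" and y: "y \<in> sphere_pts N" "nrm N (y - u) < m / 8"
    and m2: "m \<le> 2"
  shows "MX x y = dot N x y"
proof (rule MX_eqI[OF sphere_vecs[OF y(1)], where k=0])
  show "dot N x (g 0 y) = dot N x y" using y by (simp add: g_zero sphere_vecs)
  fix k
  show "dot N x (g k y) \<le> dot N x y"
  proof (cases "int q dvd k")
    case True
    then show ?thesis using g_period[of y k 0] y by (simp add: sphere_vecs g_zero)
  next
    case False
    have "dot N x (g k y) \<le> dot N u (g k u) + nrm N (x - u) + nrm N (y - u)"
      by (rule dot_g_lipschitz[OF x(1) u y(1) u])
    also have "\<dots> \<le> 1 - m + m / 8 + m / 8" using m(2)[OF False] x(2) y(2) by simp
    finally have 1: "dot N x (g k y) \<le> 1 - 3 / 4 * m" by simp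
    have "nrm N (x - y) \<le> m / 4"
      using nrm_dist_triangle[of N x y u] x(2) y(2) nrm_minus[of N u y] by simp
    then have "(nrm N (x - y))\<^sup>2 \<le> (m / 4)\<^sup>2" by (rule power_mono) (rule nrm_nonneg)
    \<comment> \<open>Since m is at most 2, the loss m^2 / 32 is at most m / 16, well below the 3 m
      / 4 lost by any nontrivial element.\<close>
    then have "dot N x y \<ge> 1 - m\<^sup>2 / 32" using sphere_dist[OF x(1) y(1)] by (simp add: power_divide)
    moreover have "m\<^sup>2 \<le> 2 * m" using m(1) m2 by (simp add: power2_eq_square)
    ultimately show ?thesis using 1 m(1) by simp
  qed
qed

end

section \<open>Lifting an isometry of the quotients to a linear map\<close>

lemma linear_expand:
  fixes L :: "pt \<Rightarrow> pt"
  assumes add: "\<And>x y. L (x + y) = L x + L y" and scale: "\<And>c x. L (sc c x) = sc c (L x)"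
    and x: "x \<in> vecs N"
  shows "L x j = (\<Sum>i<N. x i * L (unitv i) j)"
proof -
  have "L (\<lambda>i. if i < k then x i else 0) j = (\<Sum>i<k. x i * L (unitv i) j)" for k
  proof (induction k)
    case 0
    have "(\<lambda>i. if i < 0 then x i else 0) = sc 0 (\<lambda>i::nat. 0)" by (simp add: sc_def fun_eq_iff)
    then have "L (\<lambda>i. if i < 0 then x i else 0) = sc 0 (L (\<lambda>i. 0))" by (simp only: scale)
    then show ?case by (simp add: sc_def)
  next
    case (Suc k)
    have "(\<lambda>i. if i < Suc k then x i else 0) = (\<lambda>i. if i < k then x i else 0) + sc (x k) (unitv k)"
      by (auto simp: sc_def unitv_def fun_eq_iff less_Suc_eq)
    then have "L (\<lambda>i. if i < Suc k then x i else 0) = L (\<lambda>i. if i < k then x i else 0) + sc (x k) (L (unitv k))"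
      by (simp only: add scale)
    then show ?case using Suc by (simp add: sc_def)
  qed
  moreover have "(\<lambda>i. if i < N then x i else 0) = x" using x by (auto simp: vecs_def fun_eq_iff)
  ultimately show ?thesis by metis
qed

lemma eventually_linear_pos:
  fixes a b :: real
  assumes "a \<ge> 0" "a = 0 \<Longrightarrow> b > 0"
  shows "\<forall>\<^sub>F t in at_right 0. a + t * b > 0"
proof (cases "a = 0")
  case True
  have "\<forall>\<^sub>F t in at_right (0::real). t > 0" by (rule eventually_at_right_less)
  then show ?thesis by eventually_elim (use True assms(2) in simp)
next
  case False
  have "((\<lambda>t. a + t * b) \<longlongrightarrow> a + 0 * b) (at_right 0)"
    by (intro tendsto_add tendsto_mult tendsto_const tendsto_ident_at)
  then show ?thesis using False assms(1) by (intro order_tendstoD) auto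
qed

text \<open>\<open>\<Phi>\<close> only chooses representatives of orbits: it need be neither
  continuous nor equivariant, and all that is known about it is invariant under h.\<close>

locale quotient_isometry = G: isom_cyclic N q g + H: isom_cyclic N q h
  for N q :: nat and g h :: "int \<Rightarrow> pt \<Rightarrow> pt" +
  fixes \<Phi> :: "pt \<Rightarrow> pt"
  assumes Phi_sphere: "x \<in> sphere_pts N \<Longrightarrow> \<Phi> x \<in> sphere_pts N"
    and Phi_MX: "x \<in> sphere_pts N \<Longrightarrow> y \<in> sphere_pts N \<Longrightarrow> H.MX (\<Phi> x) (\<Phi> y) = G.MX x y"
    and Phi_surj: "z \<in> sphere_pts N \<Longrightarrow> \<exists>x\<in>sphere_pts N. H.MX (\<Phi> x) z = 1"
begin

text \<open>A point v with trivial stabilizer is taken near \<open>\<Phi> e\<close> and pulled back: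
  some u near e has \<open>\<Phi> u\<close> in the orbit of v. As the group is commutative, all
  points of an orbit have the same stabilizer.\<close>

lemma free_image_near:
  assumes e: "e \<in> sphere_pts N" and "d > 0"
    and dense: "\<And>v d. v \<in> sphere_pts N \<Longrightarrow> d > 0 \<Longrightarrow>
      \<exists>v'\<in>sphere_pts N. dot N v' v > 1 - d \<and> (\<forall>k. \<not> int q dvd k \<longrightarrow> h k v' \<noteq> v')"
  shows "\<exists>u\<in>sphere_pts N. dot N u e > 1 - d \<and> (\<forall>k. \<not> int q dvd k \<longrightarrow> h k (\<Phi> u) \<noteq> \<Phi> u)"
proof -
  obtain v where v: "v \<in> sphere_pts N" "dot N v (\<Phi> e) > 1 - d" "\<And>k. \<not> int q dvd k \<Longrightarrow> h k v \<noteq> v"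
    using dense[OF Phi_sphere[OF e] \<open>d > 0\<close>] by blast
  obtain u1 where u1: "u1 \<in> sphere_pts N" "H.MX (\<Phi> u1) v = 1" using Phi_surj[OF v(1)] by blast
  obtain k1 where k1: "\<Phi> u1 = h k1 v" using H.MX_1[OF Phi_sphere[OF u1(1)] v(1) u1(2)] by blast
  have vv: "v \<in> vecs N" "\<Phi> e \<in> vecs N" "e \<in> vecs N" "u1 \<in> vecs N"
    using sphere_vecs v(1) Phi_sphere[OF e] e u1(1) by auto
  have "1 - d < dot N v (h 0 (\<Phi> e))" using v(2) H.g_zero[OF vv(2)] by simp
  also have "\<dots> \<le> H.MX v (\<Phi> e)" by (rule H.MX_ge[OF vv(2)])
  also have "\<dots> = H.MX (\<Phi> u1) (\<Phi> e)" unfolding k1 by (rule H.MX_left[OF vv(1,2), symmetric])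
  also have "\<dots> = G.MX u1 e" by (rule Phi_MX[OF u1(1) e])
  finally have gt: "1 - d < G.MX u1 e" .
  obtain j where j: "G.MX u1 e = dot N u1 (g j e)" using G.MX_attained by blast
  define u where "u = g (- j) u1"
  have uS: "u \<in> sphere_pts N" unfolding u_def by (rule G.g_sphere[OF u1(1)])
  have "dot N u e = dot N u1 (g j e)" unfolding u_def using G.g_adjoint[OF vv(4), of "- j" e] by simp
  then have ue: "dot N u e > 1 - d" using gt j by simp
  have "H.MX (\<Phi> u1) (\<Phi> u) = 1"
    unfolding Phi_MX[OF u1(1) uS] unfolding u_def by (rule G.MX_self[OF u1(1)])
  then obtain k2 where k2: "\<Phi> u1 = h k2 (\<Phi> u)" using H.MX_1[OF Phi_sphere[OF u1(1)] Phi_sphere[OF uS]] by blast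
  have pv: "\<Phi> u \<in> vecs N" using sphere_vecs[OF Phi_sphere[OF uS]] .
  have "h k (\<Phi> u) \<noteq> \<Phi> u" if k: "\<not> int q dvd k" for k
  proof
    assume fx: "h k (\<Phi> u) = \<Phi> u"
    have vu: "v = h (k2 - k1) (\<Phi> u)"
    proof -
      have "v = h (- k1) (\<Phi> u1)" unfolding k1 by (rule H.g_inv[OF vv(1), symmetric])
      also have "\<dots> = h (- k1 + k2) (\<Phi> u)" unfolding k2 by (rule H.g_plus[OF pv, symmetric])
      finally show ?thesis by simp
    qed
    have "h k v = h (k + (k2 - k1)) (\<Phi> u)" unfolding vu by (rule H.g_plus[OF pv, symmetric])
    also have "\<dots> = h ((k2 - k1) + k) (\<Phi> u)" by (simp add: add.commute)
    also have "\<dots> = v" unfolding H.g_plus[OF pv] fx vu ..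
    finally show False using v(3)[OF k] by simp
  qed
  then show ?thesis using uS ue by blast
qed

text \<open>In the orbit of \<open>\<Phi> x\<close> a representative at the right distance from
  \<open>\<Phi> u\<close> is chosen. Near \<open>\<Phi> u\<close> orbit distances are distances on
  the sphere, so the choice preserves inner products and \<open>local_isometry_linear\<close>
  applies.\<close>

lemma local_lift:
  assumes u: "u \<in> sphere_pts N" and gf: "\<And>k. \<not> int q dvd k \<Longrightarrow> g k u \<noteq> u"
    and hf: "\<And>k. \<not> int q dvd k \<Longrightarrow> h k (\<Phi> u) \<noteq> \<Phi> u"
  obtains r a where "r > 0" "\<And>i. i < N \<Longrightarrow> a i \<in> vecs N"
    "\<And>i j. i < N \<Longrightarrow> j < N \<Longrightarrow> dot N (a i) (a j) = (if i = j then 1 else 0)"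
    "\<And>x. x \<in> sphere_pts N \<Longrightarrow> nrm N (x - u) < r \<Longrightarrow> \<exists>k. lincomb N a x = h k (\<Phi> x)"
proof -
  let ?v = "\<Phi> u"
  have vS: "?v \<in> sphere_pts N" by (rule Phi_sphere[OF u])
  obtain m1 where m1: "m1 > 0" "\<And>k. \<not> int q dvd k \<Longrightarrow> dot N u (g k u) \<le> 1 - m1"
    using G.free_gap[OF u gf] by blast
  obtain m2 where m2: "m2 > 0" "\<And>k. \<not> int q dvd k \<Longrightarrow> dot N ?v (h k ?v) \<le> 1 - m2"
    using H.free_gap[OF vS hf] by blast
  define m where "m = min (min m1 m2) 2"
  have m: "m > 0" "m \<le> 2" "m \<le> m1" "m \<le> m2" using m1(1) m2(1) by (auto simp: m_def)
  have g1: "dot N u (g k u) \<le> 1 - m" if "\<not> int q dvd k" for k using m1(2)[OF that] m by simp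
  have h1: "dot N ?v (h k ?v) \<le> 1 - m" if "\<not> int q dvd k" for k using m2(2)[OF that] m by simp
  define r where "r = m / 8"
  have r: "r > 0" using m by (simp add: r_def)
  have uu: "nrm N (u - u) < r" using r by (simp add: nrm_def nsq_def)
  have Gn: "G.MX x y = dot N x y" if "x \<in> sphere_pts N" "nrm N (x - u) < r" "y \<in> sphere_pts N" "nrm N (y - u) < r" for x y
    using that by (intro G.MX_near[OF u m(1) g1 _ _ _ _ m(2)]) (auto simp: r_def)
  have Hn: "H.MX x y = dot N x y" if "x \<in> sphere_pts N" "nrm N (x - ?v) < r" "y \<in> sphere_pts N" "nrm N (y - ?v) < r" for x y
    using that by (intro H.MX_near[OF vS m(1) h1 _ _ _ _ m(2)]) (auto simp: r_def)
  have ex: "\<exists>k. dot N (h k (\<Phi> x)) ?v = dot N x u" if x: "x \<in> sphere_pts N" "nrm N (x - u) < r" for x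
  proof -
    have pv: "\<Phi> x \<in> vecs N" using sphere_vecs[OF Phi_sphere[OF x(1)]] .
    obtain k where "H.MX (\<Phi> x) ?v = dot N (\<Phi> x) (h k ?v)" using H.MX_attained by blast
    then have "dot N (\<Phi> x) (h k ?v) = dot N x u" using Phi_MX[OF x(1) u] Gn[OF x u uu] by simp
    then have "dot N (h (- k) (\<Phi> x)) ?v = dot N x u" using H.g_adjoint[OF pv, of "- k" ?v] by simp
    then show ?thesis by blast
  qed
  define kk where "kk x = (SOME k. dot N (h k (\<Phi> x)) ?v = dot N x u)" for x
  define F where "F x = h (kk x) (\<Phi> x)" for x
  have Fd: "dot N (F x) ?v = dot N x u" if "x \<in> sphere_pts N" "nrm N (x - u) < r" for x
    unfolding F_def kk_def by (rule someI_ex[OF ex[OF that]])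
  have FS: "F x \<in> sphere_pts N" if "x \<in> sphere_pts N" for x
    unfolding F_def by (rule H.g_sphere[OF Phi_sphere[OF that]])
  have Fn: "nrm N (F x - ?v) < r" if x: "x \<in> sphere_pts N" "nrm N (x - u) < r" for x
  proof -
    have "(nrm N (F x - ?v))\<^sup>2 = (nrm N (x - u))\<^sup>2"
      unfolding sphere_dist[OF FS[OF x(1)] vS] sphere_dist[OF x(1) u] Fd[OF x] ..
    then have "nrm N (F x - ?v) = nrm N (x - u)"
      using nrm_nonneg[of N "F x - ?v"] nrm_nonneg[of N "x - u"] by (simp add: power2_eq_iff_nonneg)
    then show ?thesis using x by simp
  qed
  have iso: "dot N (F x) (F y) = dot N x y"
    if x: "x \<in> sphere_pts N" "nrm N (x - u) < r" and y: "y \<in> sphere_pts N" "nrm N (y - u) < r" for x y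
  proof -
    have pv: "\<Phi> x \<in> vecs N" "\<Phi> y \<in> vecs N" using sphere_vecs Phi_sphere x y by auto
    have "dot N (F x) (F y) = H.MX (F x) (F y)"
      by (rule Hn[OF FS[OF x(1)] Fn[OF x] FS[OF y(1)] Fn[OF y], symmetric])
    also have "\<dots> = H.MX (\<Phi> x) (\<Phi> y)"
      unfolding F_def H.MX_left[OF pv(1) H.g_vecs[OF pv(2)]] by (rule H.MX_right[OF pv])
    also have "\<dots> = dot N x y" unfolding Phi_MX[OF x(1) y(1)] by (rule Gn[OF x y])
    finally show ?thesis .
  qed
  obtain a where a: "\<And>i. i < N \<Longrightarrow> a i \<in> vecs N"
    "\<And>i j. i < N \<Longrightarrow> j < N \<Longrightarrow> dot N (a i) (a j) = (if i = j then 1 else 0)"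
    "\<And>x. x \<in> sphere_pts N \<Longrightarrow> nrm N (x - u) < r \<Longrightarrow> F x = lincomb N a x"
    using local_isometry_linear[OF u r FS iso] by blast
  have "\<exists>k. lincomb N a x = h k (\<Phi> x)" if "x \<in> sphere_pts N" "nrm N (x - u) < r" for x
    using a(3)[OF that] unfolding F_def by metis
  then show ?thesis using that[OF r a(1,2)] by blast
qed

text \<open>Near x both sides are linear functionals of x, one dominating the other with equality
  at x; hence they coincide.\<close>
lemma lift_nearest:
  assumes r: "r > 0" and av: "\<And>i. i < N \<Longrightarrow> a i \<in> vecs N"
    and on: "\<And>i j. i < N \<Longrightarrow> j < N \<Longrightarrow> dot N (a i) (a j) = (if i = j then 1 else 0)"
    and loc: "\<And>x. x \<in> sphere_pts N \<Longrightarrow> nrm N (x - u) < r \<Longrightarrow> \<exists>k. lincomb N a x = h k (\<Phi> x)"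
    and x: "x \<in> sphere_pts N" "nrm N (x - u) < r" and y: "y \<in> sphere_pts N"
    and strict: "\<And>j. g j y \<noteq> g k y \<Longrightarrow> dot N x (g j y) < dot N x (g k y)"
  shows "\<exists>c. lincomb N a (g k y) = h c (\<Phi> y)"
proof -
  let ?t = "g k y"
  have yv: "y \<in> vecs N" and tS: "?t \<in> sphere_pts N" and tv: "?t \<in> vecs N"
    using sphere_vecs G.g_sphere y by auto
  have pS: "\<Phi> y \<in> sphere_pts N" and pv: "\<Phi> y \<in> vecs N" using Phi_sphere sphere_vecs y by auto
  define J where "J = {j\<in>{..<q}. g (int j) y \<noteq> ?t}"
  \<comment> \<open>The margin by which \<open>g k y\<close> beats the other points of its orbit as
    seen from x; 1 is a default in case there are none.\<close>
  define d where "d = Min (insert 1 ((\<lambda>j. dot N x ?t - dot N x (g (int j) y)) ` J))"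
  have fin: "finite (insert 1 ((\<lambda>j. dot N x ?t - dot N x (g (int j) y)) ` J))" by (simp add: J_def)
  have d0: "d > 0" unfolding d_def
    by (subst Min_gr_iff[OF fin]) (use strict in \<open>auto simp: J_def\<close>)
  have dle: "dot N x (g j y) + d \<le> dot N x ?t" if "g j y \<noteq> ?t" for j
  proof -
    define j' where "j' = nat (j mod int q)"
    have jj: "g (int j') y = g j y" unfolding j'_def by (rule G.g_mod[OF yv])
    have "j' \<in> J" using that G.q_pos by (auto simp: J_def jj) (simp add: j'_def nat_less_iff)
    then have "d \<le> dot N x ?t - dot N x (g (int j') y)"
      unfolding d_def by (intro Min_le[OF fin]) blast
    then show ?thesis by (simp add: jj)
  qed
  have near: "H.MX (lincomb N a x') (\<Phi> y) = dot N x' ?t"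
    if x': "x' \<in> sphere_pts N" "nrm N (x' - x) < d / 2" "nrm N (x' - u) < r" for x'
  proof -
    have "G.MX x' y = dot N x' ?t"
    proof (rule G.MX_eqI[OF yv _ refl])
      fix j
      show "dot N x' (g j y) \<le> dot N x' ?t"
      proof (cases "g j y = ?t")
        case False
        have "dot N x' (g j y) \<le> dot N x (g j y) + nrm N (x' - x) + nrm N (y - y)"
          by (rule G.dot_g_lipschitz[OF x'(1) x(1) y y])
        moreover have "dot N x ?t \<le> dot N x' ?t + nrm N (x - x') + nrm N (y - y)"
          by (rule G.dot_g_lipschitz[OF x(1) x'(1) y y])
        moreover have "nrm N (y - y) = 0" by (simp add: nrm_def nsq_def)
        ultimately show ?thesis using dle[OF False] x'(2) nrm_minus[of N x x'] by linarith
      qed simp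
    qed
    moreover obtain k' where k': "lincomb N a x' = h k' (\<Phi> x')" using loc[OF x'(1,3)] by blast
    have "H.MX (lincomb N a x') (\<Phi> y) = H.MX (\<Phi> x') (\<Phi> y)"
      unfolding k' by (rule H.MX_left[OF sphere_vecs[OF Phi_sphere[OF x'(1)]] pv])
    ultimately show ?thesis using Phi_MX[OF x'(1) y] by simp
  qed
  have xx: "nrm N (x - x) < d / 2" using d0 by (simp add: nrm_def nsq_def)
  obtain c where c: "H.MX (lincomb N a x) (\<Phi> y) = dot N (lincomb N a x) (h c (\<Phi> y))"
    using H.MX_attained by blast
  define z where "z = h c (\<Phi> y)"
  have zS: "z \<in> sphere_pts N" unfolding z_def by (rule H.g_sphere[OF pS])
  \<comment> \<open>Represents the difference of the two functionals: \<open>dot N x' w\<close> is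
    non-negative for x' near x and 0 at x.\<close>
  define w where "w = ?t - (\<lambda>i. if i < N then dot N (a i) z else 0)"
  have wv: "w \<in> vecs N" using tv by (auto simp: w_def vecs_def)
  have dw: "dot N x' w = dot N x' ?t - dot N (lincomb N a x') z" for x'
  proof -
    have "dot N x' (\<lambda>i. if i < N then dot N (a i) z else 0) = dot N (lincomb N a x') z"
      unfolding dot_lincomb unfolding dot_def[of N x'] by (rule sum.cong) auto
    then show ?thesis by (simp add: w_def dot_diff)
  qed
  have x0: "dot N x w = 0" using near[OF x(1) xx x(2)] c by (simp add: dw z_def)
  have w0: "dot N w w = 0"
  proof (rule ccontr)
    assume "dot N w w \<noteq> 0"
    then have wpos: "dot N w w > 0" using nsq_nonneg[of N w] by (simp add: dot_self)
    \<comment> \<open>Moving from x in the direction of -w would make the difference negative within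
      the region where it is known to be non-negative.\<close>
    define rho where "rho = min (d / 2) (r - nrm N (x - u))"
    have rho: "rho > 0" using d0 x(2) by (simp add: rho_def)
    have ev: "\<forall>\<^sub>F s in at_right 0. x + sc s (sc (-1) w) \<in> punctured N \<and> nrm N (proj N (x + sc s (sc (-1) w)) - x) < rho"
      by (rule proj_near[OF x(1) vecs_ops(3)[OF wv] rho])
    from eventually_conj[OF eventually_at_right_less ev]
    have "\<exists>s>0. x + sc s (sc (-1) w) \<in> punctured N \<and> nrm N (proj N (x + sc s (sc (-1) w)) - x) < rho"
      by (rule eventually_happens'[rotated]) simp
    then obtain s where s: "s > 0" "x + sc s (sc (-1) w) \<in> punctured N"
      "nrm N (proj N (x + sc s (sc (-1) w)) - x) < rho" by blast
    define x' where "x' = proj N (x + sc s (sc (-1) w))"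
    have x'S: "x' \<in> sphere_pts N" unfolding x'_def by (rule proj_sphere[OF s(2)])
    have x'n: "nrm N (x' - x) < d / 2" "nrm N (x' - u) < r"
      using s(3) nrm_dist_triangle[of N x' u x] by (auto simp: x'_def rho_def)
    have "dot N (lincomb N a x') z \<le> H.MX (lincomb N a x') (\<Phi> y)"
      unfolding z_def by (rule H.MX_ge[OF pv])
    then have "dot N x' w \<ge> 0" using near[OF x'S x'n] by (simp add: dw)
    moreover have "dot N x' w = 1 / nrm N (x + sc s (sc (-1) w)) * (- s * dot N w w)"
      unfolding x'_def proj_sc dot_simps x0 by simp
    moreover have "1 / nrm N (x + sc s (sc (-1) w)) > 0"
      using s(2) by (simp add: nrm_def punctured_iff)
    moreover have "- s * dot N w w < 0" using s(1) wpos by simp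
    ultimately show False by (metis mult_pos_neg not_less)
  qed
  have "lincomb N a ?t = z"
  proof (rule vec_eqI)
    show "z \<in> vecs N" by (rule sphere_vecs[OF zS])
    show "lincomb N a ?t \<in> vecs N" unfolding lincomb_def vecs_def
    proof (intro CollectI allI impI sum.neutral ballI)
      fix j i assume "N \<le> j" "i \<in> {..<N}"
      then show "?t i * a i j = 0" using av[of i] by (simp add: vecs_def)
    qed
    have "w = (\<lambda>_. 0)" using w0 nsq_eq_0_iff[OF wv] by (simp add: dot_self)
    then have "dot N ?t w = 0" by (simp add: dot_def)
    then have 1: "dot N (lincomb N a ?t) z = 1" using dw[of ?t] sphere_dot[OF tS] by simp
    have 2: "dot N (lincomb N a ?t) (lincomb N a ?t) = 1"
      using dot_lincomb_orthonormal[OF on, of ?t ?t] sphere_dot[OF tS] by simp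
    show "dot N (lincomb N a ?t - z) (lincomb N a ?t - z) = 0"
      using 1 2 sphere_dot[OF zS] dot_commute[of N z "lincomb N a ?t"] by (simp add: dot_diff)
  qed
  then show ?thesis unfolding z_def by blast
qed

end

section \<open>Nearest orbit points and conjugation of the generator\<close>

context isom_cyclic
begin

lemma g_lin_cont:
  assumes x: "x \<in> vecs N" and y: "y \<in> vecs N" and D: "\<And>t. D t \<in> vecs N"
    and lim: "\<And>i. i < N \<Longrightarrow> ((\<lambda>t. D t i) \<longlongrightarrow> y i) F"
  shows "((\<lambda>t. dot N x (g j (D t))) \<longlongrightarrow> dot N x (g j y)) F"
proof -
  have e: "dot N x (g j z) = (\<Sum>i<N. z i * g (- j) x i)" if "z \<in> vecs N" for z
  proof -
    have "dot N x (g j z) = dot N z (g (- j) x)"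
      using g_adjoint[OF that, of j x] dot_commute[of N x "g j z"] by simp
    then show ?thesis by (simp add: dot_def)
  qed
  show ?thesis unfolding e[OF D] e[OF y]
    by (intro tendsto_sum tendsto_mult tendsto_const lim) simp
qed

lemma displacement_sym: "u \<in> vecs N \<Longrightarrow> dot N u (g (- k) u) = dot N u (g k u)"
  using g_adjoint[of u k u] dot_commute[of N u "g k u"] by simp

text \<open>The point \<open>u + g k0 u\<close> is, for its orbit, as close to u as its translate by \<open>g (- k0)\<close>;
  a small displacement of u decides which of the two is nearest.\<close>
lemma select_nearest:
  assumes u: "u \<in> sphere_pts N" and r: "r > 0"
    and k0: "\<not> int q dvd k0" "\<not> int q dvd 2 * k0"
    and free: "\<And>k. \<not> int q dvd k \<Longrightarrow> g k u \<noteq> u"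
    and near: "\<And>k. \<not> int q dvd k \<Longrightarrow> dot N u (g k u) \<le> dot N u (g k0 u)"
    and k1: "k1 = 0 \<or> k1 = - k0"
  shows "\<exists>x\<in>sphere_pts N. nrm N (x - u) < r \<and>
    (\<forall>j. \<not> int q dvd j - k1 \<longrightarrow> dot N x (g j (u + g k0 u)) < dot N x (g k1 (u + g k0 u)))"
proof -
  define m where "m = u + g k0 u"
  \<comment> \<open>E equals \<open>m - g (- k0) m\<close>, so a displacement along E favours m and
    one along -E favours its translate.\<close>
  define E where "E = g k0 u - g (- k0) u"
  define D where "D = (if k1 = 0 then E else sc (-1) E)"
  have uv: "u \<in> vecs N" using sphere_vecs[OF u] .
  have mv: "m \<in> vecs N" unfolding m_def by (intro vecs_ops uv g_vecs)
  have Ev: "E \<in> vecs N" unfolding E_def by (intro vecs_ops uv g_vecs)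
  have Dv: "D \<in> vecs N" unfolding D_def using Ev vecs_ops(3) by simp
  define c where "c k = dot N u (g k u)" for k
  have c1: "c k0 < 1"
  proof -
    have "g k0 u \<noteq> u" using free[OF k0(1)] .
    then have "c k0 \<noteq> 1" using sphere_eqI[OF u g_sphere[OF u], of k0] unfolding c_def by metis
    then show ?thesis using dot_le_1[OF u g_sphere[OF u], of k0] unfolding c_def by simp
  qed
  have cm: "dot N u (g j m) = c j + c (j + k0)" for j
    by (simp add: m_def g_linear dot_add c_def g_plus[OF uv])
  have c0: "c k = 1" if "int q dvd k" for k
    using g_period[OF uv, of k 0] that u by (simp add: c_def g_zero uv sphere_dot)
  have cs: "c (- k) = c k" for k unfolding c_def by (rule displacement_sym[OF uv])
  have cp: "c i = c j" if "int q dvd i - j" for i j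
    using g_period[OF uv that] by (simp add: c_def)
  have top: "dot N u (g j m) = 1 + c k0" if "int q dvd j \<or> int q dvd j + k0" for j
    using that
  proof
    assume j: "int q dvd j"
    have "c (j + k0) = c k0" by (rule cp) (simp add: j)
    then show ?thesis using c0[OF j] by (simp add: cm)
  next
    assume j: "int q dvd j + k0"
    have "c j = c (- k0)" by (rule cp) (simp add: j)
    then show ?thesis using c0[OF j] cs[of k0] by (simp add: cm)
  qed
  \<comment> \<open>Both summands of any other translate are at most \<open>c k0\<close>, while the
    two best ones attain 1 in one summand.\<close>
  have low: "dot N u (g j m) < 1 + c k0" if "\<not> int q dvd j" "\<not> int q dvd j + k0" for j
    using near[OF that(1)] near[OF that(2)] c1 by (simp add: cm c_def)
  have gm: "g j m = m" if "int q dvd j" for j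
    using g_period[OF mv, of j 0] that by (simp add: g_zero mv)
  have gk: "g j m = g (- k0) m" if "int q dvd j + k0" for j
    using g_period[OF mv, of j "- k0"] that by simp
  have mE: "m - g (- k0) m = E"
    unfolding m_def E_def g_linear g_plus[OF uv, symmetric] by (simp add: g_zero uv)
  have EE: "dot N E E > 0"
  proof -
    have "E \<noteq> (\<lambda>_. 0)"
    proof
      assume "E = (\<lambda>_. 0)"
      then have "g k0 u = g (- k0) u" by (simp add: E_def fun_eq_iff)
      then have "g k0 (g k0 u) = g k0 (g (- k0) u)" by simp
      then have "g (2 * k0) u = u" unfolding g_plus[OF uv, symmetric] by (simp add: g_zero uv)
      then show False using free[OF k0(2)] by simp
    qed
    then have "dot N E E \<noteq> 0" using nsq_eq_0_iff[OF Ev] by (simp add: dot_self)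
    then show ?thesis using nsq_nonneg[of N E] by (simp add: dot_self)
  qed
  have k1top: "int q dvd k1 \<or> int q dvd k1 + k0" using k1 by auto
  have gap: "dot N u (g k1 m - g j m) \<ge> 0 \<and> (dot N u (g k1 m - g j m) = 0 \<longrightarrow> dot N D (g k1 m - g j m) > 0)"
    if j: "\<not> int q dvd j - k1" for j
  proof (cases "int q dvd j \<or> int q dvd j + k0")
    case False
    then show ?thesis using low[of j] top[OF k1top] by (simp add: dot_diff)
  next
    case True
    have "dot N D (g k1 m - g j m) > 0"
    proof (cases "k1 = 0")
      case k10: True
      then have "\<not> int q dvd j" using j by simp
      then have "g j m = g (- k0) m" using True gk by blast
      then show ?thesis using EE k10 by (simp add: D_def mE g_zero mv)
    next
      case k1n: False
      then have k1e: "k1 = - k0" using k1 by simp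
      then have "\<not> int q dvd j + k0" using j by simp
      then have "g j m = m" using True gm by blast
      moreover have "g (- k0) m - m = sc (-1) E" unfolding mE[symmetric] by (simp add: sc_def fun_eq_iff)
      ultimately show ?thesis using EE k1n k1e by (simp add: D_def dot_sc)
    qed
    moreover have "dot N u (g k1 m - g j m) = 0" using top[OF True] top[OF k1top] by (simp add: dot_diff)
    ultimately show ?thesis by simp
  qed
  have "\<forall>\<^sub>F t in at_right 0. \<forall>j\<in>{j\<in>{..<q}. \<not> int q dvd int j - k1}.
      dot N u (g k1 m - g (int j) m) + t * dot N D (g k1 m - g (int j) m) > 0"
    by (intro eventually_ball_finite ballI eventually_linear_pos) (use gap in auto)
  from eventually_conj[OF proj_near[OF u Dv r] this]
  have "\<exists>t. (u + sc t D \<in> punctured N \<and> nrm N (proj N (u + sc t D) - u) < r) \<and>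
     (\<forall>j\<in>{j\<in>{..<q}. \<not> int q dvd int j - k1}.
      dot N u (g k1 m - g (int j) m) + t * dot N D (g k1 m - g (int j) m) > 0)"
    by (rule eventually_happens'[rotated]) simp
  then obtain t where t: "u + sc t D \<in> punctured N" "nrm N (proj N (u + sc t D) - u) < r"
     "\<And>j. j < q \<Longrightarrow> \<not> int q dvd int j - k1 \<Longrightarrow>
      dot N u (g k1 m - g (int j) m) + t * dot N D (g k1 m - g (int j) m) > 0"
    by blast
  define x where "x = proj N (u + sc t D)"
  have "dot N x (g j m) < dot N x (g k1 m)" if j: "\<not> int q dvd j - k1" for j
  proof -
    define j' where "j' = nat (j mod int q)"
    have jj: "g (int j') m = g j m" unfolding j'_def by (rule g_mod[OF mv])
    have jq: "int j' = j mod int q" "j' < q" using q_pos by (auto simp: j'_def nat_less_iff)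
    have "\<not> int q dvd int j' - k1"
    proof
      assume "int q dvd int j' - k1"
      moreover have "int q dvd j - int j'" unfolding jq(1) by (simp add: dvd_minus_mod)
      ultimately have "int q dvd (j - int j') + (int j' - k1)" by (rule dvd_add[rotated])
      then show False using j by simp
    qed
    from t(3)[OF jq(2) this] have "dot N (u + sc t D) (g k1 m - g j m) > 0"
      by (simp add: jj dot_add dot_sc)
    moreover have "1 / nrm N (u + sc t D) > 0" using t(1) by (simp add: nrm_def punctured_iff)
    ultimately have "dot N x (g k1 m - g j m) > 0" unfolding x_def proj_sc dot_sc by (rule mult_pos_pos[rotated])
    then show ?thesis by (simp add: dot_diff)
  qed
  moreover have "x \<in> sphere_pts N" unfolding x_def by (rule proj_sphere[OF t(1)])
  ultimately show ?thesis using t(2) unfolding x_def m_def by blast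
qed

end

context quotient_isometry
begin

text \<open>Seen from one point near u, m is the nearest in its orbit; seen from another,
  \<open>g (- k0) m\<close> is. Both facts persist for y close to m, and by
  \<open>lift_nearest\<close> the linear map carries y and \<open>g (- k0) y\<close>, after
  normalization, into one orbit of h. Their images thus differ by some \<open>h c\<close>, where c
  may still depend on y.\<close>

lemma conjugate_at:
  assumes u: "u \<in> sphere_pts N" and k0: "\<not> int q dvd k0" "\<not> int q dvd 2 * k0"
    and gf: "\<And>k. \<not> int q dvd k \<Longrightarrow> g k u \<noteq> u"
    and hf: "\<And>k. \<not> int q dvd k \<Longrightarrow> h k (\<Phi> u) \<noteq> \<Phi> u"
    and near: "\<And>k. \<not> int q dvd k \<Longrightarrow> dot N u (g k u) \<le> dot N u (g k0 u)"
  obtains a c where "\<And>i. i < N \<Longrightarrow> a i \<in> vecs N"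
    "\<And>i j. i < N \<Longrightarrow> j < N \<Longrightarrow> dot N (a i) (a j) = (if i = j then 1 else 0)"
    "\<And>x. x \<in> vecs N \<Longrightarrow> lincomb N a (g (- k0) x) = h c (lincomb N a x)"
proof -
  obtain r a where r: "r > 0" and av: "\<And>i. i < N \<Longrightarrow> a i \<in> vecs N"
    and on: "\<And>i j. i < N \<Longrightarrow> j < N \<Longrightarrow> dot N (a i) (a j) = (if i = j then 1 else 0)"
    and loc: "\<And>x. x \<in> sphere_pts N \<Longrightarrow> nrm N (x - u) < r \<Longrightarrow> \<exists>k. lincomb N a x = h k (\<Phi> x)"
    using local_lift[OF u gf hf] by blast
  define m where "m = u + g k0 u"
  have uv: "u \<in> vecs N" using sphere_vecs[OF u] .
  have mv: "m \<in> vecs N" unfolding m_def by (intro vecs_ops uv G.g_vecs)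
  obtain x0 where x0: "x0 \<in> sphere_pts N" "nrm N (x0 - u) < r"
    "\<And>j. \<not> int q dvd j - 0 \<Longrightarrow> dot N x0 (g j m) < dot N x0 (g 0 m)"
    using G.select_nearest[OF u r k0 gf near, of 0] unfolding m_def by blast
  obtain x1 where x1: "x1 \<in> sphere_pts N" "nrm N (x1 - u) < r"
    "\<And>j. \<not> int q dvd j - (- k0) \<Longrightarrow> dot N x1 (g j m) < dot N x1 (g (- k0) m)"
    using G.select_nearest[OF u r k0 gf near, of "- k0"] unfolding m_def by blast
  \<comment> \<open>A curve issuing from m. A linear map applied to it is, in each coordinate, a
    polynomial in t whose non-constant coefficients are the matrix entries; so a linear map
    vanishing at infinitely many of its points is 0.\<close>
  define y where "y t = (\<lambda>i. if i < N then m i + t ^ Suc i else 0)" for t :: real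
  have yv: "y t \<in> vecs N" for t by (auto simp: y_def vecs_def)
  have lim: "((\<lambda>t. dot N x (g j (y t))) \<longlongrightarrow> dot N x (g j m)) (at_right 0)" if "x \<in> sphere_pts N" for x j
  proof (rule G.g_lin_cont[OF sphere_vecs[OF that] mv yv])
    fix i assume "i < N"
    have "((\<lambda>t. m i + t ^ Suc i) \<longlongrightarrow> m i + 0 ^ Suc i) (at_right (0::real))"
      by (intro tendsto_add tendsto_power tendsto_const tendsto_ident_at)
    then show "((\<lambda>t. y t i) \<longlongrightarrow> m i) (at_right 0)" using \<open>i < N\<close> by (simp add: y_def)
  qed
  have ev: "\<forall>\<^sub>F t in at_right 0. \<forall>j\<in>{j\<in>{..<q}. \<not> int q dvd int j - k1}.
      dot N x (g (int j) (y t)) < dot N x (g k1 (y t))"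
    if x: "x \<in> sphere_pts N" "\<And>j. \<not> int q dvd j - k1 \<Longrightarrow> dot N x (g j m) < dot N x (g k1 m)" for x k1
  proof (rule eventually_ball_finite)
    show "\<forall>j\<in>{j\<in>{..<q}. \<not> int q dvd int j - k1}.
      \<forall>\<^sub>F t in at_right 0. dot N x (g (int j) (y t)) < dot N x (g k1 (y t))"
    proof
      fix j assume j: "j \<in> {j\<in>{..<q}. \<not> int q dvd int j - k1}"
      have "((\<lambda>t. dot N x (g k1 (y t)) - dot N x (g (int j) (y t))) \<longlongrightarrow>
          dot N x (g k1 m) - dot N x (g (int j) m)) (at_right 0)"
        by (intro tendsto_diff lim x(1))
      moreover have "dot N x (g k1 m) - dot N x (g (int j) m) > 0" using x(2)[of "int j"] j by simp
      ultimately have "\<forall>\<^sub>F t in at_right 0. dot N x (g k1 (y t)) - dot N x (g (int j) (y t)) > 0"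
        by (rule order_tendstoD(1))
      then show "\<forall>\<^sub>F t in at_right 0. dot N x (g (int j) (y t)) < dot N x (g k1 (y t))"
        by eventually_elim simp
    qed
  qed simp
  have lift: "\<exists>c. lincomb N a (g k1 (proj N (y t))) = h c (\<Phi> (proj N (y t)))"
    if x: "x \<in> sphere_pts N" "nrm N (x - u) < r" and yp: "y t \<in> punctured N"
      and st: "\<forall>j\<in>{j\<in>{..<q}. \<not> int q dvd int j - k1}. dot N x (g (int j) (y t)) < dot N x (g k1 (y t))" for x k1 t
  proof (rule lift_nearest[OF r av on loc x proj_sphere[OF yp]])
    fix j assume ne: "g j (proj N (y t)) \<noteq> g k1 (proj N (y t))"
    have pv: "proj N (y t) \<in> vecs N" by (rule sphere_vecs[OF proj_sphere[OF yp]])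
    define j' where "j' = nat (j mod int q)"
    have jj: "g (int j') z = g j z" if "z \<in> vecs N" for z unfolding j'_def by (rule G.g_mod[OF that])
    have jq: "j' < q" using G.q_pos by (auto simp: j'_def nat_less_iff)
    have "\<not> int q dvd int j' - k1" using ne jj[OF pv] G.g_period[OF pv, of "int j'" k1] by auto
    then have "dot N x (g j (y t)) < dot N x (g k1 (y t))" using st jq jj[OF yv] by auto
    moreover have "1 / nrm N (y t) > 0" using yp by (simp add: nrm_def punctured_iff)
    ultimately have "1 / nrm N (y t) * dot N x (g j (y t)) < 1 / nrm N (y t) * dot N x (g k1 (y t))"
      by (rule mult_strict_left_mono)
    then show "dot N x (g j (proj N (y t))) < dot N x (g k1 (proj N (y t)))"
      unfolding proj_sc G.g_linear dot_sc .
  qed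
  have conj: "\<exists>c<q. lincomb N a (g (- k0) (y t)) = h (int c) (lincomb N a (y t))"
    if s0: "\<forall>j\<in>{j\<in>{..<q}. \<not> int q dvd int j - 0}. dot N x0 (g (int j) (y t)) < dot N x0 (g 0 (y t))"
    and s1: "\<forall>j\<in>{j\<in>{..<q}. \<not> int q dvd int j - (- k0)}. dot N x1 (g (int j) (y t)) < dot N x1 (g (- k0) (y t))" for t
  proof -
    define j where "j = nat (k0 mod int q)"
    have j: "int j = k0 mod int q" "j < q" using G.q_pos by (auto simp: j_def nat_less_iff)
    have "\<not> int q dvd int j - 0" using k0(1) unfolding j(1) by (simp add: dvd_eq_mod_eq_0)
    then have lt: "dot N x0 (g (int j) (y t)) < dot N x0 (y t)" using s0 j(2) yv by (simp add: G.g_zero)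
    have "y t \<in> punctured N"
    proof (rule ccontr)
      assume "y t \<notin> punctured N"
      then have "nsq N (y t) = 0" using yv nsq_nonneg[of N "y t"] by (auto simp: punctured_iff less_le)
      then have "y t = (\<lambda>_. 0)" using nsq_eq_0_iff[OF yv] by blast
      then have "y t = sc 0 (y t)" by (simp add: sc_def)
      then have "g (int j) (y t) = sc 0 (g (int j) (y t))" using G.g_linear(2)[of "int j" 0 "y t"] by simp
      then have "dot N x0 (g (int j) (y t)) = 0" by (metis dot_sc(2) mult_zero_left)
      moreover have "dot N x0 (y t) = 0" using \<open>y t = (\<lambda>_. 0)\<close> by (simp add: dot_def)
      ultimately show False using lt by simp
    qed
    note yp = this
    let ?y = "proj N (y t)"
    have ypv: "?y \<in> vecs N" and ppv: "\<Phi> ?y \<in> vecs N"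
      using sphere_vecs Phi_sphere proj_sphere[OF yp] by auto
    obtain c0 where c0: "lincomb N a (g 0 ?y) = h c0 (\<Phi> ?y)" using lift[OF x0(1,2) yp s0] by blast
    obtain c1 where c1: "lincomb N a (g (- k0) ?y) = h c1 (\<Phi> ?y)" using lift[OF x1(1,2) yp s1] by blast
    have hv: "h c0 (\<Phi> ?y) \<in> vecs N" by (rule H.g_vecs[OF ppv])
    define c where "c = nat ((c1 - c0) mod int q)"
    have "h (int c) (h c0 (\<Phi> ?y)) = h (c1 - c0) (h c0 (\<Phi> ?y))"
      unfolding c_def by (rule H.g_mod[OF hv])
    also have "\<dots> = h c1 (\<Phi> ?y)" using H.g_plus[OF ppv, of "c1 - c0" c0] by simp
    finally have "lincomb N a (g (- k0) ?y) = h (int c) (lincomb N a ?y)"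
      using c0 c1 by (simp add: G.g_zero ypv)
    then have "sc (nrm N (y t)) (lincomb N a (g (- k0) ?y)) = sc (nrm N (y t)) (h (int c) (lincomb N a ?y))" by simp
    then have "lincomb N a (g (- k0) (y t)) = h (int c) (lincomb N a (y t))"
      unfolding lincomb_sc[symmetric] G.g_linear(2)[symmetric] H.g_linear(2)[symmetric] sc_proj[OF yp] .
    moreover have "c < q" using G.q_pos by (auto simp: c_def nat_less_iff)
    ultimately show ?thesis by blast
  qed
  have "\<forall>\<^sub>F t in at_right 0. \<exists>c<q. lincomb N a (g (- k0) (y t)) = h (int c) (lincomb N a (y t))"
  proof -
    have E0: "\<forall>\<^sub>F t in at_right 0. \<forall>j\<in>{j\<in>{..<q}. \<not> int q dvd int j - 0}.
        dot N x0 (g (int j) (y t)) < dot N x0 (g 0 (y t))"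
      by (rule ev[OF x0(1)]) (rule x0(3))
    have E1: "\<forall>\<^sub>F t in at_right 0. \<forall>j\<in>{j\<in>{..<q}. \<not> int q dvd int j - (- k0)}.
        dot N x1 (g (int j) (y t)) < dot N x1 (g (- k0) (y t))"
      by (rule ev[OF x1(1)]) (rule x1(3))
    show ?thesis using E0 E1 by eventually_elim (rule conj)
  qed
  then obtain b where b: "b > 0" "\<And>t. t > 0 \<Longrightarrow> t < b \<Longrightarrow> \<exists>c<q. lincomb N a (g (- k0) (y t)) = h (int c) (lincomb N a (y t))"
    unfolding eventually_at_right_field by blast
  \<comment> \<open>Pigeonhole: finitely many c cover an interval of parameters, so one of them
    occurs for infinitely many t.\<close>
  define T where "T c = {t. lincomb N a (g (- k0) (y t)) = h (int c) (lincomb N a (y t))}" for c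
  have "{0<..<b} \<subseteq> (\<Union>c<q. T c)"
  proof
    fix t assume "t \<in> {0<..<b}"
    then obtain c where "c < q" "lincomb N a (g (- k0) (y t)) = h (int c) (lincomb N a (y t))"
      using b(2)[of t] by auto
    then show "t \<in> (\<Union>c<q. T c)" unfolding T_def by blast
  qed
  moreover have "infinite {0<..<b}" using b(1) by (rule infinite_Ioo)
  ultimately have "infinite (\<Union>c<q. T c)" using finite_subset by blast
  then obtain c where c: "infinite (T c)" by auto
  define L where "L x = lincomb N a (g (- k0) x) - h (int c) (lincomb N a x)" for x
  have L: "L (x + z) = L x + L z" "L (sc s x) = sc s (L x)" for x z s
    by (simp_all add: L_def G.g_linear H.g_linear lincomb_add lincomb_sc) (simp add: sc_def fun_eq_iff algebra_simps)
  have Lu: "L (unitv i) j = 0" if i: "i < N" for i j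
  proof -
    define e where "e k = (case k of 0 \<Rightarrow> (\<Sum>i<N. m i * L (unitv i) j) | Suc i \<Rightarrow> L (unitv i) j)" for k
    have "(\<Sum>k\<le>N. e k * t ^ k) = L (y t) j" for t
    proof -
      have "L (y t) j = (\<Sum>i<N. y t i * L (unitv i) j)" by (rule linear_expand[OF L yv])
      also have "\<dots> = (\<Sum>i<N. m i * L (unitv i) j) + (\<Sum>i<N. L (unitv i) j * t ^ Suc i)"
        unfolding sum.distrib[symmetric] by (rule sum.cong) (auto simp: y_def algebra_simps)
      also have "\<dots> = (\<Sum>k\<le>N. e k * t ^ k)"
        by (simp add: lessThan_Suc_atMost[symmetric] sum.lessThan_Suc_shift e_def del: sum.lessThan_Suc)
      finally show ?thesis by simp
    qed
    then have "T c \<subseteq> {t. (\<Sum>k\<le>N. e k * t ^ k) = 0}" by (auto simp: T_def L_def)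
    then have "\<not> finite {t. (\<Sum>k\<le>N. e k * t ^ k) = 0}" using c finite_subset by blast
    then have "\<forall>k\<le>N. e k = 0" by (simp add: polyfun_finite_roots)
    then have "e (Suc i) = 0" using i by simp
    then show ?thesis by (simp add: e_def)
  qed
  have "lincomb N a (g (- k0) x) = h (int c) (lincomb N a x)" if "x \<in> vecs N" for x
  proof
    fix j
    have "L x j = 0" using linear_expand[OF L that, of j] Lu by simp
    then show "lincomb N a (g (- k0) x) j = h (int c) (lincomb N a x) j" by (simp add: L_def)
  qed
  then show ?thesis using that[OF av on] by blast
qed

text \<open>The point e cannot be used directly, as \<open>\<Phi> e\<close> may have a nontrivial
  stabilizer. The margin eta lets the comparisons survive the passage to a nearby u.\<close>

lemma conjugate:
  assumes e: "e \<in> sphere_pts N" and k0: "\<not> int q dvd k0" "\<not> int q dvd 2 * k0" and eta: "eta > 0"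
    and gap: "\<And>k. \<not> int q dvd k \<Longrightarrow> \<not> int q dvd k - k0 \<Longrightarrow> \<not> int q dvd k + k0 \<Longrightarrow>
      dot N e (g k e) + eta \<le> dot N e (g k0 e)"
    and gap1: "dot N e (g k0 e) + eta \<le> 1"
    and dense: "\<And>v d. v \<in> sphere_pts N \<Longrightarrow> d > 0 \<Longrightarrow>
      \<exists>v'\<in>sphere_pts N. dot N v' v > 1 - d \<and> (\<forall>k. \<not> int q dvd k \<longrightarrow> h k v' \<noteq> v')"
  obtains a c where "\<And>i. i < N \<Longrightarrow> a i \<in> vecs N"
    "\<And>i j. i < N \<Longrightarrow> j < N \<Longrightarrow> dot N (a i) (a j) = (if i = j then 1 else 0)"
    "\<And>x. x \<in> vecs N \<Longrightarrow> lincomb N a (g (- k0) x) = h c (lincomb N a x)"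
proof -
  have "eta\<^sup>2 / 64 > 0" using eta by simp
  from free_image_near[OF e this dense]
  obtain u where u: "u \<in> sphere_pts N" "dot N u e > 1 - eta\<^sup>2 / 64"
    "\<And>k. \<not> int q dvd k \<Longrightarrow> h k (\<Phi> u) \<noteq> \<Phi> u" by blast
  \<comment> \<open>The inner product above 1 - eta^2 / 64 gives a distance below eta / 4, so each
    displacement \<open>dot N u (g k u)\<close> differs from that of e by less than eta / 2.\<close>
  have "(nrm N (u - e))\<^sup>2 < (eta / 4)\<^sup>2"
  proof -
    have "eta\<^sup>2 > 0" using eta by simp
    moreover have "(eta / 4)\<^sup>2 = eta\<^sup>2 / 16" by (simp add: power_divide)
    ultimately show ?thesis using sphere_dist[OF u(1) e] u(2) by linarith
  qed
  then have ue: "nrm N (u - e) < eta / 4"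
    using power2_less_imp_less[of "nrm N (u - e)" "eta / 4"] eta by simp
  have up: "dot N u (g k u) < dot N e (g k e) + eta / 2" for k
    using G.dot_g_lipschitz[OF u(1) e u(1) e, of k] ue by linarith
  have lo: "dot N e (g k e) < dot N u (g k u) + eta / 2" for k
    using G.dot_g_lipschitz[OF e u(1) e u(1), of k] ue nrm_minus[of N e u] by linarith
  have uv: "u \<in> vecs N" by (rule sphere_vecs[OF u(1)])
  have near: "dot N u (g k u) \<le> dot N u (g k0 u)" if k: "\<not> int q dvd k" for k
  proof -
    consider "int q dvd k - k0" | "int q dvd k + k0" | "\<not> int q dvd k - k0" "\<not> int q dvd k + k0" by blast
    then show ?thesis
    proof cases
      case 1
      then show ?thesis using G.g_period[OF uv 1] by simp
    next
      case 2
      then show ?thesis using G.g_period[OF uv, of k "- k0"] G.displacement_sym[OF uv, of k0] by simp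
    next
      case 3
      then show ?thesis using gap[OF k 3] up[of k] lo[of k0] by linarith
    qed
  qed
  have gf: "g k u \<noteq> u" if k: "\<not> int q dvd k" for k
  proof
    assume "g k u = u"
    then have "dot N u (g k u) = 1" using sphere_dot[OF u(1)] by simp
    then show False using near[OF k] up[of k0] gap1 eta by linarith
  qed
  show ?thesis using conjugate_at[OF u(1) k0 gf u(3) near] that by blast
qed

end

section \<open>Rotation numbers under an isometry of lens spaces\<close>

lemma zeta_ext:
  assumes "2 * n \<le> N" "x \<in> vecs N" "y \<in> vecs N" "\<And>l. l < N \<Longrightarrow> zeta n l x = zeta n l y"
  shows "x = y"
proof (rule vec_eqI[OF assms(2,3)])
  have "dot N x z = dot N y z" for z
    unfolding dot_zeta[OF assms(1), symmetric] using assms(4) by simp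
  then show "dot N (x - y) (x - y) = 0" by (simp add: dot_diff(1))
qed

lemma lens_isom_cyclic:
  assumes "q > 0" and N: "2 * length ps \<le> N"
  shows "isom_cyclic N q (lens_act (q, ps, W))"
proof
  show "q > 0" by fact
  fix x y :: pt and k i j :: int and c :: real
  show v: "lens_act (q, ps, W) k x \<in> vecs N" if "x \<in> vecs N" for x k
    using lens_act_vecs[OF that N] .
  show "dot N (lens_act (q, ps, W) k x) (lens_act (q, ps, W) k y) = dot N x y"
    by (rule lens_act_dot[OF N])
  show "lens_act (q, ps, W) k (x + y) = lens_act (q, ps, W) k x + lens_act (q, ps, W) k y"
    by (rule ext) (simp add: lens_act_def Let_def algebra_simps)
  show "lens_act (q, ps, W) k (sc c x) = sc c (lens_act (q, ps, W) k x)"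
    by (rule ext) (simp add: lens_act_def Let_def sc_def algebra_simps)
  show "lens_act (q, ps, W) (i + j) x = lens_act (q, ps, W) i (lens_act (q, ps, W) j x)" if x: "x \<in> vecs N"
  proof (rule zeta_ext[OF N])
    fix l
    have "- ((i + j) * lens_weight ps l) = - (i * lens_weight ps l) + - (j * lens_weight ps l)" by (simp add: algebra_simps)
    then show "zeta (length ps) l (lens_act (q, ps, W) (i + j) x) =
        zeta (length ps) l (lens_act (q, ps, W) i (lens_act (q, ps, W) j x))"
      unfolding zeta_lens_act by (simp only: gam_add mult.assoc)
  qed (intro v x)+
  show "lens_act (q, ps, W) i x = lens_act (q, ps, W) j x" if x: "x \<in> vecs N" and d: "int q dvd i - j"
  proof (rule zeta_ext[OF N])
    fix l
    have "int q dvd (i - j) * - lens_weight ps l" using d by simp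
    then have "gam q (- (i * lens_weight ps l)) = gam q (- (j * lens_weight ps l))"
      by (intro gam_cong \<open>q > 0\<close>) (simp add: algebra_simps)
    then show "zeta (length ps) l (lens_act (q, ps, W) i x) = zeta (length ps) l (lens_act (q, ps, W) j x)"
      unfolding zeta_lens_act by simp
  qed (intro v x)+
  show "lens_act (q, ps, W) 0 x = x" if x: "x \<in> vecs N"
    by (rule zeta_ext[OF N v[OF x] x]) (simp add: zeta_lens_act)
qed

lemma (in isom_cyclic) MX_abs_le: "x \<in> sphere_pts N \<Longrightarrow> y \<in> sphere_pts N \<Longrightarrow> \<bar>MX x y\<bar> \<le> 1"
  using MX_attained[of x y] dot_le_1[OF _ g_sphere] by metis

lemma orbit_dist_MX:
  assumes "q > 0" and N: "2 * length ps + W = N" and x: "x \<in> sphere_pts N" and y: "y \<in> sphere_pts N"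
  shows "orbit_dist (q, ps, W) x y = arccos (isom_cyclic.MX N q (lens_act (q, ps, W)) x y)"
proof -
  interpret isom_cyclic N q "lens_act (q, ps, W)" by (rule lens_isom_cyclic) (use assms in auto)
  let ?g = "lens_act (q, ps, W)"
  have d: "\<bar>dot N x (?g k y)\<bar> \<le> 1" for k by (rule dot_le_1[OF x g_sphere[OF y]])
  have "orbit_dist (q, ps, W) x y = Min ((\<lambda>k. arccos (dot N x (?g (int k) y))) ` {..<q})"
    by (simp add: orbit_dist_def lens_N_def lens_order_def sph_dist_def N dot_def)
  also have "\<dots> = arccos (MX x y)"
  proof (rule Min_eqI)
    fix b assume "b \<in> (\<lambda>k. arccos (dot N x (?g (int k) y))) ` {..<q}"
    then obtain k where b: "b = arccos (dot N x (?g (int k) y))" by blast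
    show "arccos (MX x y) \<le> b"
      unfolding b arccos_le_mono[OF MX_abs_le[OF x y] d] by (rule MX_ge[OF sphere_vecs[OF y]])
  next
    have "MX x y \<in> (\<lambda>k. dot N x (?g (int k) y)) ` {..<q}"
      unfolding MX_def using \<open>q > 0\<close> by (intro Max_in) auto
    then show "arccos (MX x y) \<in> (\<lambda>k. arccos (dot N x (?g (int k) y))) ` {..<q}" by auto
  qed simp
  finally show ?thesis .
qed

lemma gam_cos: "gam q a + gam q (- a) = of_real (2 * cos (2 * pi * of_int a / real q))"
  by (simp add: gam_def complex_eq_iff)

lemma gam_sum_eq:
  assumes "q > 0" "gam q a + gam q (- a) = gam q b + gam q (- b)"
  shows "int q dvd a - b \<or> int q dvd a + b"
proof -
  \<comment> \<open>With \<alpha> and \<beta> for the two roots of unity, the difference of the sums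
    factors as (\<alpha> - \<beta>) (1 - 1 / (\<alpha> \<beta>)).\<close>
  have "(gam q a - gam q b) * (1 - gam q (- a - b)) =
      (gam q a + gam q (a + (- a - b)) * - 1) - (gam q b - gam q (b + (- a - b)))"
    unfolding gam_add[of q a "- a - b"] gam_add[of q b "- a - b"] by (simp add: algebra_simps)
  also have "\<dots> = 0" using assms(2) by (simp add: algebra_simps)
  finally have "gam q a = gam q b \<or> gam q (- a - b) = 1" by simp
  then show ?thesis
  proof
    assume "gam q a = gam q b"
    then have "gam q (a - b) = 1" using gam_add[of q "a - b" b] by simp
    then show ?thesis using gam_eq_1_iff[OF assms(1)] by simp
  next
    assume "gam q (- a - b) = 1"
    then have "int q dvd - (a + b)" using gam_eq_1_iff[OF assms(1), of "- a - b"] by simp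
    then show ?thesis by (simp only: dvd_minus_iff) simp
  qed
qed

text \<open>Reduction modulo q and the symmetry of the cosine leave a representative between 2 and q
  / 2, where the cosine decreases.\<close>

lemma cos_gap:
  fixes r :: int
  assumes "q > 0" "\<not> int q dvd r" "\<not> int q dvd r - 1" "\<not> int q dvd r + 1"
  shows "cos (2 * pi * of_int r / real q) \<le> cos (2 * pi * 2 / real q)"
proof -
  define s where "s = r mod int q"
  have dv: "int q dvd r - s" by (simp add: s_def dvd_minus_mod)
  have "gam q r = gam q s" by (rule gam_cong[OF assms(1) dv])
  then have cs: "cos (2 * pi * of_int r / real q) = cos (2 * pi * of_int s / real q)"
    by (simp add: gam_def complex_eq_iff)
  have s: "0 \<le> s" "s < int q" using assms(1) by (auto simp: s_def)
  have "s \<noteq> 0" using dv assms(2) by auto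
  moreover have "s \<noteq> 1" using dv assms(3) by auto
  moreover have "s \<noteq> int q - 1"
  proof
    assume "s = int q - 1"
    then have "int q dvd (r - (int q - 1)) + int q" using dv by (intro dvd_add) auto
    then show False using assms(4) by simp
  qed
  ultimately have s2: "2 \<le> s" "s \<le> int q - 2" using s by auto
  have mono: "cos (2 * pi * of_int t / real q) \<le> cos (2 * pi * 2 / real q)" if "2 \<le> t" "2 * t \<le> int q" for t :: int
  proof (rule cos_monotone_0_pi_le)
    show "0 \<le> 2 * pi * 2 / real q" by simp
    have "2 * real_of_int t \<le> real q" using that(2) by linarith
    then have "pi * (2 * real_of_int t) \<le> pi * real q" by (intro mult_left_mono) auto
    then show "2 * pi * of_int t / real q \<le> pi" using assms(1) by (simp add: field_simps)
    have "2 * pi * 2 \<le> 2 * pi * of_int t" using that(1) by (intro mult_left_mono) auto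
    then show "2 * pi * 2 / real q \<le> 2 * pi * of_int t / real q" using assms(1) by (intro divide_right_mono) auto
  qed
  show ?thesis
  proof (cases "2 * s \<le> int q")
    case True
    then show ?thesis using mono[of s] s2 cs by simp
  next
    case False
    have "2 * pi * of_int (int q - s) / real q = 2 * pi - 2 * pi * of_int s / real q"
      using assms(1) by (simp add: field_simps)
    then have "cos (2 * pi * of_int s / real q) = cos (2 * pi * of_int (int q - s) / real q)"
      by simp
    then show ?thesis using mono[of "int q - s"] s2 cs False by simp
  qed
qed

lemma unitv_sphere: "i < N \<Longrightarrow> unitv i \<in> sphere_pts N"
  using dot_unitv(1)[of i N "unitv i"] unitv_vecs by (simp add: sphere_pts_iff dot_self unitv_def)

text \<open>In a plane whose rotation number is coprime to q, no nontrivial group element fixes a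
  nonzero vector. A point with a nonzero coordinate there has trivial stabilizer, and a small push
  into the plane makes the coordinate nonzero.\<close>

lemma lens_free_dense:
  assumes q: "q > 0" and N: "2 * length ps \<le> N" and i: "i < length ps" and cop: "coprime (ps ! i) (int q)"
    and v: "v \<in> sphere_pts N" and "d > 0"
  shows "\<exists>v'\<in>sphere_pts N. dot N v' v > 1 - d \<and> (\<forall>k. \<not> int q dvd k \<longrightarrow> lens_act (q, ps, W) k v' \<noteq> v')"
proof -
  have free: "lens_act (q, ps, W) k x \<noteq> x" if "x (2 * i) \<noteq> 0" "\<not> int q dvd k" for x k
  proof
    assume fx: "lens_act (q, ps, W) k x = x"
    have z: "zeta (length ps) (2 * i) x \<noteq> 0"
      using that(1) i by (simp add: zeta_def kA_def kB_def complex_eq_iff)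
    have "gam q (- (k * lens_weight ps (2 * i))) * zeta (length ps) (2 * i) x = zeta (length ps) (2 * i) x"
      unfolding zeta_lens_act[of ps "2 * i" q W k x, symmetric] fx ..
    then have "gam q (- (k * lens_weight ps (2 * i))) = 1" using z by simp
    then have "int q dvd k * ps ! i" using gam_eq_1_iff[OF q] i by (simp add: lens_weight_def)
    then have "int q dvd k" using cop by (simp add: coprime_dvd_mult_left_iff coprime_commute)
    then show False using that(2) by simp
  qed
  show ?thesis
  proof (cases "v (2 * i) = 0")
    case False
    then show ?thesis using v \<open>d > 0\<close> free sphere_dot[OF v] by (intro bexI[of _ v]) auto
  next
    case True
    have iN: "2 * i < N" using i N by simp
    have "sqrt d > 0" using \<open>d > 0\<close> by simp
    from eventually_conj[OF eventually_at_right_less proj_near[OF v unitv_vecs[OF iN] this]]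
    have "\<exists>t>0. v + sc t (unitv (2 * i)) \<in> punctured N \<and> nrm N (proj N (v + sc t (unitv (2 * i))) - v) < sqrt d"
      by (rule eventually_happens'[rotated]) simp
    then obtain t where t: "t > 0" "v + sc t (unitv (2 * i)) \<in> punctured N"
      "nrm N (proj N (v + sc t (unitv (2 * i))) - v) < sqrt d" by blast
    define v' where "v' = proj N (v + sc t (unitv (2 * i)))"
    have S: "v' \<in> sphere_pts N" unfolding v'_def by (rule proj_sphere[OF t(2)])
    have "(nrm N (v' - v))\<^sup>2 < (sqrt d)\<^sup>2"
      using t(3) nrm_nonneg unfolding v'_def by (rule power_strict_mono) simp
    then have "dot N v' v > 1 - d" using sphere_dist[OF S v] \<open>d > 0\<close> by simp
    moreover have "v' (2 * i) \<noteq> 0"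
      using t(1,2) True nsq_pos[OF t(2)] by (simp add: v'_def proj_def sc_def unitv_def)
    ultimately show ?thesis using S free by blast
  qed
qed

text \<open>An isometry of the quotients conjugates a generator into the other group, so it carries
  rotation numbers to rotation numbers up to a common factor.\<close>
lemma lens_isometric_weights:
  assumes iso: "lens_isometric (q, ps, W) (q, ps', W)" and q: "q > 2" and len: "length ps = length ps'"
    and i0: "i0 < length ps" "coprime (ps ! i0) (int q)" and i1: "i1 < length ps'" "coprime (ps' ! i1) (int q)"
  shows "\<exists>c. \<forall>p\<in>set ps. \<not> int q dvd p \<longrightarrow> (\<exists>p'\<in>set ps'. int q dvd c * p' - p \<or> int q dvd c * p' + p)"
proof -
  define N where "N = 2 * length ps + W"
  have N: "2 * length ps \<le> N" "2 * length ps' \<le> N" "2 * length ps + W = N" "2 * length ps' + W = N"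
    by (simp_all add: N_def len)
  have q0: "q > 0" using q by simp
  let ?g = "lens_act (q, ps, W)" and ?h = "lens_act (q, ps', W)"
  interpret G: isom_cyclic N q ?g by (rule lens_isom_cyclic[OF q0 N(1)])
  interpret H: isom_cyclic N q ?h by (rule lens_isom_cyclic[OF q0 N(2)])
  have LN: "lens_N (q, ps, W) = N" "lens_N (q, ps', W) = N" by (simp_all add: lens_N_def N)
  obtain Phi where P: "(\<forall>x\<in>sphere_pts N. Phi x \<in> sphere_pts N) \<and>
      (\<forall>x\<in>sphere_pts N. \<forall>y\<in>sphere_pts N. orbit_dist (q, ps', W) (Phi x) (Phi y) = orbit_dist (q, ps, W) x y) \<and>
      (\<forall>z\<in>sphere_pts N. \<exists>x\<in>sphere_pts N. orbit_dist (q, ps', W) (Phi x) z = 0)"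
    using iso unfolding lens_isometric_def LN by (rule exE)
  have PS: "Phi x \<in> sphere_pts N" if "x \<in> sphere_pts N" for x using P that by blast
  interpret Q: quotient_isometry N q ?g ?h Phi
  proof
    fix x y assume x: "x \<in> sphere_pts N"
    show "Phi x \<in> sphere_pts N" by (rule PS[OF x])
    assume y: "y \<in> sphere_pts N"
    have "orbit_dist (q, ps', W) (Phi x) (Phi y) = orbit_dist (q, ps, W) x y" using P x y by blast
    then have "arccos (H.MX (Phi x) (Phi y)) = arccos (G.MX x y)"
      unfolding orbit_dist_MX[OF q0 N(3) x y] orbit_dist_MX[OF q0 N(4) PS[OF x] PS[OF y]] .
    then show "H.MX (Phi x) (Phi y) = G.MX x y"
      using arccos_eq_iff H.MX_abs_le[OF PS[OF x] PS[OF y]] G.MX_abs_le[OF x y] by blast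
  next
    fix z assume z: "z \<in> sphere_pts N"
    then obtain x where x: "x \<in> sphere_pts N" "orbit_dist (q, ps', W) (Phi x) z = 0" using P by blast
    then have "arccos (H.MX (Phi x) z) = arccos 1"
      unfolding orbit_dist_MX[OF q0 N(4) PS[OF x(1)] z] by simp
    then have "H.MX (Phi x) z = 1"
      using arccos_eq_iff[of "H.MX (Phi x) z" 1] H.MX_abs_le[OF PS[OF x(1)] z] by simp
    then show "\<exists>x\<in>sphere_pts N. H.MX (Phi x) z = 1" using x(1) by blast
  qed
  define p0 where "p0 = ps ! i0"
  \<comment> \<open>The power k0 rotates the plane of index i0 by the least angle 2 pi / q, so a
    unit vector of that plane is displaced least by \<open>g k0\<close> and its inverse.\<close>
  obtain k0 where k0: "int q dvd k0 * p0 - 1"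
  proof -
    obtain s t where "s * p0 + t * int q = 1"
      using i0(2) bezout_int[of p0 "int q"] by (auto simp: p0_def)
    then have "s * p0 - 1 = int q * (- t)" by (simp add: algebra_simps)
    then have "int q dvd s * p0 - 1" by (rule dvdI)
    then show ?thesis by (rule that)
  qed
  have nd1: "\<not> int q dvd k0"
  proof
    assume "int q dvd k0"
    from dvd_diff[OF dvd_mult2[OF this, of p0] k0] show False using q by simp
  qed
  have nd2: "\<not> int q dvd 2 * k0"
  proof
    assume "int q dvd 2 * k0"
    from dvd_diff[OF dvd_mult2[OF this, of p0] dvd_mult[OF k0, of 2]]
    have "int q dvd 2" by (simp add: algebra_simps)
    then show False using q zdvd_imp_le[of "int q" 2] by simp
  qed
  define e where "e = unitv (2 * i0)"
  have iN: "2 * i0 < N" using i0(1) N(1) by simp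
  have eS: "e \<in> sphere_pts N" unfolding e_def by (rule unitv_sphere[OF iN])
  have ce: "dot N e (?g k e) = cos (2 * pi * of_int (k * p0) / real q)" for k
    unfolding e_def dot_unitv(2)[OF iN] using i0(1) by (simp add: lens_act_def Let_def unitv_def p0_def)
  define c1 where "c1 = cos (2 * pi * 1 / real q)"
  define c2 where "c2 = cos (2 * pi * 2 / real q)"
  have ck0: "dot N e (?g k0 e) = c1"
  proof -
    have "gam q (k0 * p0) = gam q 1" by (rule gam_cong[OF q0 k0])
    then show ?thesis unfolding ce c1_def by (simp add: gam_def complex_eq_iff)
  qed
  have r3: "real q \<ge> 3" using q by simp
  have "c1 < 1"
  proof -
    have "cos (2 * pi * 1 / real q) < cos 0"
    proof (rule cos_monotone_0_pi)
      show "2 * pi * 1 / real q \<le> pi" using r3 by (simp add: field_simps)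
    qed (use q0 in auto)
    then show ?thesis by (simp add: c1_def)
  qed
  \<comment> \<open>For q = 3 every residue is 0, 1 or -1, so there is no second angle to compare
    with.\<close>
  have cgap: "c2 < c1 \<or> q = 3"
  proof (cases "q = 3")
    case False
    then have r4: "real q \<ge> 4" using q by simp
    have "cos (2 * pi * 2 / real q) < cos (2 * pi * 1 / real q)"
    proof (rule cos_monotone_0_pi)
      have "pi * 4 \<le> pi * real q" using r4 by (intro mult_left_mono) auto
      then show "2 * pi * 2 / real q \<le> pi" using q0 by (simp add: field_simps)
      show "2 * pi * 1 / real q < 2 * pi * 2 / real q" using q0 by (simp add: divide_strict_right_mono)
    qed simp
    then show ?thesis by (simp add: c1_def c2_def)
  qed simp
  define eta where "eta = (if q = 3 then 1 - c1 else min (1 - c1) (c1 - c2))"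
  have eta: "eta > 0" using \<open>c1 < 1\<close> cgap by (auto simp: eta_def)
  have gap: "dot N e (?g k e) + eta \<le> dot N e (?g k0 e)"
    if k: "\<not> int q dvd k" "\<not> int q dvd k - k0" "\<not> int q dvd k + k0" for k
  proof -
    have tr: "int q dvd k * p0 - s \<Longrightarrow> int q dvd k - s * k0" for s
    proof -
      assume "int q dvd k * p0 - s"
      from dvd_diff[OF dvd_mult[OF this, of k0] dvd_mult[OF k0, of k]]
      show ?thesis by (simp add: algebra_simps)
    qed
    have n: "\<not> int q dvd k * p0" "\<not> int q dvd k * p0 - 1" "\<not> int q dvd k * p0 + 1"
      using tr[of 0] tr[of 1] tr[of "-1"] k by auto
    have "q \<noteq> 3"
    proof
      assume q3: "q = 3"
      have "int q dvd k * p0 \<or> int q dvd k * p0 - 1 \<or> int q dvd k * p0 + 1"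
        unfolding q3 by presburger
      then show False using n by blast
    qed
    then show ?thesis using cos_gap[OF q0 n] unfolding ce[of k] ck0 by (simp add: eta_def c2_def)
  qed
  have gap1: "dot N e (?g k0 e) + eta \<le> 1" unfolding ck0 by (auto simp: eta_def)
  obtain a c where av: "\<And>i. i < N \<Longrightarrow> a i \<in> vecs N"
    and on: "\<And>i j. i < N \<Longrightarrow> j < N \<Longrightarrow> dot N (a i) (a j) = (if i = j then 1 else 0)"
    and cj: "\<And>x. x \<in> vecs N \<Longrightarrow> lincomb N a (?g (- k0) x) = ?h c (lincomb N a x)"
    using Q.conjugate[OF eS nd1 nd2 eta gap gap1 lens_free_dense[OF q0 N(2) i1]] by blast
  have "\<exists>p'\<in>set ps'. int q dvd (c * p0) * p' - p \<or> int q dvd (c * p0) * p' + p"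
    if p: "p \<in> set ps" "\<not> int q dvd p" for p
  proof -
    obtain i where i: "i < length ps" "ps ! i = p" using p(1) by (auto simp: in_set_conv_nth)
    have iN: "2 * i < N" using i(1) N(1) by simp
    \<comment> \<open>A rotation has in general no real eigenvector, but
      \<open>g (- k0) + g k0\<close> multiplies f by the scalar C. The image X of f is then an
      eigenvector of \<open>h c + h (- c)\<close>, and any nonzero coordinate of X reveals a
      matching rotation number.\<close>
    define f where "f = unitv (2 * i)"
    have fv: "f \<in> vecs N" unfolding f_def by (rule unitv_vecs[OF iN])
    define C where "C = 2 * cos (2 * pi * of_int (k0 * p) / real q)"
    have gf: "?g (- k0) f + ?g k0 f = sc C f"
    proof (rule zeta_ext[OF N(1)])
      show "?g (- k0) f + ?g k0 f \<in> vecs N" "sc C f \<in> vecs N" by (intro vecs_ops G.g_vecs fv)+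
      fix l assume "l < N"
      have za: "zeta (length ps) l (x + y) = zeta (length ps) l x + zeta (length ps) l y" for x y
        by (simp add: zeta_def algebra_simps)
      have zs: "zeta (length ps) l (sc C f) = of_real C * zeta (length ps) l f"
        by (simp add: zeta_def sc_def algebra_simps)
      show "zeta (length ps) l (?g (- k0) f + ?g k0 f) = zeta (length ps) l (sc C f)"
      proof (cases "zeta (length ps) l f = 0")
        case True
        then show ?thesis unfolding za zs zeta_lens_act by simp
      next
        case False
        then have "l = 2 * i \<or> par (length ps) l = 2 * i"
          by (auto simp: zeta_def f_def unitv_def split: if_splits)
        then have "l = 2 * i \<or> l = Suc (2 * i)"
          using i(1) by (auto simp: par_eq_iff) (auto simp: par_def)
        then have "lens_weight ps l = p \<or> lens_weight ps l = - p" using i by (auto simp: lens_weight_def)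
        then have "gam q (- (- k0 * lens_weight ps l)) + gam q (- (k0 * lens_weight ps l)) = of_real C"
          using gam_cos[of q "k0 * p"] unfolding C_def by (auto simp: add.commute)
        then show ?thesis unfolding za zs zeta_lens_act by (simp only: distrib_right[symmetric])
      qed
    qed
    define X where "X = lincomb N a f"
    have Xv: "X \<in> vecs N" unfolding X_def lincomb_def vecs_def
    proof (intro CollectI allI impI sum.neutral ballI)
      fix j i assume "N \<le> j" "i \<in> {..<N}"
      then show "f i * a i j = 0" using av[of i] by (simp add: vecs_def)
    qed
    have X1: "dot N X X = 1"
      using dot_lincomb_orthonormal[OF on, of f f] sphere_dot[OF unitv_sphere[OF iN]]
      unfolding X_def f_def by simp
    have "X = ?h c (lincomb N a (?g k0 f))"
      using cj[OF G.g_vecs[OF fv, of k0]] G.g_inv[OF fv] by (simp add: X_def)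
    moreover have gkv: "lincomb N a (?g k0 f) \<in> vecs N" unfolding lincomb_def vecs_def
    proof (intro CollectI allI impI sum.neutral ballI)
      fix j i assume "N \<le> j" "i \<in> {..<N}"
      then show "?g k0 f i * a i j = 0" using av[of i] by (simp add: vecs_def)
    qed
    ultimately have "?h (- c) X = lincomb N a (?g k0 f)" using H.g_inv[OF gkv] by simp
    then have hX: "?h c X + ?h (- c) X = sc C X"
      using cj[OF fv] gf lincomb_add[of N a "?g (- k0) f" "?g k0 f"] lincomb_sc[of N a C f] by (simp add: X_def)
    have "\<exists>l<N. zeta (length ps') l X \<noteq> 0"
    proof (rule ccontr)
      assume "\<not> (\<exists>l<N. zeta (length ps') l X \<noteq> 0)"
      then have "dot N X X = 0" unfolding dot_zeta[OF N(2), symmetric] by simp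
      then show False using X1 by simp
    qed
    then obtain l where l: "l < N" "zeta (length ps') l X \<noteq> 0" by blast
    let ?w = "lens_weight ps' l"
    have "(gam q (- (c * ?w)) + gam q (- (- c * ?w))) * zeta (length ps') l X =
        zeta (length ps') l (?h c X + ?h (- c) X)"
      by (simp only: zeta_lens_act distrib_right) (simp add: zeta_def zeta_lens_act[unfolded zeta_def] algebra_simps)
    also have "\<dots> = of_real C * zeta (length ps') l X"
      unfolding hX by (simp add: zeta_def sc_def algebra_simps)
    finally have "gam q (- (c * ?w)) + gam q (- (- c * ?w)) = of_real C" using l(2) by simp
    then have "gam q (c * ?w) + gam q (- (c * ?w)) = gam q (k0 * p) + gam q (- (k0 * p))"
      unfolding gam_cos[of q "k0 * p"] C_def by (simp add: add.commute)
    from gam_sum_eq[OF q0 this]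
    \<comment> \<open>Multiplication by p0 cancels k0.\<close>
    have "int q dvd (c * p0) * ?w - p \<or> int q dvd (c * p0) * ?w + p"
    proof
      assume "int q dvd c * ?w - k0 * p"
      from dvd_add[OF dvd_mult[OF this, of p0] dvd_mult[OF k0, of p]]
      show ?thesis by (simp add: algebra_simps)
    next
      assume "int q dvd c * ?w + k0 * p"
      from dvd_diff[OF dvd_mult[OF this, of p0] dvd_mult[OF k0, of p]]
      show ?thesis by (simp add: algebra_simps)
    qed
    note D = this
    show ?thesis
    proof (cases "l < 2 * length ps'")
      case False
      \<comment> \<open>Beyond the planes the weight is 0, so q would divide p.\<close>
      then show ?thesis using D p(2) by (simp add: lens_weight_def)
    next
      case True
      then have m: "ps' ! (l div 2) \<in> set ps'" by (intro nth_mem) auto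
      have "?w = ps' ! (l div 2) \<or> ?w = - (ps' ! (l div 2))" using True by (auto simp: lens_weight_def)
      then show ?thesis
      proof
        assume "?w = - (ps' ! (l div 2))"
        then have e: "(c * p0) * ?w - p = - ((c * p0) * ps' ! (l div 2) + p)"
          "(c * p0) * ?w + p = - ((c * p0) * ps' ! (l div 2) - p)"
          by (simp_all add: right_diff_distrib)
        show ?thesis using D m unfolding e dvd_minus_iff by blast
      qed (use D m in auto)
    qed
  qed
  then show ?thesis by blast
qed

section \<open>Construction of the pairs\<close>

text \<open>The numbers s and t supply the coprime rotation numbers that
  \<open>lens_isometric_weights\<close> asks for. Every remaining number of the first space is, up
  to sign, c times a remaining number of the second; as multiplication by c is injective up to sign,
  \<open>c * 1\<close> and \<open>c * b\<close> can only fall on the deleted 1 and a.\<close>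

lemma complement_weights_not_isometric:
  assumes q: "q > 2" and a: "a \<in> {2..int (q div 2)}" and b: "b \<in> {2..int (q div 2)}"
    and ab: "a \<noteq> b" "\<not> int q dvd a * b - 1" "\<not> int q dvd a * b + 1"
    and s: "s \<in> {2..int (q div 2)}" "s \<noteq> a" "coprime s (int q)"
    and t: "t \<in> {2..int (q div 2)}" "t \<noteq> b" "coprime t (int q)"
  shows "\<not> lens_isometric (q, complement_weights q a, W) (q, complement_weights q b, W)"
proof
  assume iso: "lens_isometric (q, complement_weights q a, W) (q, complement_weights q b, W)"
  have sm: "s \<in> set (complement_weights q a)" "t \<in> set (complement_weights q b)" using s t by (auto simp: set_complement_weights)
  obtain i0 where i0: "i0 < length (complement_weights q a)" "complement_weights q a ! i0 = s" using sm by (auto simp: in_set_conv_nth)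
  obtain i1 where i1: "i1 < length (complement_weights q b)" "complement_weights q b ! i1 = t" using sm by (auto simp: in_set_conv_nth)
  have len: "length (complement_weights q a) = length (complement_weights q b)" using length_complement_weights[OF a] length_complement_weights[OF b] by simp
  obtain c where c: "\<And>p. p \<in> set (complement_weights q a) \<Longrightarrow> \<not> int q dvd p \<Longrightarrow>
      \<exists>p'\<in>set (complement_weights q b). int q dvd c * p' - p \<or> int q dvd c * p' + p"
    using lens_isometric_weights[OF iso q len i0(1) _ i1(1)] i0(2) i1(2) s(3) t(3) by blast
  let ?R = "{1..int (q div 2)}"
  have nd: "\<not> int q dvd p" if "p \<in> ?R" for p
  proof
    assume "int q dvd p"
    then have "int q \<le> p" using that by (intro zdvd_imp_le) auto
    then show False using that q by auto
  qed
  \<comment> \<open>A common divisor of c and q would divide s, which is c times some number modulo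
    q and sign.\<close>
  have cop: "coprime c (int q)"
  proof -
    have sR: "s \<in> ?R" using s(1) by auto
    obtain p' where p': "int q dvd c * p' - s \<or> int q dvd c * p' + s"
      using c[OF sm(1) nd[OF sR]] by blast
    have "is_unit d" if d: "d dvd c" "d dvd int q" for d
    proof -
      have "d dvd s"
        using p'
      proof
        assume "int q dvd c * p' - s"
        then have "d dvd c * p' - (c * p' - s)" by (rule dvd_diff[OF dvd_mult2[OF d(1)] dvd_trans[OF d(2)]])
        then show ?thesis by simp
      next
        assume "int q dvd c * p' + s"
        then have "d dvd (c * p' + s) - c * p'" by (rule dvd_diff[OF dvd_trans[OF d(2)] dvd_mult2[OF d(1)]])
        then show ?thesis by simp
      qed
      then show ?thesis by (rule coprime_common_divisor[OF s(3) _ d(2)])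
    qed
    then show ?thesis by (rule coprimeI)
  qed
  have cancel: "p = p'" if "p \<in> ?R" "p' \<in> ?R" "int q dvd c * p - c * p' \<or> int q dvd c * p + c * p'" for p p'
  proof -
    have "int q dvd c * (p - p') \<or> int q dvd c * (p + p')" using that(3) by (simp add: algebra_simps)
    then have "int q dvd p - p' \<or> int q dvd p + p'"
      using cop by (simp add: coprime_dvd_mult_right_iff coprime_commute)
    then show ?thesis by (rule half_residue_eq[OF that(1,2)])
  qed
  have rep: "\<exists>r\<in>?R. int q dvd x - r \<or> int q dvd x + r" if "\<not> int q dvd x" for x
  proof -
    have m: "x mod int q \<noteq> 0" "0 \<le> x mod int q" "x mod int q < int q"
      using that q by (auto simp: dvd_eq_mod_eq_0)
    have d: "int q dvd x - x mod int q" by (simp add: dvd_minus_mod)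
    show ?thesis
    proof (cases "x mod int q \<le> int (q div 2)")
      case True
      then show ?thesis using d m by (intro bexI[of _ "x mod int q"]) auto
    next
      case False
      have "int q dvd (x - x mod int q) + int q" using d by simp
      then have "int q dvd x + (int q - x mod int q)" by (simp add: algebra_simps)
      then show ?thesis using False m by (intro bexI[of _ "int q - x mod int q"]) auto
    qed
  qed
  have key: "\<exists>r\<in>{1, a}. int q dvd c * p - r \<or> int q dvd c * p + r" if p: "p \<in> {1, b}" for p
  proof -
    have pR: "p \<in> ?R" using p b q by auto
    have "\<not> int q dvd c * p"
      using nd[OF pR] cop by (simp add: coprime_dvd_mult_right_iff coprime_commute)
    then obtain r where r: "r \<in> ?R" "int q dvd c * p - r \<or> int q dvd c * p + r" using rep by blast
    have "r \<in> {1, a}"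
    proof (rule ccontr)
      assume "r \<notin> {1, a}"
      then have "r \<in> set (complement_weights q a)" using r(1) by (auto simp: set_complement_weights)
      then obtain p' where p': "p' \<in> set (complement_weights q b)" "int q dvd c * p' - r \<or> int q dvd c * p' + r"
        using c nd[OF r(1)] by blast
      have "int q dvd c * p - c * p' \<or> int q dvd c * p + c * p'"
        using r(2) p'(2)
      proof (elim disjE)
        assume "int q dvd c * p - r" "int q dvd c * p' - r"
        from dvd_diff[OF this] show ?thesis by simp
      next
        assume "int q dvd c * p - r" "int q dvd c * p' + r"
        from dvd_add[OF this] show ?thesis by simp
      next
        assume "int q dvd c * p + r" "int q dvd c * p' - r"
        from dvd_add[OF this] show ?thesis by simp
      next
        assume "int q dvd c * p + r" "int q dvd c * p' + r"
        from dvd_diff[OF this] show ?thesis by simp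
      qed
      then have "p = p'" by (intro cancel[OF pR]) (use p'(1) in \<open>auto simp: set_complement_weights\<close>)
      then show False using p p'(1) by (auto simp: set_complement_weights)
    qed
    then show ?thesis using r(2) by blast
  qed
  \<comment> \<open>The classes of \<open>c * 1\<close> and \<open>c * b\<close>. If r1 = 1 then b =
    rb, hence b is 1 or a; if r1 = a and rb = 1 then a b is 1 up to sign; r1 = rb contradicts
    injectivity.\<close>
  obtain r1 where r1: "r1 \<in> {1, a}" "int q dvd c * 1 - r1 \<or> int q dvd c * 1 + r1" using key[of 1] by blast
  obtain rb where rb: "rb \<in> {1, a}" "int q dvd c * b - rb \<or> int q dvd c * b + rb" using key[of b] by blast
  have R1: "1 \<in> ?R" using q by auto
  have Rb: "b \<in> ?R" "a \<in> ?R" using a b by auto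
  have eqb: "int q dvd r1 * b - rb \<or> int q dvd r1 * b + rb"
    using r1(2) rb(2)
  proof (elim disjE)
    assume "int q dvd c * 1 - r1" "int q dvd c * b - rb"
    from dvd_diff[OF this(2) dvd_mult2[OF this(1), of b]] show ?thesis by (simp add: algebra_simps)
  next
    assume "int q dvd c * 1 - r1" "int q dvd c * b + rb"
    from dvd_diff[OF this(2) dvd_mult2[OF this(1), of b]] show ?thesis by (simp add: algebra_simps)
  next
    assume "int q dvd c * 1 + r1" "int q dvd c * b - rb"
    from dvd_diff[OF dvd_mult2[OF this(1), of b] this(2)] show ?thesis by (simp add: algebra_simps)
  next
    assume "int q dvd c * 1 + r1" "int q dvd c * b + rb"
    from dvd_diff[OF dvd_mult2[OF this(1), of b] this(2)] show ?thesis by (simp add: algebra_simps)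
  qed
  show False
  proof (cases "r1 = 1")
    case True
    have "b = rb" by (rule half_residue_eq[OF Rb(1)]) (use eqb rb(1) R1 Rb True in auto)
    then show False using rb(1) ab(1) b by auto
  next
    case False
    then have ra: "r1 = a" using r1(1) by simp
    show False
    proof (cases "rb = 1")
      case True
      then show False using eqb ra ab(2,3) by simp
    next
      case False
      then have "rb = r1" using rb(1) ra by simp
      then have d: "int q dvd c * b - r1 \<or> int q dvd c * b + r1" using rb(2) by simp
      have "int q dvd c * 1 - c * b \<or> int q dvd c * 1 + c * b"
        using r1(2) d
      proof (elim disjE)
        assume "int q dvd c * 1 - r1" "int q dvd c * b - r1"
        from dvd_diff[OF this] show ?thesis by simp
      next
        assume "int q dvd c * 1 - r1" "int q dvd c * b + r1"
        from dvd_add[OF this] show ?thesis by simp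
      next
        assume "int q dvd c * 1 + r1" "int q dvd c * b - r1"
        from dvd_add[OF this] show ?thesis by simp
      next
        assume "int q dvd c * 1 + r1" "int q dvd c * b + r1"
        from dvd_diff[OF this] show ?thesis by simp
      qed
      then have "1 = b" by (rule cancel[OF R1 Rb(1)])
      then show False using b by simp
    qed
  qed
qed

lemma valid_complement_weights:
  assumes "q > 2" "s \<in> {2..int (q div 2)}" "s \<noteq> a" "coprime s (int q)"
  shows "valid_lens (q, complement_weights q a, W)"
proof -
  have s: "s \<in> set (complement_weights q a)" using assms by (auto simp: set_complement_weights)
  have "d dvd 1" if "d dvd int q" "\<forall>p\<in>set (complement_weights q a). d dvd p" for d
    using coprime_common_divisor[OF assms(4)] that s by blast
  then show ?thesis using assms(1) s by (auto simp: valid_lens_def)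
qed

lemma isospec_noniso_pair_complement_weights:
  assumes q: "q > 2" and a: "a \<in> {2..int (q div 2)}" and b: "b \<in> {2..int (q div 2)}"
    and ab: "a \<noteq> b" "\<not> int q dvd a * b - 1" "\<not> int q dvd a * b + 1"
    and s: "s \<in> {2..int (q div 2)}" "s \<noteq> a" "coprime s (int q)"
    and t: "t \<in> {2..int (q div 2)}" "t \<noteq> b" "coprime t (int q)"
    and T1: "ramanujan_fps q W a = ramanujan_fps q W b"
    and T2: "ramanujan_fps q W (1 + a) + ramanujan_fps q W (1 - a) = ramanujan_fps q W (1 + b) + ramanujan_fps q W (1 - b)"
    and d: "d = 2 * (q div 2 - 2) + W - 1"
  shows "isospec_noniso_pair q d"
proof -
  have "s \<in> set (complement_weights q a)" using s by (auto simp: set_complement_weights)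
  then have ne: "complement_weights q a \<noteq> []" by auto
  have "isospectral (q, complement_weights q a, W) (q, complement_weights q b, W)"
    by (rule isospectral_complement_weights[OF _ a b ne T1 T2]) (use q in simp)
  moreover have "\<not> lens_isometric (q, complement_weights q a, W) (q, complement_weights q b, W)"
    by (rule complement_weights_not_isometric[OF q a b ab s t])
  ultimately show ?thesis
    unfolding isospec_noniso_pair_def
    using valid_complement_weights[OF q s] valid_complement_weights[OF q t]
    by (intro exI[of _ "(q, complement_weights q a, W)"] exI[of _ "(q, complement_weights q b, W)"])
      (simp add: lens_order_def lens_dim_def lens_N_def length_complement_weights[OF a] length_complement_weights[OF b] d)
qed

section \<open>The individual orders q\<close>

lemma not_int_dvd_small: "0 < x \<Longrightarrow> x < int q \<Longrightarrow> \<not> int q dvd x"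
  using zdvd_not_zless by blast

text \<open>The deleted pairs are \<open>{1, 2}\<close> and \<open>{1, 4}\<close>, or \<open>{1, 2}\<close> and \<open>{1, 3}\<close> when 5 divides q.\<close>
lemma pair_odd:
  assumes q: "odd q" "q > 10" and c5: "coprime 5 (int q) \<or> coprime 3 (int q)"
  shows "isospec_noniso_pair q (q + W - 6)"
proof -
  have q0: "q > 0" using q by simp
  obtain k where k: "q = 2 * k + 1" using q(1) by (elim oddE)
  then have k5: "k \<ge> 5" "q div 2 = k" using q(2) by auto
  have d: "q + W - 6 = 2 * (q div 2 - 2) + W - 1" using k k5 by simp
  have cop2: "coprime 2 (int q)" using q(1) by simp
  have cop4: "coprime 4 (int q)"
    using coprime_power_left_iff[of 2 2 "int q"] cop2 by simp
  note T = ramanujan_fps_coprime[OF q0, of _ W]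
  have Tm1: "ramanujan_fps q W (- 1) = ramanujan_fps q W 1" by (rule ramanujan_fps_uminus)
  show ?thesis
    using c5
  proof
    \<comment> \<open>The numbers 1 + a, 1 - a are 3, -1 and 1 + b, 1 - b are 5, -3: the terms at 3
      and -3 agree by parity, and -1 and 5 are units.\<close>
    assume c5: "coprime 5 (int q)"
    show ?thesis
    proof (rule isospec_noniso_pair_complement_weights[where a=2 and b=4 and s=4 and t=2, OF _ _ _ _ _ _ _ _ cop4 _ _ cop2 _ _ d])
      show "\<not> int q dvd 2 * 4 - 1" "\<not> int q dvd 2 * 4 + 1"
        using not_int_dvd_small[of 7 q] not_int_dvd_small[of 9 q] q(2) by auto
      show "ramanujan_fps q W 2 = ramanujan_fps q W 4" using T[OF cop2] T[OF cop4] by simp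
      have "ramanujan_fps q W (- 3) = ramanujan_fps q W 3" by (rule ramanujan_fps_uminus)
      then show "ramanujan_fps q W (1 + 2) + ramanujan_fps q W (1 - 2) = ramanujan_fps q W (1 + 4) + ramanujan_fps q W (1 - 4)"
        using T[OF c5] Tm1 by simp
    qed (use k5 q in auto)
  next
    \<comment> \<open>Now the four numbers are 3, -1, 4 and -2, all of them units.\<close>
    assume c3: "coprime 3 (int q)"
    show ?thesis
    proof (rule isospec_noniso_pair_complement_weights[where a=2 and b=3 and s=3 and t=2, OF _ _ _ _ _ _ _ _ c3 _ _ cop2 _ _ d])
      show "\<not> int q dvd 2 * 3 - 1" "\<not> int q dvd 2 * 3 + 1"
        using not_int_dvd_small[of 5 q] not_int_dvd_small[of 7 q] q(2) by auto
      show "ramanujan_fps q W 2 = ramanujan_fps q W 3" using T[OF cop2] T[OF c3] by simp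
      have "ramanujan_fps q W (- 2) = ramanujan_fps q W 2" by (rule ramanujan_fps_uminus)
      then show "ramanujan_fps q W (1 + 2) + ramanujan_fps q W (1 - 2) = ramanujan_fps q W (1 + 3) + ramanujan_fps q W (1 - 3)"
        using T[OF c3] T[OF cop2] T[OF cop4] Tm1 by simp
    qed (use k5 q in auto)
  qed
qed

lemma prime_coprime_int:
  assumes "prime p" "prime r" "p \<noteq> (r::nat)"
  shows "coprime (int p) (int r)"
  using primes_coprime[OF assms] by simp

text \<open>The units 3 and 5 are deleted next to 1. The numbers 1 + a, 1 - a, 1 + b, 1 - b are 4,
  -2, 6, -4, and 6 is the unit -3 times -2.\<close>

lemma pair_power_of_2:
  assumes "m \<ge> (6::nat)"
  shows "isospec_noniso_pair (2 ^ m) (2 ^ m + W - 5)"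
proof -
  define q :: nat where "q = 2 ^ m"
  have "(2::nat) ^ 6 \<le> 2 ^ m" using assms by (intro power_increasing) auto
  then have q64: "q \<ge> 64" by (simp add: q_def)
  have q0: "q > 0" using q64 by simp
  have ev: "even q" using assms by (simp add: q_def)
  have cop: "coprime x (int q)" if "odd x" for x :: int
    using that by (simp add: q_def)
  have d: "q + W - 5 = 2 * (q div 2 - 2) + W - 1" using ev q64 by (auto elim!: evenE)
  note T = ramanujan_fps_coprime[OF q0, of _ W]
  have c3: "coprime 3 (int q)" and c5: "coprime 5 (int q)" and c3': "coprime (- 3) (int q)" by (rule cop; simp)+
  have "isospec_noniso_pair q (q + W - 5)"
  proof (rule isospec_noniso_pair_complement_weights[where a=3 and b=5 and s=5 and t=3, OF _ _ _ _ _ _ _ _ c5 _ _ c3 _ _ d])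
    show "\<not> int q dvd 3 * 5 - 1" "\<not> int q dvd 3 * 5 + 1"
      using not_int_dvd_small[of 14 q] not_int_dvd_small[of 16 q] q64 by auto
    show "ramanujan_fps q W 3 = ramanujan_fps q W 5" using T[OF c3] T[OF c5] by simp
    have "ramanujan_fps q W (- 3 * - 2) = ramanujan_fps q W (- 2)" by (rule ramanujan_fps_unit[OF q0 c3'])
    moreover have "ramanujan_fps q W (- 4) = ramanujan_fps q W 4" by (rule ramanujan_fps_uminus)
    ultimately show "ramanujan_fps q W (1 + 3) + ramanujan_fps q W (1 - 3) = ramanujan_fps q W (1 + 5) + ramanujan_fps q W (1 - 5)" by simp
  qed (use q64 in auto)
  then show ?thesis by (simp add: q_def)
qed

text \<open>Here 2 and 4 are not units but still associates: 2 (P + 2) is 4 modulo 2 P, and P + 2 is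
  odd and coprime to P. The numbers 3, -1 and 5, -3 match because 5 is a unit, and 3 serves as the
  coprime rotation number of both spaces.\<close>

lemma pair_twice_prime:
  assumes P: "prime (P::nat)" "odd P" "P \<ge> 7"
  shows "isospec_noniso_pair (2 * P) (2 * P + W - 5)"
proof -
  define q where "q = 2 * P"
  have q0: "q > 0" using P by (simp add: q_def)
  have d: "q + W - 5 = 2 * (q div 2 - 2) + W - 1" using P by (simp add: q_def)
  have cop: "coprime (int r) (int q)" if "prime r" "odd r" "r \<noteq> P" for r
  proof -
    have "coprime (int r) (int P)" by (rule prime_coprime_int[OF that(1) P(1) that(3)])
    moreover have "coprime (int r) 2" using that(2) by simp
    ultimately show ?thesis by (simp add: q_def)
  qed
  have p3: "prime (3::nat)" and p5: "prime (5::nat)" by simp_all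
  have c3: "coprime 3 (int q)" using cop[OF p3] P by simp
  have c5: "coprime 5 (int q)" using cop[OF p5] P by simp
  have cu: "coprime (int P + 2) (int q)"
  proof -
    have "coprime 2 (int P)" using P(2) by simp
    then have "coprime (int P + 2) (int P)" 
      using gcd_add1[of 2 "int P"] by (simp add: coprime_iff_gcd_eq_1 add.commute)
    moreover have "coprime (int P + 2) 2" using P(2) by simp
    ultimately show ?thesis by (simp add: q_def)
  qed
  note T = ramanujan_fps_coprime[OF q0, of _ W]
  have "isospec_noniso_pair q (q + W - 5)"
  proof (rule isospec_noniso_pair_complement_weights[where a=2 and b=4 and s=3 and t=3, OF _ _ _ _ _ _ _ _ c3 _ _ c3 _ _ d])
    show "\<not> int q dvd 2 * 4 - 1" "\<not> int q dvd 2 * 4 + 1"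
      using not_int_dvd_small[of 7 q] not_int_dvd_small[of 9 q] P by (auto simp: q_def)
    have "ramanujan_fps q W ((int P + 2) * 2) = ramanujan_fps q W 2" by (rule ramanujan_fps_unit[OF q0 cu])
    moreover have "ramanujan_fps q W ((int P + 2) * 2) = ramanujan_fps q W 4"
      by (rule ramanujan_fps_cong[OF q0]) (simp add: q_def algebra_simps)
    ultimately show "ramanujan_fps q W 2 = ramanujan_fps q W 4" by simp
    have "ramanujan_fps q W (- 1) = ramanujan_fps q W 1" "ramanujan_fps q W (- 3) = ramanujan_fps q W 3" by (rule ramanujan_fps_uminus)+
    then show "ramanujan_fps q W (1 + 2) + ramanujan_fps q W (1 - 2) = ramanujan_fps q W (1 + 4) + ramanujan_fps q W (1 - 4)"
      using T[OF c3] T[OF c5] by simp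
  qed (use P in \<open>auto simp: q_def\<close>)
  then show ?thesis by (simp add: q_def)
qed

text \<open>Powers of 5 use the unit 3, all others the unit 5.\<close>

lemma pair_odd_prime_power:
  assumes P: "prime (P::nat)" "odd P" "(P \<ge> 5 \<and> m \<ge> 2) \<or> (P \<ge> 3 \<and> m \<ge> (3::nat))"
  shows "isospec_noniso_pair (P ^ m) (P ^ m + W - 6)"
proof (rule pair_odd)
  show "odd (P ^ m)" using P(2) by simp
  show "P ^ m > 10"
    using P(3)
  proof
    assume h: "P \<ge> 5 \<and> m \<ge> 2"
    have "5 ^ 2 \<le> P ^ 2" using h by (intro power_mono) auto
    also have "\<dots> \<le> P ^ m" using h by (intro power_increasing) auto
    finally show ?thesis by simp
  next
    assume h: "P \<ge> 3 \<and> m \<ge> 3"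
    have "3 ^ 3 \<le> P ^ 3" using h by (intro power_mono) auto
    also have "\<dots> \<le> P ^ m" using h by (intro power_increasing) auto
    finally show ?thesis by simp
  qed
  show "coprime 5 (int (P ^ m)) \<or> coprime 3 (int (P ^ m))"
  proof (cases "P = 5")
    case True
    have "coprime (int 3) (int P)" by (rule prime_coprime_int) (use P(1) True in auto)
    then show ?thesis by simp
  next
    case False
    have "coprime (int 5) (int P)" by (rule prime_coprime_int) (use P(1) False in auto)
    then show ?thesis by simp
  qed
qed

text \<open>If 5 divides q, the bound excludes q = 15 and so 3 is a unit; otherwise 5 is
  one.\<close>

lemma pair_two_primes:
  assumes P: "prime (P1::nat)" "prime P2" "odd P1" "odd P2" "P1 \<noteq> P2" "P1 * P2 \<ge> 33"
  shows "isospec_noniso_pair (P1 * P2) (P1 * P2 + W - 6)"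
proof (rule pair_odd)
  show "odd (P1 * P2)" using P by simp
  show "P1 * P2 > 10" using P(6) by simp
  have c: "coprime (int r) (int (P1 * P2))" if "prime r" "r \<noteq> P1" "r \<noteq> P2" for r
    using prime_coprime_int[OF that(1) P(1) that(2)] prime_coprime_int[OF that(1) P(2) that(3)] by simp
  have p3: "prime (3::nat)" and p5: "prime (5::nat)" by simp_all
  show "coprime 5 (int (P1 * P2)) \<or> coprime 3 (int (P1 * P2))"
  proof (cases "P1 = 5 \<or> P2 = 5")
    case True
    then have "P1 \<noteq> 3" "P2 \<noteq> 3" using P(6) by auto
    then show ?thesis using c[OF p3] by simp
  next
    case False
    then show ?thesis using c[OF p5] by simp
  qed
qed

theorem theorem3p2p5:
  fixes W :: nat
  shows "(\<forall>(P::nat) m. prime P \<and> odd P \<and> ((P \<ge> 5 \<and> m \<ge> 2) \<or> (P \<ge> 3 \<and> m \<ge> 3)) \<longrightarrow>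
            isospec_noniso_pair (P ^ m) (P ^ m + W - 6))
       \<and> (\<forall>(P1::nat) P2. prime P1 \<and> prime P2 \<and> odd P1 \<and> odd P2 \<and> P1 \<noteq> P2 \<and> P1 * P2 \<ge> 33 \<longrightarrow>
            isospec_noniso_pair (P1 * P2) (P1 * P2 + W - 6))
       \<and> (\<forall>m::nat. m \<ge> 6 \<longrightarrow> isospec_noniso_pair (2 ^ m) (2 ^ m + W - 5))
       \<and> (\<forall>P::nat. prime P \<and> odd P \<and> P \<ge> 7 \<longrightarrow> isospec_noniso_pair (2 * P) (2 * P + W - 5))"
  by (intro conjI allI impI; (elim conjE)?;
      rule pair_odd_prime_power pair_two_primes pair_power_of_2 pair_twice_prime; assumption)

end
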